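(* Let $\mathcal{P}$ be a grid poset, and let $\mathcal{E}$ be the spread exact structure on $\operatorname{rep}\mathcal{P}$. An object $X\in\operatorname{rep}\mathcal{P}$ is $\mathcal{E}$-projective if and only if $X$ is isomorphic to a finite direct sum of finitely presented spread representations. Moreover, every finitely presented representation of $\mathcal{P}$ admits a spread-resolution of finite length.
   Context: Fix a field $\mathbb{k}$. A poset $\mathcal{P}$ is viewed as a category with one morphism $x\to y$ iff $x\le y$; a representation of $\mathcal{P}$ is a functor $\mathcal{P}\to\mathrm{Vec}_\mathbb{k}$. For $S\subseteq\mathcal{P}$ let $\uparrow S=\{p:\exists s\in S,\ s\le p\}$. A subset $S$ is convex if $s\le p\le s'$ with $s,s'\in S$ implies $p\in S$; connected if it is nonempty and any two elements are joined by a zigzag $s_0\le s_1\ge s_2\le\cdots s_k$ inside $S$; a spread if convex and connected. For convex $S$, the indicator representation $\mathbb{k}_S$ takes value $\mathbb{k}$ on $S$ and $0$ elsewhere, with identity maps $\mathbb{k}_S(p\le p')$ when $p,p'\in S$ and zero otherwise; if $S$ is a spread this is a spread representation. A representation is finitely presented if it is the cokernel of a morphism between finite direct sums of representations $\mathbb{k}_{\uparrow\{p\}}$, $p\in\mathcal{P}$; $\operatorname{rep}\mathcal{P}$ is the category of finitely presented representations. $\operatorname{add}\operatorname{spread}(\mathcal{P})$ is the full subcategory of $\operatorname{rep}\mathcal{P}$ of objects isomorphic to direct summands of finite direct sums of finitely presented spread representations. A spread-approximation of $M$ is a morphism $f:C\to M$ with $C\in\operatorname{add}\operatorname{spread}(\mathcal{P})$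 such that $\operatorname{Hom}(Z,f)$ is surjective for all $Z\in\operatorname{add}\operatorname{spread}(\mathcal{P})$. A spread-resolution of $M$ is a sequence $\cdots\to C_1\xrightarrow{f_1}C_0\xrightarrow{f_0}M\to 0$ in which each corestriction $C_i\to\ker f_{i-1}$ (with $f_{-1}:M\to 0$) is a spread-approximation; its length is the least $i$ with $C_{i+1}=0$ (or $\infty$). The spread exact structure $\mathcal{E}$ is the class of short exact sequences $0\to L\to M\to N\to 0$ in $\operatorname{rep}\mathcal{P}$ that remain exact after applying $\operatorname{Hom}(\mathbb{k}_S,-)$ for every finitely presented spread $S$; an object $X$ is $\mathcal{E}$-projective if $\operatorname{Hom}(X,-)$ sends every sequence in $\mathcal{E}$ to a short exact sequence. A grid poset is a finite product $\mathcal{T}_1\times\cdots\times\mathcal{T}_n$ of totally ordered sets with the product order. *)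

theory Defs
  imports "Jordan_Normal_Form.Matrix"
begin

text \<open>Representations of a poset (P, lq) over a field 'k, encoded pointwise by
coordinate spaces 'k^(dm p) and structure matrices mp p q for p lq q.
Finitely presented representations are pointwise finite-dimensional, so this
encoding covers rep P.\<close>

record ('p, 'k) prep =
  dm :: "'p \<Rightarrow> nat"
  mp :: "'p \<Rightarrow> 'p \<Rightarrow> 'k mat"

definition is_rep :: "'p set \<Rightarrow> ('p \<Rightarrow> 'p \<Rightarrow> bool) \<Rightarrow> ('p, 'k::field) prep \<Rightarrow> bool" where
  "is_rep P lq X \<longleftrightarrow>
     (\<forall>p\<in>P. \<forall>q\<in>P. lq p q \<longrightarrow> mp X p q \<in> carrier_mat (dm X q) (dm X p)) \<and>
     (\<forall>p\<in>P. mp X p p = 1\<^sub>m (dm X p)) \<and>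
     (\<forall>p\<in>P. \<forall>q\<in>P. \<forall>r\<in>P. lq p q \<and> lq q r \<longrightarrow> mp X p r = mp X q r * mp X p q)"

definition is_hom :: "'p set \<Rightarrow> ('p \<Rightarrow> 'p \<Rightarrow> bool) \<Rightarrow> ('p, 'k::field) prep \<Rightarrow> ('p, 'k) prep
    \<Rightarrow> ('p \<Rightarrow> 'k mat) \<Rightarrow> bool" where
  "is_hom P lq X Y f \<longleftrightarrow>
     (\<forall>p\<in>P. f p \<in> carrier_mat (dm Y p) (dm X p)) \<and>
     (\<forall>p\<in>P. \<forall>q\<in>P. lq p q \<longrightarrow> f q * mp X p q = mp Y p q * f p)"

definition zero_rep :: "('p, 'k::field) prep" where
  "zero_rep = \<lparr> dm = (\<lambda>p. 0), mp = (\<lambda>p q. 0\<^sub>m 0 0) \<rparr>"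

definition dsum :: "('p, 'k::field) prep \<Rightarrow> ('p, 'k) prep \<Rightarrow> ('p, 'k) prep" where
  "dsum X Y = \<lparr> dm = (\<lambda>p. dm X p + dm Y p),
      mp = (\<lambda>p q. four_block_mat (mp X p q) (0\<^sub>m (dm X q) (dm Y p))
                                  (0\<^sub>m (dm Y q) (dm X p)) (mp Y p q)) \<rparr>"

definition dsum_list :: "('p, 'k::field) prep list \<Rightarrow> ('p, 'k) prep" where
  "dsum_list Xs = foldr dsum Xs zero_rep"

definition iso :: "'p set \<Rightarrow> ('p \<Rightarrow> 'p \<Rightarrow> bool) \<Rightarrow> ('p, 'k::field) prep \<Rightarrow> ('p, 'k) prep \<Rightarrow> bool" where
  "iso P lq X Y \<longleftrightarrow> (\<exists>f g. is_hom P lq X Y f \<and> is_hom P lq Y X g \<and>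
     (\<forall>p\<in>P. g p * f p = 1\<^sub>m (dm X p) \<and> f p * g p = 1\<^sub>m (dm Y p)))"

definition indicator_rep :: "'p set \<Rightarrow> ('p, 'k::field) prep" where
  "indicator_rep S = \<lparr> dm = (\<lambda>p. if p \<in> S then 1 else 0),
      mp = (\<lambda>p q. if p \<in> S \<and> q \<in> S then 1\<^sub>m 1
                  else 0\<^sub>m (if q \<in> S then 1 else 0) (if p \<in> S then 1 else 0)) \<rparr>"

definition up :: "'p set \<Rightarrow> ('p \<Rightarrow> 'p \<Rightarrow> bool) \<Rightarrow> 'p set \<Rightarrow> 'p set" where
  "up P lq S = {q\<in>P. \<exists>s\<in>S. lq s q}"

definition convex :: "'p set \<Rightarrow> ('p \<Rightarrow> 'p \<Rightarrow> bool) \<Rightarrow> 'p set \<Rightarrow> bool" where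
  "convex P lq S \<longleftrightarrow> S \<subseteq> P \<and> (\<forall>s\<in>S. \<forall>p\<in>P. \<forall>s'\<in>S. lq s p \<and> lq p s' \<longrightarrow> p \<in> S)"

definition connected_sub :: "'p set \<Rightarrow> ('p \<Rightarrow> 'p \<Rightarrow> bool) \<Rightarrow> 'p set \<Rightarrow> bool" where
  "connected_sub P lq S \<longleftrightarrow> S \<subseteq> P \<and> S \<noteq> {} \<and>
     (\<forall>x\<in>S. \<forall>y\<in>S. (\<lambda>a b. a \<in> S \<and> b \<in> S \<and> (lq a b \<or> lq b a))\<^sup>*\<^sup>* x y)"

definition spread :: "'p set \<Rightarrow> ('p \<Rightarrow> 'p \<Rightarrow> bool) \<Rightarrow> 'p set \<Rightarrow> bool" where
  "spread P lq S \<longleftrightarrow> convex P lq S \<and> connected_sub P lq S"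

definition exact_at :: "'p set \<Rightarrow> ('p, 'k::field) prep \<Rightarrow> ('p, 'k) prep \<Rightarrow> ('p, 'k) prep
    \<Rightarrow> ('p \<Rightarrow> 'k mat) \<Rightarrow> ('p \<Rightarrow> 'k mat) \<Rightarrow> bool" where
  "exact_at P A B C f g \<longleftrightarrow> (\<forall>p\<in>P. \<forall>w\<in>carrier_vec (dm B p).
      g p *\<^sub>v w = 0\<^sub>v (dm C p) \<longleftrightarrow> (\<exists>v\<in>carrier_vec (dm A p). w = f p *\<^sub>v v))"

definition pw_surj :: "'p set \<Rightarrow> ('p, 'k::field) prep \<Rightarrow> ('p, 'k) prep \<Rightarrow> ('p \<Rightarrow> 'k mat) \<Rightarrow> bool" where
  "pw_surj P B C g \<longleftrightarrow> (\<forall>p\<in>P. \<forall>u\<in>carrier_vec (dm C p). \<exists>w\<in>carrier_vec (dm B p). u = g p *\<^sub>v w)"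

definition pw_inj :: "'p set \<Rightarrow> ('p, 'k::field) prep \<Rightarrow> ('p, 'k) prep \<Rightarrow> ('p \<Rightarrow> 'k mat) \<Rightarrow> bool" where
  "pw_inj P A B f \<longleftrightarrow> (\<forall>p\<in>P. \<forall>v\<in>carrier_vec (dm A p). f p *\<^sub>v v = 0\<^sub>v (dm B p) \<longrightarrow> v = 0\<^sub>v (dm A p))"

definition fin_pres :: "'p set \<Rightarrow> ('p \<Rightarrow> 'p \<Rightarrow> bool) \<Rightarrow> ('p, 'k::field) prep \<Rightarrow> bool" where
  "fin_pres P lq M \<longleftrightarrow> is_rep P lq M \<and>
     (\<exists>as bs phi pi.
        set as \<subseteq> P \<and> set bs \<subseteq> P \<and>
        (let F1 = dsum_list (map (\<lambda>b. indicator_rep (up P lq {b})) bs);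
             F0 = dsum_list (map (\<lambda>a. indicator_rep (up P lq {a})) as)
         in is_hom P lq F1 F0 phi \<and> is_hom P lq F0 M pi \<and>
            exact_at P F1 F0 M phi pi \<and> pw_surj P F0 M pi))"

definition fp_spread :: "'p set \<Rightarrow> ('p \<Rightarrow> 'p \<Rightarrow> bool) \<Rightarrow> 'k::field itself \<Rightarrow> 'p set \<Rightarrow> bool" where
  "fp_spread P lq (TYPE('k)) S \<longleftrightarrow> spread P lq S \<and> fin_pres P lq (indicator_rep S :: ('p, 'k) prep)"

definition add_spread :: "'p set \<Rightarrow> ('p \<Rightarrow> 'p \<Rightarrow> bool) \<Rightarrow> ('p, 'k::field) prep \<Rightarrow> bool" where
  "add_spread P lq X \<longleftrightarrow> fin_pres P lq X \<and>
     (\<exists>Y Ss. is_rep P lq Y \<and> (\<forall>S\<in>set Ss. fp_spread P lq TYPE('k) S) \<and>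
        iso P lq (dsum X Y) (dsum_list (map indicator_rep Ss)))"

definition short_exact :: "'p set \<Rightarrow> ('p \<Rightarrow> 'p \<Rightarrow> bool) \<Rightarrow> ('p, 'k::field) prep \<Rightarrow> ('p, 'k) prep
    \<Rightarrow> ('p, 'k) prep \<Rightarrow> ('p \<Rightarrow> 'k mat) \<Rightarrow> ('p \<Rightarrow> 'k mat) \<Rightarrow> bool" where
  "short_exact P lq L M N f g \<longleftrightarrow>
     fin_pres P lq L \<and> fin_pres P lq M \<and> fin_pres P lq N \<and>
     is_hom P lq L M f \<and> is_hom P lq M N g \<and>
     pw_inj P L M f \<and> exact_at P L M N f g \<and> pw_surj P M N g"

definition hom_exact :: "'p set \<Rightarrow> ('p \<Rightarrow> 'p \<Rightarrow> bool) \<Rightarrow> ('p, 'k::field) prep \<Rightarrow> ('p, 'k) prep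
    \<Rightarrow> ('p, 'k) prep \<Rightarrow> ('p, 'k) prep \<Rightarrow> ('p \<Rightarrow> 'k mat) \<Rightarrow> ('p \<Rightarrow> 'k mat) \<Rightarrow> bool" where
  "hom_exact P lq X L M N f g \<longleftrightarrow>
     (\<forall>h. is_hom P lq X L h \<and> (\<forall>p\<in>P. f p * h p = 0\<^sub>m (dm M p) (dm X p))
          \<longrightarrow> (\<forall>p\<in>P. h p = 0\<^sub>m (dm L p) (dm X p))) \<and>
     (\<forall>h. is_hom P lq X M h \<longrightarrow>
          ((\<forall>p\<in>P. g p * h p = 0\<^sub>m (dm N p) (dm X p)) \<longleftrightarrow>
           (\<exists>k. is_hom P lq X L k \<and> (\<forall>p\<in>P. h p = f p * k p)))) \<and>
     (\<forall>h. is_hom P lq X N h \<longrightarrow> (\<exists>k. is_hom P lq X M k \<and> (\<forall>p\<in>P. h p = g p * k p)))"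

definition in_spread_E :: "'p set \<Rightarrow> ('p \<Rightarrow> 'p \<Rightarrow> bool) \<Rightarrow> ('p, 'k::field) prep \<Rightarrow> ('p, 'k) prep
    \<Rightarrow> ('p, 'k) prep \<Rightarrow> ('p \<Rightarrow> 'k mat) \<Rightarrow> ('p \<Rightarrow> 'k mat) \<Rightarrow> bool" where
  "in_spread_E P lq L M N f g \<longleftrightarrow> short_exact P lq L M N f g \<and>
     (\<forall>S. fp_spread P lq TYPE('k) S \<longrightarrow> hom_exact P lq (indicator_rep S) L M N f g)"

definition E_projective :: "'p set \<Rightarrow> ('p \<Rightarrow> 'p \<Rightarrow> bool) \<Rightarrow> ('p, 'k::field) prep \<Rightarrow> bool" where
  "E_projective P lq X \<longleftrightarrow>
     (\<forall>L M N f g. in_spread_E P lq L M N f g \<longrightarrow> hom_exact P lq X L M N f g)"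

text \<open>For a complex C --f--> B --d--> D: the corestriction C \<rightarrow> ker d of f is a
spread-approximation, i.e. every morphism from an object of add spread into ker d
(= a morphism Z \<rightarrow> B killed by d) factors through f.\<close>
definition ker_approx :: "'p set \<Rightarrow> ('p \<Rightarrow> 'p \<Rightarrow> bool) \<Rightarrow> ('p, 'k::field) prep \<Rightarrow> ('p \<Rightarrow> 'k mat)
    \<Rightarrow> ('p, 'k) prep \<Rightarrow> ('p \<Rightarrow> 'k mat) \<Rightarrow> ('p, 'k) prep \<Rightarrow> bool" where
  "ker_approx P lq C f B d D \<longleftrightarrow>
     (\<forall>Z h. add_spread P lq Z \<and> is_hom P lq Z B h \<and>
            (\<forall>p\<in>P. d p * h p = 0\<^sub>m (dm D p) (dm Z p)) \<longrightarrow>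
            (\<exists>k. is_hom P lq Z C k \<and> (\<forall>p\<in>P. h p = f p * k p)))"

text \<open>M admits a spread-resolution 0 \<rightarrow> C_m \<rightarrow> ... \<rightarrow> C_0 \<rightarrow> M \<rightarrow> 0 of finite length
(C_{m+1} = 0).\<close>
definition has_finite_spread_res :: "'p set \<Rightarrow> ('p \<Rightarrow> 'p \<Rightarrow> bool) \<Rightarrow> ('p, 'k::field) prep \<Rightarrow> bool" where
  "has_finite_spread_res P lq M \<longleftrightarrow>
     (\<exists>(m::nat) (Cs :: nat \<Rightarrow> ('p, 'k) prep) (fs :: nat \<Rightarrow> 'p \<Rightarrow> 'k mat).
        let tgt = (\<lambda>i. if i = 0 then M else Cs (i - 1)) in
        (\<forall>i\<le>m. add_spread P lq (Cs i)) \<and>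
        (\<forall>i\<le>m. is_hom P lq (Cs i) (tgt i) (fs i)) \<and>
        (\<forall>i<m. \<forall>p\<in>P. fs i p * fs (Suc i) p = 0\<^sub>m (dm (tgt i) p) (dm (Cs (Suc i)) p)) \<and>
        ker_approx P lq (Cs 0) (fs 0) M (\<lambda>p. 0\<^sub>m 0 (dm M p)) zero_rep \<and>
        (\<forall>i<m. ker_approx P lq (Cs (Suc i)) (fs (Suc i)) (Cs i) (fs i) (tgt i)) \<and>
        ker_approx P lq zero_rep (\<lambda>p. 0\<^sub>m (dm (Cs m) p) 0) (Cs m) (fs m) (tgt m))"

definition total_order_on :: "'a set \<Rightarrow> ('a \<Rightarrow> 'a \<Rightarrow> bool) \<Rightarrow> bool" where
  "total_order_on A r \<longleftrightarrow>
     (\<forall>x\<in>A. r x x) \<and> (\<forall>x\<in>A. \<forall>y\<in>A. r x y \<and> r y x \<longrightarrow> x = y) \<and>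
     (\<forall>x\<in>A. \<forall>y\<in>A. \<forall>z\<in>A. r x y \<and> r y z \<longrightarrow> r x z) \<and> (\<forall>x\<in>A. \<forall>y\<in>A. r x y \<or> r y x)"

definition grid_carrier :: "nat \<Rightarrow> (nat \<Rightarrow> 'a set) \<Rightarrow> (nat \<Rightarrow> 'a) set" where
  "grid_carrier n T = PiE {..<n} T"

definition grid_le :: "nat \<Rightarrow> (nat \<Rightarrow> 'a \<Rightarrow> 'a \<Rightarrow> bool) \<Rightarrow> (nat \<Rightarrow> 'a) \<Rightarrow> (nat \<Rightarrow> 'a) \<Rightarrow> bool" where
  "grid_le n leT x y \<longleftrightarrow> (\<forall>i<n. leT i (x i) (y i))"

end

theory Submission
  imports Defs
begin

text \<open>
A finitely presented representation of a grid P is determined by its restriction to a finite subgrid Q: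
it is pulled back along the floor map to Q.  Every morphism from the indicator of a convex set to it factors
through the indicator of a convex union of floor fibres, so finitely many saturated spreads suffice to
approximate it.

Let first T be the least point of Q in the spread T for a fixed linear extension of Q.  For each T take as
many copies of T as the dimension of the space of values at first T of morphisms from T.
Their sum approximates F, and if a morphism from T to the kernel is nonzero at first T, then some
spread S strictly above T has a morphism to F that is nonzero at first S.  Here S is above T if first S comes
earlier or first S = first T and there is a morphism from T to S that is nonzero there; connectedness makes
this antisymmetric.  So iterated kernels vanish.

A projective object is a direct summand of its approximation.  Since endomorphisms of spread
representations are scalars, the same antisymmetry shows that a nonzero summand of a sum of spreads
splits off a spread, and induction on the dimension over Q finishes.
\<close>

section \<open>Linear algebra\<close>

text \<open>The test spreads are not tied to \<open>Q\<close>: their corners may lie anywhere, so no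
  finite list of them is in sight at the outset. What helps is that the target is constant on floor
  fibres and that two points with comparable floors have a common upper bound in the fibre of the
  larger floor (in a grid, the coordinatewise maximum). Values can therefore be moved to floors
  without ambiguity. Besides a finite \<open>Q\<close> with floors, this is all that is taken from
  the grid. The linear extension serves one purpose: a spread S that contains \<open>first T\<close>
  cannot have a later first point. So a component of a morphism from T that is nonzero at
  \<open>first T\<close> ends at T or strictly above T. Generators at the single point
  \<open>first T\<close> are enough, since a morphism that vanishes there is supported over fewer
  points of \<open>Q\<close>. In place of unique decomposition into indecomposables, a spread S is
  split off a summand X by a composite from S through X back to S that is a nonzero scalar.\<close>

lemma carrier_vec0: "v \<in> carrier_vec 0 \<Longrightarrow> v = 0\<^sub>v 0"
  by (intro eq_vecI) auto

lemma mat_unit_vec_col: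
  assumes "A \<in> carrier_mat n m" "j < m"
  shows "A *\<^sub>v unit_vec m j = (col A j :: 'a::field vec)"
  using assms by (intro eq_vecI) (auto simp: scalar_prod_right_unit)

lemma zero_mat_vec[simp]:
  "x \<in> carrier_vec m \<Longrightarrow> 0\<^sub>m n m *\<^sub>v x = (0\<^sub>v n :: 'a::field vec)"
  by (intro eq_vecI) auto

lemma mat_eqI_vec:
  assumes "A \<in> carrier_mat n m" "B \<in> carrier_mat n m"
    and "\<And>v. v \<in> carrier_vec m \<Longrightarrow> A *\<^sub>v v = B *\<^sub>v (v :: 'a::field vec)"
  shows "A = B"
proof (rule mat_col_eqI)
  fix j assume "j < dim_col B"
  hence "j < m" using assms by auto
  thus "col A j = col B j"
    using assms(3)[of "unit_vec m j"] assms(1,2) by (simp add: mat_unit_vec_col)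
qed (use assms in auto)

text \<open>Lifting the columns of \<open>H\<close> one at a time gives the columns of
  \<open>K\<close>. No naturality is involved, so this factors morphisms pointwise.\<close>

lemma mat_factor:
  fixes A H :: "'a::field mat"
  assumes A: "A \<in> carrier_mat n m" and H: "H \<in> carrier_mat n k"
    and ex: "\<And>v. v \<in> carrier_vec k \<Longrightarrow> \<exists>u\<in>carrier_vec m. H *\<^sub>v v = A *\<^sub>v u"
  shows "\<exists>K\<in>carrier_mat m k. H = A * K"
proof -
  have "\<forall>j. \<exists>u. j < k \<longrightarrow> u \<in> carrier_vec m \<and> H *\<^sub>v unit_vec k j = A *\<^sub>v u"
    using ex by (meson unit_vec_carrier)
  then obtain u where u: "\<And>j. j < k \<Longrightarrow> u j \<in> carrier_vec m"
    "\<And>j. j < k \<Longrightarrow> H *\<^sub>v unit_vec k j = A *\<^sub>v u j" by metis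
  let ?K = "mat_of_cols m (map u [0..<k])"
  have K: "?K \<in> carrier_mat m k" by (simp add: carrier_matI)
  have "H = A * ?K"
  proof (rule mat_col_eqI)
    fix j assume "j < dim_col (A * ?K)"
    hence j: "j < k" using K by simp
    have "col (A * ?K) j = A *\<^sub>v col ?K j" using col_mult2[OF A K j] .
    also have "col ?K j = u j" using j u(1)[OF j] by (simp add: col_mat_of_cols)
    also have "A *\<^sub>v u j = col H j" using u(2)[OF j] H j by (simp add: mat_unit_vec_col)
    finally show "col H j = col (A * ?K) j" by simp
  qed (use A H K in auto)
  thus ?thesis using K by blast
qed

lemma vec_zero_eq:
  assumes "u \<in> carrier_vec n" "v \<in> carrier_vec n" "u - v = 0\<^sub>v n"
  shows "u = (v :: 'a::field vec)"
proof (rule eq_vecI)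
  fix i assume "i < dim_vec v"
  hence i: "i < n" "i < dim_vec v" using assms(2) by simp_all
  have "(u - v) $ i = 0" unfolding assms(3) using i(1) by simp
  moreover have "(u - v) $ i = u $ i - v $ i" using i(2) by (rule index_minus_vec)
  ultimately show "u $ i = v $ i" by simp
qed (use assms(1,2) in auto)

section \<open>Inclusions and projections of a sum of two coordinate spaces\<close>

definition inl_mat :: "nat \<Rightarrow> nat \<Rightarrow> 'a::field mat" where
  "inl_mat a b = mat (a + b) a (\<lambda>(i, j). if i = j then 1 else 0)"
definition inr_mat :: "nat \<Rightarrow> nat \<Rightarrow> 'a::field mat" where
  "inr_mat a b = mat (a + b) b (\<lambda>(i, j). if i = a + j then 1 else 0)"
definition prl_mat :: "nat \<Rightarrow> nat \<Rightarrow> 'a::field mat" where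
  "prl_mat a b = mat a (a + b) (\<lambda>(i, j). if j = i then 1 else 0)"
definition prr_mat :: "nat \<Rightarrow> nat \<Rightarrow> 'a::field mat" where
  "prr_mat a b = mat b (a + b) (\<lambda>(i, j). if j = a + i then 1 else 0)"

lemma biprod_carrier[simp]:
  "inl_mat a b \<in> carrier_mat (a + b) a" "inr_mat a b \<in> carrier_mat (a + b) b"
  "prl_mat a b \<in> carrier_mat a (a + b)" "prr_mat a b \<in> carrier_mat b (a + b)"
  by (auto simp: inl_mat_def inr_mat_def prl_mat_def prr_mat_def)

lemma prl_mat_vec: 
  assumes "x \<in> carrier_vec a" "y \<in> carrier_vec b"
  shows "prl_mat a b *\<^sub>v (x @\<^sub>v y) = x"
proof (rule eq_vecI)
  fix i assume "i < dim_vec x"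
  hence i: "i < a" using assms by simp
  have "row (prl_mat a b) i = (unit_vec (a + b) i :: 'a vec)"
    using i by (intro eq_vecI) (auto simp: prl_mat_def unit_vec_def)
  thus "(prl_mat a b *\<^sub>v (x @\<^sub>v y)) $ i = x $ i"
    using i assms by (auto simp: prl_mat_def scalar_prod_left_unit)
qed (use assms in \<open>auto simp: prl_mat_def\<close>)

lemma prr_mat_vec: 
  assumes "x \<in> carrier_vec a" "y \<in> carrier_vec b"
  shows "prr_mat a b *\<^sub>v (x @\<^sub>v y) = y"
proof (rule eq_vecI)
  fix i assume "i < dim_vec y"
  hence i: "i < b" using assms by simp
  have "row (prr_mat a b) i = (unit_vec (a + b) (a + i) :: 'a vec)"
    using i by (intro eq_vecI) (auto simp: prr_mat_def unit_vec_def)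
  thus "(prr_mat a b *\<^sub>v (x @\<^sub>v y)) $ i = y $ i"
    using i assms by (auto simp: prr_mat_def scalar_prod_left_unit)
qed (use assms in \<open>auto simp: prr_mat_def\<close>)

lemma inl_mat_vec: 
  assumes "x \<in> carrier_vec a"
  shows "inl_mat a b *\<^sub>v x = x @\<^sub>v 0\<^sub>v b"
proof (rule eq_vecI)
  fix i assume "i < dim_vec (x @\<^sub>v 0\<^sub>v b)"
  hence i: "i < a + b" using assms by simp
  have "row (inl_mat a b) i = (if i < a then unit_vec a i else (0\<^sub>v a :: 'a vec))"
    using i by (intro eq_vecI) (auto simp: inl_mat_def unit_vec_def)
  thus "(inl_mat a b *\<^sub>v x) $ i = (x @\<^sub>v 0\<^sub>v b) $ i"
    using i assms by (auto simp: inl_mat_def scalar_prod_left_unit)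
qed (use assms in \<open>auto simp: inl_mat_def\<close>)

lemma inr_mat_vec: 
  assumes "x \<in> carrier_vec b"
  shows "inr_mat a b *\<^sub>v x = 0\<^sub>v a @\<^sub>v x"
proof (rule eq_vecI)
  fix i assume "i < dim_vec (0\<^sub>v a @\<^sub>v x)"
  hence i: "i < a + b" using assms by simp
  have "row (inr_mat a b) i = (if i < a then 0\<^sub>v b else (unit_vec b (i - a) :: 'a vec))"
    using i by (intro eq_vecI) (auto simp: inr_mat_def unit_vec_def)
  thus "(inr_mat a b *\<^sub>v x) $ i = (0\<^sub>v a @\<^sub>v x) $ i"
    using i assms by (auto simp: inr_mat_def scalar_prod_left_unit)
qed (use assms in \<open>auto simp: inr_mat_def\<close>)

lemma append_vec_cases:
  assumes "v \<in> carrier_vec (a + b)"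
  obtains x y where "x \<in> carrier_vec a" "y \<in> carrier_vec b" "v = x @\<^sub>v y"
  using that[OF vec_first_carrier[of v a] vec_last_carrier[of v b]] vec_first_last_append[OF assms] by simp

text \<open>Gaussian elimination on the first coordinate. The columns of \<open>B\<close> are a
  basis of \<open>V\<close> and \<open>B * L\<close> is a projection onto \<open>V\<close>, so
  membership becomes an equation. The last two conjuncts stand in for dimension theory: a subspace
  of full dimension is everything, the fact by which the induction on dimension vectors finally
  descends.\<close>

lemma subspace_basis:
  fixes V :: "'a::field vec set"
  assumes "V \<subseteq> carrier_vec n" "0\<^sub>v n \<in> V"
    and "\<And>u v. u \<in> V \<Longrightarrow> v \<in> V \<Longrightarrow> u + v \<in> V"
    and "\<And>c v. v \<in> V \<Longrightarrow> c \<cdot>\<^sub>v v \<in> V"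
  shows "\<exists>d B L. B \<in> carrier_mat n d \<and> L \<in> carrier_mat d n \<and> L * B = 1\<^sub>m d \<and>
    (\<forall>v\<in>carrier_vec n. v \<in> V \<longleftrightarrow> B *\<^sub>v (L *\<^sub>v v) = v) \<and> d \<le> n \<and> (d = n \<longrightarrow> V = carrier_vec n)"
  using assms
proof (induction n arbitrary: V)
  case 0
  have "v = 0\<^sub>v 0" if "v \<in> carrier_vec 0" for v :: "'a vec" using that by (intro eq_vecI) auto
  hence V: "V = carrier_vec 0" using 0(1,2) by blast
  show ?case
    by (rule exI[of _ 0], rule exI[of _ "0\<^sub>m 0 0"], rule exI[of _ "0\<^sub>m 0 0"]) (use V in auto)
next
  case (Suc n)
  let ?z = "0\<^sub>v 1 :: 'a vec"
  \<comment> \<open>The vectors of \<open>V\<close> with vanishing first coordinate, seen one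
    dimension lower.\<close>
  define W where "W = {v \<in> carrier_vec n. ?z @\<^sub>v v \<in> V}"
  have W1: "W \<subseteq> carrier_vec n" by (auto simp: W_def)
  have z: "?z @\<^sub>v 0\<^sub>v n = 0\<^sub>v (Suc n)" by (intro eq_vecI) auto
  have W2: "0\<^sub>v n \<in> W" using Suc.prems(2) z by (auto simp: W_def)
  have W3: "u + v \<in> W" if "u \<in> W" "v \<in> W" for u v
    using that Suc.prems(3)[of "?z @\<^sub>v u" "?z @\<^sub>v v"] append_vec_add[of ?z 1 ?z u n v] by (auto simp: W_def)
  have W4: "c \<cdot>\<^sub>v v \<in> W" if "v \<in> W" for c v
  proof -
    have "c \<cdot>\<^sub>v (?z @\<^sub>v v) = ?z @\<^sub>v (c \<cdot>\<^sub>v v)" by (intro eq_vecI) auto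
    thus ?thesis using that Suc.prems(4)[of "?z @\<^sub>v v" c] by (auto simp: W_def)
  qed
  obtain d B L where B: "B \<in> carrier_mat n d" and L: "L \<in> carrier_mat d n" and LB: "L * B = 1\<^sub>m d"
    and BL: "\<And>v. v \<in> carrier_vec n \<Longrightarrow> v \<in> W \<longleftrightarrow> B *\<^sub>v (L *\<^sub>v v) = v"
    and d: "d \<le> n" "d = n \<Longrightarrow> W = carrier_vec n"
    using Suc.IH[OF W1 W2 W3 W4] by blast
  have LBv: "L *\<^sub>v (B *\<^sub>v x) = x" if "x \<in> carrier_vec d" for x
    using that assoc_mult_mat_vec[OF L B, symmetric] LB by simp
  show ?case
  proof (cases "\<exists>w\<in>V. w $ 0 \<noteq> 0")
    case False
    let ?B = "inr_mat 1 n * B" and ?L = "L * prr_mat 1 n"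
    have B': "?B \<in> carrier_mat (Suc n) d" and L': "?L \<in> carrier_mat d (Suc n)"
      using B L mult_carrier_mat[OF biprod_carrier(2)[of 1 n] B] mult_carrier_mat[OF L biprod_carrier(4)[of 1 n]]
      by auto
    have Bv: "?B *\<^sub>v x = ?z @\<^sub>v (B *\<^sub>v x)" if "x \<in> carrier_vec d" for x
      unfolding assoc_mult_mat_vec[OF biprod_carrier(2)[of 1 n] B that]
      by (rule inr_mat_vec) (use that B in auto)
    have Lv: "?L *\<^sub>v (x @\<^sub>v y) = L *\<^sub>v y" if "x \<in> carrier_vec 1" "y \<in> carrier_vec n" for x y
      using assoc_mult_mat_vec[OF L biprod_carrier(4)[of 1 n] append_carrier_vec[OF that]]
      unfolding prr_mat_vec[OF that] .
    have "?L * ?B = 1\<^sub>m d"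
    proof (rule mat_eqI_vec)
      fix v :: "'a vec" assume v: "v \<in> carrier_vec d"
      have "(?L * ?B) *\<^sub>v v = ?L *\<^sub>v (?B *\<^sub>v v)" using assoc_mult_mat_vec[OF L' B' v] .
      also have "\<dots> = L *\<^sub>v (B *\<^sub>v v)"
        unfolding Bv[OF v] by (rule Lv) (use B v in auto)
      finally show "(?L * ?B) *\<^sub>v v = 1\<^sub>m d *\<^sub>v v" unfolding LBv[OF v] one_mult_mat_vec[OF v] .
    qed (use B' L' in auto)
    moreover have "v \<in> V \<longleftrightarrow> ?B *\<^sub>v (?L *\<^sub>v v) = v" if v: "v \<in> carrier_vec (Suc n)" for v
    proof -
      have v': "v \<in> carrier_vec (1 + n)" using v by simp
      obtain x y where xy: "x \<in> carrier_vec 1" "y \<in> carrier_vec n" "v = x @\<^sub>v y"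
        by (rule append_vec_cases[OF v'])
      have "?B *\<^sub>v (?L *\<^sub>v v) = ?z @\<^sub>v (B *\<^sub>v (L *\<^sub>v y))"
        unfolding xy(3) Lv[OF xy(1,2)] by (rule Bv) (use xy L in auto)
      moreover have "v \<in> V \<longleftrightarrow> x = ?z \<and> y \<in> W"
      proof
        assume vV: "v \<in> V"
        hence "v $ 0 = 0" using False by auto
        hence "x = ?z" using xy by (intro eq_vecI) auto
        thus "x = ?z \<and> y \<in> W" using vV xy by (auto simp: W_def)
      qed (use xy in \<open>auto simp: W_def\<close>)
      moreover have "?z @\<^sub>v (B *\<^sub>v (L *\<^sub>v y)) = x @\<^sub>v y \<longleftrightarrow> ?z = x \<and> B *\<^sub>v (L *\<^sub>v y) = y"
        by (rule append_vec_eq) (use xy in auto)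
      ultimately show ?thesis using BL[OF xy(2)] unfolding xy(3) by metis
    qed
    moreover have "d \<le> Suc n" "d = Suc n \<longrightarrow> V = carrier_vec (Suc n)" using d(1) by simp_all
    ultimately show ?thesis using B' L' by blast
  next
    case True
    then obtain w0 where w0: "w0 \<in> V" "w0 $ 0 \<noteq> 0" by blast
    \<comment> \<open>The pivot, scaled to have first coordinate 1.\<close>
    define w1 where "w1 = (1 / (w0 $ 0)) \<cdot>\<^sub>v w0"
    have w1: "w1 \<in> V" using Suc.prems(4)[OF w0(1)] by (simp add: w1_def)
    have w1c: "w1 \<in> carrier_vec (1 + n)" using w1 Suc.prems(1) by auto
    have w10: "w1 $ 0 = 1" using w0 Suc.prems(1) by (auto simp: w1_def)
    obtain e w where ew: "e \<in> carrier_vec 1" "w \<in> carrier_vec n" "w1 = e @\<^sub>v w"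
      by (rule append_vec_cases[OF w1c])
    have e: "e $ 0 = 1" using w10 ew by simp
    let ?wm = "mat_of_cols n [w]"
    have wm: "?wm \<in> carrier_mat n 1" by (simp add: carrier_matI)
    have wmv: "?wm *\<^sub>v x = (x $ 0) \<cdot>\<^sub>v w" if "x \<in> carrier_vec 1" for x
      using that ew(2) by (intro eq_vecI) (auto simp: scalar_prod_def mat_of_cols_def)
    \<comment> \<open>Lower left block of the new left inverse. A first coordinate
      \<open>x $ 0\<close> brings the multiple \<open>x $ 0\<close> of \<open>w\<close> with it, and
      this block subtracts that multiple before \<open>L\<close> is applied.\<close>
    let ?N = "L * (- ?wm)"
    have Nv: "?N *\<^sub>v x = L *\<^sub>v (- (x $ 0 \<cdot>\<^sub>v w))" if x: "x \<in> carrier_vec 1" for x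
    proof -
      have "?N *\<^sub>v x = L *\<^sub>v ((- ?wm) *\<^sub>v x)" by (rule assoc_mult_mat_vec[OF L _ x]) (use wm in auto)
      also have "(- ?wm) *\<^sub>v x = - (?wm *\<^sub>v x)" using x wm by simp
      finally show ?thesis using wmv[OF x] by simp
    qed
    let ?B = "four_block_mat (1\<^sub>m 1) (0\<^sub>m 1 d) ?wm B"
    let ?L = "four_block_mat (1\<^sub>m 1) (0\<^sub>m 1 n) ?N L"
    have B': "?B \<in> carrier_mat (Suc n) (Suc d)"
      using four_block_carrier_mat[OF one_carrier_mat[of 1] B] by simp
    have L': "?L \<in> carrier_mat (Suc d) (Suc n)"
      using four_block_carrier_mat[OF one_carrier_mat[of 1] L] by simp
    have N: "?N \<in> carrier_mat d 1" using L wm by simp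
    have Bv: "?B *\<^sub>v (x @\<^sub>v y) = x @\<^sub>v (x $ 0 \<cdot>\<^sub>v w + B *\<^sub>v y)" if "x \<in> carrier_vec 1" "y \<in> carrier_vec d" for x y
      using four_block_mat_mult_vec[OF one_carrier_mat[of 1] zero_carrier_mat[of 1 d] wm B that] that wmv[OF that(1)]
      by simp
    have Lv: "?L *\<^sub>v (x @\<^sub>v y) = x @\<^sub>v (L *\<^sub>v (y - x $ 0 \<cdot>\<^sub>v w))" if xy: "x \<in> carrier_vec 1" "y \<in> carrier_vec n" for x y
    proof -
      have "?N *\<^sub>v x + L *\<^sub>v y = L *\<^sub>v (- (x $ 0 \<cdot>\<^sub>v w) + y)"
        unfolding Nv[OF xy(1)] by (rule mult_add_distrib_mat_vec[OF L, symmetric]) (use xy ew in auto)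
      also have "- (x $ 0 \<cdot>\<^sub>v w) + y = y - x $ 0 \<cdot>\<^sub>v w" using xy ew by (intro eq_vecI) auto
      finally show ?thesis
        using four_block_mat_mult_vec[OF one_carrier_mat[of 1] zero_carrier_mat[of 1 n] N L that] that
        by simp
    qed
    have "?L * ?B = 1\<^sub>m (Suc d)"
    proof (rule mat_eqI_vec)
      fix v :: "'a vec" assume v: "v \<in> carrier_vec (Suc d)"
      hence v': "v \<in> carrier_vec (1 + d)" by simp
      obtain x y where xy: "x \<in> carrier_vec 1" "y \<in> carrier_vec d" "v = x @\<^sub>v y"
        by (rule append_vec_cases[OF v'])
      have "(?L * ?B) *\<^sub>v v = ?L *\<^sub>v (?B *\<^sub>v v)" using assoc_mult_mat_vec[OF L' B' v] .
      also have "\<dots> = x @\<^sub>v (L *\<^sub>v ((x $ 0 \<cdot>\<^sub>v w + B *\<^sub>v y) - x $ 0 \<cdot>\<^sub>v w))"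
        unfolding xy(3) Bv[OF xy(1,2)] by (rule Lv) (use xy ew B in auto)
      also have "(x $ 0 \<cdot>\<^sub>v w + B *\<^sub>v y) - x $ 0 \<cdot>\<^sub>v w = B *\<^sub>v y"
        using xy ew B by (intro eq_vecI) auto
      also have "x @\<^sub>v (L *\<^sub>v (B *\<^sub>v y)) = v" using LBv xy by simp
      finally show "(?L * ?B) *\<^sub>v v = 1\<^sub>m (Suc d) *\<^sub>v v" using v by simp
    qed (use B' L' in auto)
    moreover have "v \<in> V \<longleftrightarrow> ?B *\<^sub>v (?L *\<^sub>v v) = v" if v: "v \<in> carrier_vec (Suc n)" for v
    proof -
      have v': "v \<in> carrier_vec (1 + n)" using v by simp
      obtain x y where xy: "x \<in> carrier_vec 1" "y \<in> carrier_vec n" "v = x @\<^sub>v y"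
        by (rule append_vec_cases[OF v'])
      let ?y = "y - x $ 0 \<cdot>\<^sub>v w"
      have yc: "?y \<in> carrier_vec n" using xy ew by auto
      have "?B *\<^sub>v (?L *\<^sub>v v) = x @\<^sub>v (x $ 0 \<cdot>\<^sub>v w + B *\<^sub>v (L *\<^sub>v ?y))"
        unfolding xy(3) Lv[OF xy(1,2)] by (rule Bv) (use xy L yc in auto)
      hence "?B *\<^sub>v (?L *\<^sub>v v) = v \<longleftrightarrow> x $ 0 \<cdot>\<^sub>v w + B *\<^sub>v (L *\<^sub>v ?y) = y"
        unfolding xy(3) using append_vec_eq[OF xy(1,1)] by metis
      also have "\<dots> \<longleftrightarrow> B *\<^sub>v (L *\<^sub>v ?y) = ?y"
      proof
        assume h: "x $ 0 \<cdot>\<^sub>v w + B *\<^sub>v (L *\<^sub>v ?y) = y"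
        show "B *\<^sub>v (L *\<^sub>v ?y) = ?y"
        proof (rule eq_vecI)
          fix i assume "i < dim_vec ?y"
          hence i: "i < n" using ew by simp
          have "(x $ 0 \<cdot>\<^sub>v w + B *\<^sub>v (L *\<^sub>v ?y)) $ i = y $ i" using h by simp
          thus "(B *\<^sub>v (L *\<^sub>v ?y)) $ i = ?y $ i" using i ew xy B
            by (simp add: algebra_simps del: index_mult_mat_vec)
        qed (use B ew in auto)
      next
        assume h: "B *\<^sub>v (L *\<^sub>v ?y) = ?y"
        show "x $ 0 \<cdot>\<^sub>v w + B *\<^sub>v (L *\<^sub>v ?y) = y" unfolding h
          using xy ew by (intro eq_vecI) auto
      qed
      also have "\<dots> \<longleftrightarrow> ?y \<in> W" using BL[OF yc] by simp
      also have "\<dots> \<longleftrightarrow> v \<in> V"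
      proof -
        \<comment> \<open>Subtracting a multiple of the pivot clears the first coordinate, and
          adding it back undoes this; both operations stay in \<open>V\<close>.\<close>
        have 1: "(- (x $ 0)) \<cdot>\<^sub>v w1 + v = ?z @\<^sub>v ?y"
          using xy ew e by (intro eq_vecI) (auto simp: append_vec_def Let_def)
        have 2: "(x $ 0) \<cdot>\<^sub>v w1 + (?z @\<^sub>v ?y) = v"
          using xy ew e by (intro eq_vecI) (auto simp: append_vec_def Let_def)
        show ?thesis
          using Suc.prems(3)[OF Suc.prems(4)[OF w1, of "- (x $ 0)"], of v] 1
            Suc.prems(3)[OF Suc.prems(4)[OF w1, of "x $ 0"], of "?z @\<^sub>v ?y"] 2 yc
          by (auto simp: W_def)
      qed
      finally show ?thesis by simp
    qed
    moreover have "V = carrier_vec (Suc n)" if "Suc d = Suc n"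
    proof -
      have "v \<in> V" if v: "v \<in> carrier_vec (Suc n)" for v
      proof -
        have v': "v \<in> carrier_vec (1 + n)" using v by simp
        obtain x y where xy: "x \<in> carrier_vec 1" "y \<in> carrier_vec n" "v = x @\<^sub>v y"
          by (rule append_vec_cases[OF v'])
        let ?y = "y - x $ 0 \<cdot>\<^sub>v w"
        have "?y \<in> W" using d(2) \<open>Suc d = Suc n\<close> xy ew by auto
        moreover have "(x $ 0) \<cdot>\<^sub>v w1 + (?z @\<^sub>v ?y) = v"
          using xy ew e by (intro eq_vecI) (auto simp: append_vec_def Let_def)
        ultimately show ?thesis
          using Suc.prems(3)[OF Suc.prems(4)[OF w1, of "x $ 0"], of "?z @\<^sub>v ?y"] by (auto simp: W_def)
      qed
      thus ?thesis using Suc.prems(1) by auto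
    qed
    moreover have "Suc d \<le> Suc n" using d(1) by simp
    ultimately show ?thesis using B' L' by blast
  qed
qed

section \<open>Representations and morphisms\<close>

lemma mat_eqI_unit:
  assumes "A \<in> carrier_mat n m" "B \<in> carrier_mat n m"
    and "\<And>j. j < m \<Longrightarrow> A *\<^sub>v unit_vec m j = B *\<^sub>v (unit_vec m j :: 'a::field vec)"
  shows "A = B"
proof (rule mat_col_eqI)
  fix j assume "j < dim_col B"
  hence "j < m" using assms by auto
  thus "col A j = col B j"
    using assms(3)[of j] assms(1,2) by (simp add: mat_unit_vec_col)
qed (use assms in auto)

text \<open>The \<open>d\<close>-fold sum of an indicator in closed form. Over \<open>S\<close>, a
  morphism out of it is a matrix with \<open>d\<close> columns, one value family for each. For
  \<open>d = 1\<close> it is literally \<open>indicator_rep S\<close>, so facts about powers cover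
  indicators too.\<close>

definition pow_ind :: "'p set \<Rightarrow> nat \<Rightarrow> ('p, 'k::field) prep" where
  "pow_ind S d = \<lparr> dm = (\<lambda>p. if p \<in> S then d else 0),
      mp = (\<lambda>p q. if p \<in> S \<and> q \<in> S then 1\<^sub>m d
                  else 0\<^sub>m (if q \<in> S then d else 0) (if p \<in> S then d else 0)) \<rparr>"

lemma pow_ind_1: "indicator_rep S = pow_ind S 1"
  unfolding indicator_rep_def pow_ind_def ..

lemma dm_pow_ind: "dm (pow_ind S d) p = (if p \<in> S then d else 0)"
  by (simp add: pow_ind_def)

lemma dm_dsum[simp]: "dm (dsum X Y) p = dm X p + dm Y p"
  by (simp add: dsum_def)

lemma dm_zero[simp]: "dm zero_rep p = 0"
  by (simp add: zero_rep_def)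

lemma dsum_list_simps[simp]: "dsum_list [] = zero_rep" "dsum_list (X # Xs) = dsum X (dsum_list Xs)"
  by (simp_all add: dsum_list_def)

text \<open>The axioms are asked on the carrier only: the relation of a grid is defined for all
  functions and does not separate functions that differ outside the index range.\<close>

locale rposet =
  fixes P :: "'p set" and lq :: "'p \<Rightarrow> 'p \<Rightarrow> bool"
  assumes refl: "p \<in> P \<Longrightarrow> lq p p"
    and trans: "\<lbrakk>p \<in> P; q \<in> P; r \<in> P; lq p q; lq q r\<rbrakk> \<Longrightarrow> lq p r"
    and antisym: "\<lbrakk>p \<in> P; q \<in> P; lq p q; lq q p\<rbrakk> \<Longrightarrow> p = q"
begin

abbreviation "rep X \<equiv> is_rep P lq X"
abbreviation "rhom X Y f \<equiv> is_hom P lq X Y f"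

lemma rep_mat: "\<lbrakk>rep X; p \<in> P; q \<in> P; lq p q\<rbrakk> \<Longrightarrow> mp X p q \<in> carrier_mat (dm X q) (dm X p)"
  by (simp add: is_rep_def)

lemma rep_vec:
  "\<lbrakk>rep X; p \<in> P; q \<in> P; lq p q; v \<in> carrier_vec (dm X p)\<rbrakk> \<Longrightarrow> mp X p q *\<^sub>v v \<in> carrier_vec (dm X q)"
  using rep_mat mult_mat_vec_carrier by blast

lemma rep_id: "\<lbrakk>rep X; p \<in> P; v \<in> carrier_vec (dm X p)\<rbrakk> \<Longrightarrow> mp X p p *\<^sub>v v = v"
  by (simp add: is_rep_def)

lemma rep_comp:
  assumes "rep X" "p \<in> P" "q \<in> P" "r \<in> P" "lq p q" "lq q r" "v \<in> carrier_vec (dm X p)"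
  shows "mp X q r *\<^sub>v (mp X p q *\<^sub>v v) = mp X p r *\<^sub>v v"
proof -
  have "mp X p r = mp X q r * mp X p q" using assms by (simp add: is_rep_def)
  thus ?thesis
    using assoc_mult_mat_vec[OF rep_mat[OF assms(1,3,4,6)] rep_mat[OF assms(1,2,3,5)] assms(7)] by simp
qed

text \<open>Here and in \<open>homI\<close>, matrix identities are traded for identities on vectors,
  so that diagram chases can run on elements.\<close>

lemma repI:
  assumes "\<And>p q. \<lbrakk>p \<in> P; q \<in> P; lq p q\<rbrakk> \<Longrightarrow> mp X p q \<in> carrier_mat (dm X q) (dm X p)"
    and "\<And>p v. \<lbrakk>p \<in> P; v \<in> carrier_vec (dm X p)\<rbrakk> \<Longrightarrow> mp X p p *\<^sub>v v = (v :: 'k::field vec)"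
    and "\<And>p q r v. \<lbrakk>p \<in> P; q \<in> P; r \<in> P; lq p q; lq q r; v \<in> carrier_vec (dm X p)\<rbrakk>
      \<Longrightarrow> mp X q r *\<^sub>v (mp X p q *\<^sub>v v) = mp X p r *\<^sub>v v"
  shows "rep X"
  unfolding is_rep_def
proof (intro conjI ballI impI)
  fix p assume "p \<in> P"
  thus "mp X p p = 1\<^sub>m (dm X p)"
    using mat_eqI_vec[OF assms(1)[OF _ _ refl] one_carrier_mat] assms(2) by simp
next
  fix p q r assume h: "p \<in> P" "q \<in> P" "r \<in> P" "lq p q \<and> lq q r"
  note c = assms(1)[OF h(1,2)] assms(1)[OF h(2,3)] assms(1)[OF h(1,3)]
  have pr: "lq p r" using h trans by blast
  show "mp X p r = mp X q r * mp X p q"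
  proof (rule mat_eqI_vec)
    fix v :: "'k vec" assume v: "v \<in> carrier_vec (dm X p)"
    show "mp X p r *\<^sub>v v = (mp X q r * mp X p q) *\<^sub>v v"
      using assoc_mult_mat_vec[OF c(2) c(1) v] assms(3)[OF h(1-3) _ _ v] h by simp
  qed (use c h pr in auto)
qed (use assms(1) in auto)

lemma hom_mat: "\<lbrakk>rhom X Y f; p \<in> P\<rbrakk> \<Longrightarrow> f p \<in> carrier_mat (dm Y p) (dm X p)"
  by (simp add: is_hom_def)

lemma hom_vec: "\<lbrakk>rhom X Y f; p \<in> P; v \<in> carrier_vec (dm X p)\<rbrakk> \<Longrightarrow> f p *\<^sub>v v \<in> carrier_vec (dm Y p)"
  using hom_mat mult_mat_vec_carrier by blast

lemma hom_nat:
  assumes "rep X" "rep Y" "rhom X Y f" "p \<in> P" "q \<in> P" "lq p q" "v \<in> carrier_vec (dm X p)"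
  shows "f q *\<^sub>v (mp X p q *\<^sub>v v) = mp Y p q *\<^sub>v (f p *\<^sub>v v)"
proof -
  have "f q * mp X p q = mp Y p q * f p" using assms by (simp add: is_hom_def)
  thus ?thesis
    using assoc_mult_mat_vec[OF hom_mat[OF assms(3,5)] rep_mat[OF assms(1,4,5,6)] assms(7)]
      assoc_mult_mat_vec[OF rep_mat[OF assms(2,4,5,6)] hom_mat[OF assms(3,4)] assms(7)] by simp
qed

lemma homI:
  assumes "rep X" "rep Y" and c: "\<And>p. p \<in> P \<Longrightarrow> f p \<in> carrier_mat (dm Y p) (dm X p)"
    and n: "\<And>p q v. \<lbrakk>p \<in> P; q \<in> P; lq p q; v \<in> carrier_vec (dm X p)\<rbrakk>
      \<Longrightarrow> f q *\<^sub>v (mp X p q *\<^sub>v v) = mp Y p q *\<^sub>v (f p *\<^sub>v (v :: 'k::field vec))"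
  shows "rhom X Y f"
  unfolding is_hom_def
proof (intro conjI ballI impI)
  fix p q assume h: "p \<in> P" "q \<in> P" "lq p q"
  note m = rep_mat[OF assms(1) h] rep_mat[OF assms(2) h] c[OF h(1)] c[OF h(2)]
  show "f q * mp X p q = mp Y p q * f p"
  proof (rule mat_eqI_vec)
    fix v :: "'k vec" assume v: "v \<in> carrier_vec (dm X p)"
    show "(f q * mp X p q) *\<^sub>v v = (mp Y p q * f p) *\<^sub>v v"
      using assoc_mult_mat_vec[OF m(4) m(1) v] assoc_mult_mat_vec[OF m(2) m(3) v] n[OF h v] by simp
  qed (use m in auto)
qed (use c in auto)

lemma hom_comp_vec:
  assumes "rhom X Y f" "rhom Y Z g" "p \<in> P" "v \<in> carrier_vec (dm X p)"
  shows "(g p * f p) *\<^sub>v v = g p *\<^sub>v (f p *\<^sub>v v)"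
  using assoc_mult_mat_vec[OF hom_mat[OF assms(2,3)] hom_mat[OF assms(1,3)] assms(4)] .

lemma hom_comp:
  assumes "rep X" "rep Y" "rep Z" "rhom X Y f" "rhom Y Z g"
  shows "rhom X Z (\<lambda>p. g p * f p)"
proof (rule homI[OF assms(1,3)])
  fix p assume "p \<in> P" thus "g p * f p \<in> carrier_mat (dm Z p) (dm X p)"
    using hom_mat[OF assms(4)] hom_mat[OF assms(5)] mult_carrier_mat by blast
next
  fix p q and v :: "'a vec" assume h: "p \<in> P" "q \<in> P" "lq p q" "v \<in> carrier_vec (dm X p)"
  show "(g q * f q) *\<^sub>v (mp X p q *\<^sub>v v) = mp Z p q *\<^sub>v ((g p * f p) *\<^sub>v v)"
    unfolding hom_comp_vec[OF assms(4,5) h(1,4)] hom_comp_vec[OF assms(4,5) h(2) rep_vec[OF assms(1) h]]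
      hom_nat[OF assms(1,2,4) h] hom_nat[OF assms(2,3,5) h(1-3) hom_vec[OF assms(4) h(1,4)]] ..
qed

lemma hom_id: "rep X \<Longrightarrow> rhom X X (\<lambda>p. 1\<^sub>m (dm X p))"
  by (rule homI) (auto simp: rep_vec)

lemma rep_zero: "rep zero_rep"
  by (rule repI) (auto simp: zero_rep_def intro!: eq_vecI)

lemma rep_pow_ind: "convex P lq S \<Longrightarrow> rep (pow_ind S d)"
proof (rule repI)
  fix p q r and v :: "'a vec"
  assume S: "convex P lq S" and h: "p \<in> P" "q \<in> P" "r \<in> P" "lq p q" "lq q r" "v \<in> carrier_vec (dm (pow_ind S d) p)"
  show "mp (pow_ind S d) q r *\<^sub>v (mp (pow_ind S d) p q *\<^sub>v v) = mp (pow_ind S d) p r *\<^sub>v v"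
  proof (cases "p \<in> S \<and> r \<in> S")
    case True
    \<comment> \<open>The use of convexity: a composite through a point outside \<open>S\<close>
      would be zero while the direct map is the identity.\<close>
    hence "q \<in> S" using S h unfolding convex_def by blast
    thus ?thesis using True h(6) by (simp add: pow_ind_def)
  next
    case False thus ?thesis using h(6) by (auto simp: pow_ind_def)
  qed
qed (auto simp: pow_ind_def)

text \<open>Families v describing the morphisms from the indicator of Z to F, without the matrix encoding.\<close>

definition vhom :: "'p set \<Rightarrow> ('p, 'k::field) prep \<Rightarrow> ('p \<Rightarrow> 'k vec) \<Rightarrow> bool" where
  "vhom Z F v \<longleftrightarrow> (\<forall>z\<in>Z. v z \<in> carrier_vec (dm F z)) \<and>
     (\<forall>z\<in>Z. \<forall>p\<in>P. lq z p \<longrightarrow> mp F z p *\<^sub>v v z = (if p \<in> Z then v p else 0\<^sub>v (dm F p)))"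

lemma vhomD:
  "vhom Z F v \<Longrightarrow> z \<in> Z \<Longrightarrow> v z \<in> carrier_vec (dm F z)"
  "\<lbrakk>vhom Z F v; z \<in> Z; p \<in> P; lq z p\<rbrakk> \<Longrightarrow> mp F z p *\<^sub>v v z = (if p \<in> Z then v p else 0\<^sub>v (dm F p))"
  by (auto simp: vhom_def)

lemma vhom_comp:
  assumes "Z \<subseteq> P" "rep F" "rep G" "vhom Z F v" "rhom F G g"
  shows "vhom Z G (\<lambda>z. g z *\<^sub>v v z)"
  unfolding vhom_def
proof (intro conjI ballI impI)
  fix z assume z: "z \<in> Z"
  hence "z \<in> P" using assms(1) by auto
  thus "g z *\<^sub>v v z \<in> carrier_vec (dm G z)" by (rule hom_vec[OF assms(5) _ vhomD(1)[OF assms(4) z]])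
next
  fix z p assume h: "z \<in> Z" "p \<in> P" "lq z p"
  have z: "z \<in> P" using h assms(1) by auto
  have g0: "g p *\<^sub>v 0\<^sub>v (dm F p) = 0\<^sub>v (dm G p)" using hom_mat[OF assms(5) h(2)] by (intro eq_vecI) auto
  show "mp G z p *\<^sub>v (g z *\<^sub>v v z) = (if p \<in> Z then g p *\<^sub>v v p else 0\<^sub>v (dm G p))"
    unfolding hom_nat[OF assms(2,3,5) z h(2,3) vhomD(1)[OF assms(4) h(1)], symmetric]
      vhomD(2)[OF assms(4) h] using g0 by (cases "p \<in> Z") simp_all
qed

lemma vhom_of_hom:
  assumes "convex P lq S" "rep F" "rhom (pow_ind S d) F H" "c \<in> carrier_vec d"
  shows "vhom S F (\<lambda>p. H p *\<^sub>v c)"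
proof -
  have S: "S \<subseteq> P" using assms(1) by (simp add: convex_def)
  have "vhom S (pow_ind S d) (\<lambda>p. c)"
    using assms(4) by (simp add: vhom_def pow_ind_def)
  thus ?thesis using vhom_comp[OF S rep_pow_ind[OF assms(1)] assms(2) _ assms(3)] by blast
qed

text \<open>The families are the columns of \<open>H\<close>. Off \<open>S\<close> the matrix has no
  columns, which matches the clause of \<open>vhom\<close> by which a value leaving the set becomes
  zero.\<close>

lemma hom_of_vhoms:
  assumes S: "convex P lq S" and F: "rep F" and v: "\<And>j. j < d \<Longrightarrow> vhom S F (v j)"
  shows "\<exists>H. rhom (pow_ind S d) F H \<and> (\<forall>j<d. \<forall>p\<in>S. H p *\<^sub>v unit_vec d j = (v j p :: 'k::field vec))"
proof -
  define H where "H = (\<lambda>p. mat_of_cols (dm F p) (if p \<in> S then map (\<lambda>j. v j p) [0..<d] else []))"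
  have SP: "S \<subseteq> P" using S by (simp add: convex_def)
  have Hc: "H p \<in> carrier_mat (dm F p) (dm (pow_ind S d) p)" for p
    by (auto simp: H_def pow_ind_def intro!: carrier_matI)
  have Hj: "H p *\<^sub>v unit_vec d j = v j p" if "p \<in> S" "j < d" for p j
  proof -
    have "H p \<in> carrier_mat (dm F p) d" using Hc[of p] that by (simp add: pow_ind_def)
    hence "H p *\<^sub>v unit_vec d j = col (H p) j" using that(2) by (rule mat_unit_vec_col)
    also have "\<dots> = v j p" using that vhomD(1)[OF v[OF that(2)] that(1)]
      by (simp add: H_def col_mat_of_cols)
    finally show ?thesis .
  qed
  have "rhom (pow_ind S d) F H"
    unfolding is_hom_def
  proof (intro conjI ballI impI)
    fix p q assume h: "p \<in> P" "q \<in> P" "lq p q"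
    let ?J = "pow_ind S d :: ('p, 'k) prep"
    note m = rep_mat[OF rep_pow_ind[OF S] h, of d] rep_mat[OF F h] Hc[of p] Hc[of q]
    show "H q * mp ?J p q = mp F p q * H p"
    proof (rule mat_eqI_unit[OF mult_carrier_mat[OF m(4,1)] mult_carrier_mat[OF m(2,3)]])
      fix j assume "j < dm ?J p"
      hence j: "p \<in> S" "j < d" "dm ?J p = d" by (auto simp: pow_ind_def split: if_splits)
      have u: "(unit_vec d j :: 'k vec) \<in> carrier_vec (dm ?J p)" using j by simp
      have "(H q * mp ?J p q) *\<^sub>v unit_vec d j = H q *\<^sub>v (mp ?J p q *\<^sub>v unit_vec d j)"
        by (rule assoc_mult_mat_vec[OF m(4) m(1) u])
      also have "\<dots> = (if q \<in> S then v j q else 0\<^sub>v (dm F q))"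
      proof (cases "q \<in> S")
        case True thus ?thesis using j Hj by (simp add: pow_ind_def)
      next
        case False
        hence "H q \<in> carrier_mat (dm F q) 0" using Hc[of q] by (simp add: pow_ind_def)
        thus ?thesis using False j by (intro eq_vecI) (auto simp: scalar_prod_def pow_ind_def)
      qed
      also have "\<dots> = mp F p q *\<^sub>v (H p *\<^sub>v unit_vec d j)"
        using vhomD(2)[OF v[OF j(2)] j(1) h(2,3)] Hj[OF j(1,2)] by simp
      also have "\<dots> = (mp F p q * H p) *\<^sub>v unit_vec d j"
        by (rule assoc_mult_mat_vec[OF m(2) m(3) u, symmetric])
      finally show "(H q * mp ?J p q) *\<^sub>v unit_vec (dm ?J p) j = (mp F p q * H p) *\<^sub>v unit_vec (dm ?J p) j"
        using j(3) by simp
    qed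
  qed (use Hc in auto)
  thus ?thesis using Hj by blast
qed

section \<open>Binary direct sums and their canonical morphisms\<close>

lemma dsum_vec:
  assumes "rep X" "rep Y" "p \<in> P" "q \<in> P" "lq p q" "x \<in> carrier_vec (dm X p)" "y \<in> carrier_vec (dm Y p)"
  shows "mp (dsum X Y) p q *\<^sub>v (x @\<^sub>v y) = (mp X p q *\<^sub>v x) @\<^sub>v (mp Y p q *\<^sub>v y)"
  using four_block_mat_mult_vec[OF rep_mat[OF assms(1,3,4,5)] zero_carrier_mat zero_carrier_mat
      rep_mat[OF assms(2,3,4,5)] assms(6,7)] rep_vec[OF assms(1,3-6)] rep_vec[OF assms(2,3-5,7)] assms
  by (simp add: dsum_def)

lemma rep_dsum:
  assumes "rep X" "rep Y" shows "rep (dsum X Y)"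
proof (rule repI)
  fix p q assume "p \<in> P" "q \<in> P" "lq p q"
  thus "mp (dsum X Y) p q \<in> carrier_mat (dm (dsum X Y) q) (dm (dsum X Y) p)"
    using rep_mat[OF assms(1)] rep_mat[OF assms(2)] by (simp add: dsum_def)
next
  fix p and v :: "'a vec" assume h: "p \<in> P" "v \<in> carrier_vec (dm (dsum X Y) p)"
  have "v \<in> carrier_vec (dm X p + dm Y p)" using h(2) by simp
  then obtain x y where xy: "x \<in> carrier_vec (dm X p)" "y \<in> carrier_vec (dm Y p)" "v = x @\<^sub>v y"
    by (rule append_vec_cases)
  show "mp (dsum X Y) p p *\<^sub>v v = v"
    unfolding xy(3) dsum_vec[OF assms h(1) h(1) refl[OF h(1)] xy(1,2)] using xy h assms by (simp add: rep_id)
next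
  fix p q r and v :: "'a vec" assume h: "p \<in> P" "q \<in> P" "r \<in> P" "lq p q" "lq q r" "v \<in> carrier_vec (dm (dsum X Y) p)"
  have "v \<in> carrier_vec (dm X p + dm Y p)" using h(6) by simp
  then obtain x y where xy: "x \<in> carrier_vec (dm X p)" "y \<in> carrier_vec (dm Y p)" "v = x @\<^sub>v y"
    by (rule append_vec_cases)
  have pr: "lq p r" using h trans by blast
  show "mp (dsum X Y) q r *\<^sub>v (mp (dsum X Y) p q *\<^sub>v v) = mp (dsum X Y) p r *\<^sub>v v"
    unfolding xy(3) dsum_vec[OF assms h(1,2,4) xy(1,2)] dsum_vec[OF assms h(1,3) pr xy(1,2)]
      dsum_vec[OF assms h(2,3,5) rep_vec[OF assms(1) h(1,2,4) xy(1)] rep_vec[OF assms(2) h(1,2,4) xy(2)]]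
    using assms h xy by (simp add: rep_comp)
qed

definition dinl :: "('p, 'k::field) prep \<Rightarrow> ('p, 'k) prep \<Rightarrow> 'p \<Rightarrow> 'k mat" where
  "dinl X Y = (\<lambda>p. inl_mat (dm X p) (dm Y p))"
definition dinr :: "('p, 'k::field) prep \<Rightarrow> ('p, 'k) prep \<Rightarrow> 'p \<Rightarrow> 'k mat" where
  "dinr X Y = (\<lambda>p. inr_mat (dm X p) (dm Y p))"
definition dprl :: "('p, 'k::field) prep \<Rightarrow> ('p, 'k) prep \<Rightarrow> 'p \<Rightarrow> 'k mat" where
  "dprl X Y = (\<lambda>p. prl_mat (dm X p) (dm Y p))"
definition dprr :: "('p, 'k::field) prep \<Rightarrow> ('p, 'k) prep \<Rightarrow> 'p \<Rightarrow> 'k mat" where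
  "dprr X Y = (\<lambda>p. prr_mat (dm X p) (dm Y p))"

lemma mult_mat_zero_vec[simp]:
  "A \<in> carrier_mat n m \<Longrightarrow> A *\<^sub>v 0\<^sub>v m = (0\<^sub>v n :: 'b::field vec)"
  by (intro eq_vecI) auto

lemma rep_zero_vec: "\<lbrakk>rep X; p \<in> P; q \<in> P; lq p q\<rbrakk> \<Longrightarrow> mp X p q *\<^sub>v 0\<^sub>v (dm X p) = 0\<^sub>v (dm X q)"
  using rep_mat mult_mat_zero_vec by blast

lemma hom_zero_vec: "\<lbrakk>rhom X Y f; p \<in> P\<rbrakk> \<Longrightarrow> f p *\<^sub>v 0\<^sub>v (dm X p) = 0\<^sub>v (dm Y p)"
  using hom_mat mult_mat_zero_vec by blast

lemma dsum_homs:
  assumes X: "rep X" and Y: "rep Y"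
  shows "rhom X (dsum X Y) (dinl X Y)" "rhom Y (dsum X Y) (dinr X Y)"
    "rhom (dsum X Y) X (dprl X Y)" "rhom (dsum X Y) Y (dprr X Y)"
proof -
  note D = rep_dsum[OF X Y]
  show "rhom X (dsum X Y) (dinl X Y)"
    by (rule homI[OF X D])
      (simp_all add: dinl_def inl_mat_vec dsum_vec[OF X Y] rep_vec[OF X] rep_vec[OF Y] rep_zero_vec[OF Y])
  show "rhom Y (dsum X Y) (dinr X Y)"
    by (rule homI[OF Y D])
      (simp_all add: dinr_def inr_mat_vec dsum_vec[OF X Y] rep_vec[OF X] rep_vec[OF Y] rep_zero_vec[OF X])
  show "rhom (dsum X Y) X (dprl X Y)"
  proof (rule homI[OF D X])
    fix p q and v :: "'a vec" assume h: "p \<in> P" "q \<in> P" "lq p q" "v \<in> carrier_vec (dm (dsum X Y) p)"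
    from h(4) have "v \<in> carrier_vec (dm X p + dm Y p)" by simp
    then obtain x y where xy: "x \<in> carrier_vec (dm X p)" "y \<in> carrier_vec (dm Y p)" "v = x @\<^sub>v y"
      by (rule append_vec_cases)
    show "dprl X Y q *\<^sub>v (mp (dsum X Y) p q *\<^sub>v v) = mp X p q *\<^sub>v (dprl X Y p *\<^sub>v v)"
      unfolding xy(3) dsum_vec[OF X Y h(1-3) xy(1,2)] dprl_def
      using xy h by (simp add: prl_mat_vec rep_vec[OF X] rep_vec[OF Y])
  qed (simp add: dprl_def)
  show "rhom (dsum X Y) Y (dprr X Y)"
  proof (rule homI[OF D Y])
    fix p q and v :: "'a vec" assume h: "p \<in> P" "q \<in> P" "lq p q" "v \<in> carrier_vec (dm (dsum X Y) p)"
    from h(4) have "v \<in> carrier_vec (dm X p + dm Y p)" by simp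
    then obtain x y where xy: "x \<in> carrier_vec (dm X p)" "y \<in> carrier_vec (dm Y p)" "v = x @\<^sub>v y"
      by (rule append_vec_cases)
    show "dprr X Y q *\<^sub>v (mp (dsum X Y) p q *\<^sub>v v) = mp Y p q *\<^sub>v (dprr X Y p *\<^sub>v v)"
      unfolding xy(3) dsum_vec[OF X Y h(1-3) xy(1,2)] dprr_def
      using xy h by (simp add: prr_mat_vec rep_vec[OF X] rep_vec[OF Y])
  qed (simp add: dprr_def)
qed

lemma dsum_vecs:
  assumes "x \<in> carrier_vec (dm X p)" "y \<in> carrier_vec (dm Y p)"
  shows "dinl X Y p *\<^sub>v x = x @\<^sub>v 0\<^sub>v (dm Y p)" "dinr X Y p *\<^sub>v y = 0\<^sub>v (dm X p) @\<^sub>v y"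
    "dprl X Y p *\<^sub>v (x @\<^sub>v y) = x" "dprr X Y p *\<^sub>v (x @\<^sub>v y) = y"
  using assms by (simp_all add: dinl_def dinr_def dprl_def dprr_def inl_mat_vec inr_mat_vec prl_mat_vec prr_mat_vec)

lemma dsum_out:
  assumes X: "rep X" and Y: "rep Y" and M: "rep M" and f: "rhom X M f" and g: "rhom Y M g"
  shows "\<exists>h. rhom (dsum X Y) M h \<and> (\<forall>p\<in>P. \<forall>x\<in>carrier_vec (dm X p). \<forall>y\<in>carrier_vec (dm Y p).
     h p *\<^sub>v (x @\<^sub>v y) = f p *\<^sub>v x + g p *\<^sub>v (y :: 'k::field vec))"
proof -
  let ?h = "\<lambda>p. f p * dprl X Y p + g p * dprr X Y p"
  note D = rep_dsum[OF X Y] and dh = dsum_homs[OF X Y]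
  have c: "f p * dprl X Y p \<in> carrier_mat (dm M p) (dm (dsum X Y) p)"
     "g p * dprr X Y p \<in> carrier_mat (dm M p) (dm (dsum X Y) p)" if "p \<in> P" for p
    using that hom_mat[OF hom_comp[OF D X M dh(3) f]] hom_mat[OF hom_comp[OF D Y M dh(4) g]] by auto
  have v: "?h p *\<^sub>v (x @\<^sub>v y) = f p *\<^sub>v x + g p *\<^sub>v y" if "p \<in> P"
    "x \<in> carrier_vec (dm X p)" "y \<in> carrier_vec (dm Y p)" for p x y
  proof -
    have xy: "x @\<^sub>v y \<in> carrier_vec (dm (dsum X Y) p)" using that by simp
    show ?thesis
      unfolding add_mult_distrib_mat_vec[OF c[OF that(1)] xy] hom_comp_vec[OF dh(3) f that(1) xy]
        hom_comp_vec[OF dh(4) g that(1) xy] using dsum_vecs(3,4)[OF that(2,3)] by simp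
  qed
  have "rhom (dsum X Y) M ?h"
  proof (rule homI[OF D M])
    fix p q and v' :: "'k vec" assume h: "p \<in> P" "q \<in> P" "lq p q" "v' \<in> carrier_vec (dm (dsum X Y) p)"
    from h(4) have "v' \<in> carrier_vec (dm X p + dm Y p)" by simp
    then obtain x y where xy: "x \<in> carrier_vec (dm X p)" "y \<in> carrier_vec (dm Y p)" "v' = x @\<^sub>v y"
      by (rule append_vec_cases)
    show "?h q *\<^sub>v (mp (dsum X Y) p q *\<^sub>v v') = mp M p q *\<^sub>v (?h p *\<^sub>v v')"
      unfolding xy(3) dsum_vec[OF X Y h(1-3) xy(1,2)] v[OF h(1) xy(1,2)]
        v[OF h(2) rep_vec[OF X h(1-3) xy(1)] rep_vec[OF Y h(1-3) xy(2)]]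
        mult_add_distrib_mat_vec[OF rep_mat[OF M h(1-3)] hom_vec[OF f h(1) xy(1)] hom_vec[OF g h(1) xy(2)]]
        hom_nat[OF X M f h(1-3) xy(1)] hom_nat[OF Y M g h(1-3) xy(2)] ..
  qed (use c in auto)
  thus ?thesis using v by blast
qed

section \<open>Finite direct sums over lists\<close>

lemma rep_dsum_list: "\<forall>X\<in>set Xs. rep X \<Longrightarrow> rep (dsum_list Xs)"
  by (induction Xs) (auto simp: rep_zero rep_dsum)

text \<open>Inclusion of the summand with index \<open>i\<close>; the recursion follows the nesting
  of \<open>dsum_list\<close>. The value for the empty list is a dummy, as the facts about
  \<open>linj\<close> and \<open>lprj\<close> assume an index below the length.\<close>

primrec linj :: "('p, 'k::field) prep list \<Rightarrow> nat \<Rightarrow> 'p \<Rightarrow> 'k mat" where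
  "linj [] = (\<lambda>i p. 0\<^sub>m 0 0)"
| "linj (X # Xs) = (\<lambda>i p. case i of 0 \<Rightarrow> dinl X (dsum_list Xs) p
     | Suc j \<Rightarrow> dinr X (dsum_list Xs) p * linj Xs j p)"

primrec lprj :: "('p, 'k::field) prep list \<Rightarrow> nat \<Rightarrow> 'p \<Rightarrow> 'k mat" where
  "lprj [] = (\<lambda>i p. 0\<^sub>m 0 0)"
| "lprj (X # Xs) = (\<lambda>i p. case i of 0 \<Rightarrow> dprl X (dsum_list Xs) p
     | Suc j \<Rightarrow> lprj Xs j p * dprr X (dsum_list Xs) p)"

lemma linj_hom: "\<lbrakk>\<forall>X\<in>set Xs. rep X; i < length Xs\<rbrakk> \<Longrightarrow> rhom (Xs ! i) (dsum_list Xs) (linj Xs i)"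
proof (induction Xs arbitrary: i)
  case (Cons X Xs)
  have X: "rep X" and D: "rep (dsum_list Xs)" using Cons.prems rep_dsum_list by auto
  show ?case
  proof (cases i)
    case 0 thus ?thesis using dsum_homs[OF X D] by simp
  next
    case (Suc j)
    have "rep (Xs ! j)" using Cons.prems Suc by auto
    thus ?thesis using Suc hom_comp[OF _ D rep_dsum[OF X D] _ dsum_homs(2)[OF X D]] Cons by auto
  qed
qed simp

lemma lprj_hom: "\<lbrakk>\<forall>X\<in>set Xs. rep X; i < length Xs\<rbrakk> \<Longrightarrow> rhom (dsum_list Xs) (Xs ! i) (lprj Xs i)"
proof (induction Xs arbitrary: i)
  case (Cons X Xs)
  have X: "rep X" and D: "rep (dsum_list Xs)" using Cons.prems rep_dsum_list by auto
  show ?case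
  proof (cases i)
    case 0 thus ?thesis using dsum_homs[OF X D] by simp
  next
    case (Suc j)
    have "rep (Xs ! j)" using Cons.prems Suc by auto
    thus ?thesis using Suc hom_comp[OF rep_dsum[OF X D] D _ dsum_homs(4)[OF X D]] Cons by auto
  qed
qed simp

lemma linj_Suc_vec:
  assumes "\<forall>X\<in>set (X # Xs). rep X" "i < length Xs" "p \<in> P" "x \<in> carrier_vec (dm (Xs ! i) p)"
  shows "linj (X # Xs) (Suc i) p *\<^sub>v x = 0\<^sub>v (dm X p) @\<^sub>v (linj Xs i p *\<^sub>v x)"
proof -
  have X: "rep X" and D: "rep (dsum_list Xs)" using assms rep_dsum_list by auto
  have l: "rhom (Xs ! i) (dsum_list Xs) (linj Xs i)" using assms linj_hom by auto
  show ?thesis using hom_comp_vec[OF l dsum_homs(2)[OF X D] assms(3,4)]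
      dsum_vecs(2)[OF _ hom_vec[OF l assms(3,4)], of "0\<^sub>v (dm X p)" X] by simp
qed

lemma lprj_Suc_vec:
  assumes "\<forall>X\<in>set (X # Xs). rep X" "i < length Xs" "p \<in> P" "x \<in> carrier_vec (dm X p)"
    "y \<in> carrier_vec (dm (dsum_list Xs) p)"
  shows "lprj (X # Xs) (Suc i) p *\<^sub>v (x @\<^sub>v y) = lprj Xs i p *\<^sub>v y"
proof -
  have X: "rep X" and D: "rep (dsum_list Xs)" using assms rep_dsum_list by auto
  have l: "rhom (dsum_list Xs) (Xs ! i) (lprj Xs i)" using assms lprj_hom by auto
  have xy: "x @\<^sub>v y \<in> carrier_vec (dm (dsum X (dsum_list Xs)) p)" using assms by simp
  show ?thesis using hom_comp_vec[OF dsum_homs(4)[OF X D] l assms(3) xy] dsum_vecs(4)[OF assms(4,5)] by simp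
qed

lemma lprj_linj:
  "\<lbrakk>\<forall>X\<in>set Xs. rep X; i < length Xs; j < length Xs; p \<in> P; x \<in> carrier_vec (dm (Xs ! j) p)\<rbrakk>
    \<Longrightarrow> lprj Xs i p *\<^sub>v (linj Xs j p *\<^sub>v x) = (if i = j then x else 0\<^sub>v (dm (Xs ! i) p))"
proof (induction Xs arbitrary: i j)
  case (Cons X Xs)
  have X: "rep X" and D: "rep (dsum_list Xs)" and Xs: "\<forall>X\<in>set Xs. rep X"
    using Cons.prems rep_dsum_list by auto
  have z: "0\<^sub>v (dm X p) \<in> carrier_vec (dm X p)" "0\<^sub>v (dm (dsum_list Xs) p) \<in> carrier_vec (dm (dsum_list Xs) p)" by auto
  show ?case
  proof (cases j)
    case 0
    hence x: "x \<in> carrier_vec (dm X p)" using Cons.prems by simp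
    hence l: "linj (X # Xs) j p *\<^sub>v x = x @\<^sub>v 0\<^sub>v (dm (dsum_list Xs) p)" using 0 dsum_vecs(1)[OF x z(2)] by simp
    show ?thesis
    proof (cases i)
      case 0 thus ?thesis using l \<open>j = 0\<close> dsum_vecs(3)[OF x z(2)] by simp
    next
      case (Suc i')
      thus ?thesis using l \<open>j = 0\<close> Cons.prems lprj_Suc_vec[OF Cons.prems(1) _ _ x z(2), of i']
          hom_zero_vec[OF lprj_hom[OF Xs, of i']] by simp
    qed
  next
    case (Suc j')
    hence x: "x \<in> carrier_vec (dm (Xs ! j') p)" and j': "j' < length Xs" using Cons.prems by auto
    have l: "linj (X # Xs) j p *\<^sub>v x = 0\<^sub>v (dm X p) @\<^sub>v (linj Xs j' p *\<^sub>v x)"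
      using linj_Suc_vec[OF Cons.prems(1) j' Cons.prems(4) x] Suc by simp
    have c: "linj Xs j' p *\<^sub>v x \<in> carrier_vec (dm (dsum_list Xs) p)"
      by (rule hom_vec[OF linj_hom[OF Xs j'] Cons.prems(4) x])
    show ?thesis
    proof (cases i)
      case 0 thus ?thesis using l Suc dsum_vecs(3)[OF z(1) c] by simp
    next
      case (Suc i')
      thus ?thesis using l \<open>j = Suc j'\<close> Cons.prems lprj_Suc_vec[OF Cons.prems(1) _ _ z(1) c, of i']
          Cons.IH[OF Xs _ j' Cons.prems(4) x, of i'] by simp
    qed
  qed
qed simp

text \<open>Replaces the identity that the products \<open>linj Xs i * lprj Xs i\<close> add up to
  one, without forming a sum of matrices. \<open>L\<close> is any matrix and not a morphism: the
  induction restricts it to the tail, and later uses insert differences of morphisms at a single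
  point.\<close>

lemma dsum_list_kill:
  "\<lbrakk>\<forall>X\<in>set Xs. rep X; p \<in> P; w \<in> carrier_vec (dm (dsum_list Xs) p); L \<in> carrier_mat k (dm (dsum_list Xs) p);
    \<And>i. i < length Xs \<Longrightarrow> L *\<^sub>v (linj Xs i p *\<^sub>v (lprj Xs i p *\<^sub>v w)) = 0\<^sub>v k\<rbrakk> \<Longrightarrow> L *\<^sub>v w = 0\<^sub>v k"
proof (induction Xs arbitrary: w L)
  case Nil
  have "w = 0\<^sub>v 0" using Nil by (intro eq_vecI) auto
  thus ?case using Nil(4) by (intro eq_vecI) (auto simp: scalar_prod_def)
next
  case (Cons X Xs)
  have X: "rep X" and D: "rep (dsum_list Xs)" and Xs: "\<forall>X\<in>set Xs. rep X"
    using Cons.prems rep_dsum_list by auto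
  have z: "0\<^sub>v (dm X p) \<in> carrier_vec (dm X p)" "0\<^sub>v (dm (dsum_list Xs) p) \<in> carrier_vec (dm (dsum_list Xs) p)" by auto
  from Cons.prems(3) have "w \<in> carrier_vec (dm X p + dm (dsum_list Xs) p)" by simp
  then obtain x y where xy: "x \<in> carrier_vec (dm X p)" "y \<in> carrier_vec (dm (dsum_list Xs) p)" "w = x @\<^sub>v y"
    by (rule append_vec_cases)
  let ?R = "dinr X (dsum_list Xs) p"
  have L: "L \<in> carrier_mat k (dm (dsum X (dsum_list Xs)) p)" using Cons.prems by simp
  have R: "?R \<in> carrier_mat (dm (dsum X (dsum_list Xs)) p) (dm (dsum_list Xs) p)"
    by (rule hom_mat[OF dsum_homs(2)[OF X D] Cons.prems(2)])
  have LR: "(L * ?R) *\<^sub>v u = L *\<^sub>v (0\<^sub>v (dm X p) @\<^sub>v u)" if u: "u \<in> carrier_vec (dm (dsum_list Xs) p)" for u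
    using assoc_mult_mat_vec[OF L R u] dsum_vecs(2)[OF z(1) u] by simp
  have "(L * ?R) *\<^sub>v y = 0\<^sub>v k"
  proof (rule Cons.IH[OF Xs Cons.prems(2) xy(2)])
    show "L * ?R \<in> carrier_mat k (dm (dsum_list Xs) p)" using L R by (rule mult_carrier_mat)
    fix i assume i: "i < length Xs"
    have lc: "lprj Xs i p *\<^sub>v y \<in> carrier_vec (dm (Xs ! i) p)"
      by (rule hom_vec[OF lprj_hom[OF Xs i] Cons.prems(2) xy(2)])
    have ic: "linj Xs i p *\<^sub>v (lprj Xs i p *\<^sub>v y) \<in> carrier_vec (dm (dsum_list Xs) p)"
      by (rule hom_vec[OF linj_hom[OF Xs i] Cons.prems(2) lc])
    show "(L * ?R) *\<^sub>v (linj Xs i p *\<^sub>v (lprj Xs i p *\<^sub>v y)) = 0\<^sub>v k"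
      unfolding LR[OF ic]
      using Cons.prems(5)[of "Suc i"] i unfolding xy(3) lprj_Suc_vec[OF Cons.prems(1) i Cons.prems(2) xy(1,2)]
        linj_Suc_vec[OF Cons.prems(1) i Cons.prems(2) lc] by simp
  qed
  hence 1: "L *\<^sub>v (0\<^sub>v (dm X p) @\<^sub>v y) = 0\<^sub>v k" using LR[OF xy(2)] by simp
  have 2: "L *\<^sub>v (x @\<^sub>v 0\<^sub>v (dm (dsum_list Xs) p)) = 0\<^sub>v k"
    using Cons.prems(5)[of 0] dsum_vecs(3)[OF xy(1,2)] dsum_vecs(1)[OF xy(1,2)] unfolding xy(3) by simp
  have "w = (x @\<^sub>v 0\<^sub>v (dm (dsum_list Xs) p)) + (0\<^sub>v (dm X p) @\<^sub>v y)"
    unfolding xy(3) append_vec_add[OF xy(1) z(1) z(2) xy(2)] using xy by simp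
  moreover have "L *\<^sub>v \<dots> = L *\<^sub>v (x @\<^sub>v 0\<^sub>v (dm (dsum_list Xs) p)) + L *\<^sub>v (0\<^sub>v (dm X p) @\<^sub>v y)"
    by (rule mult_add_distrib_mat_vec[OF L]) (use xy in auto)
  ultimately show ?case using 1 2 by simp
qed

text \<open>The existence half of the universal property; the uniqueness half is
  \<open>dsum_list_eqI\<close>.\<close>

lemma dsum_list_out:
  "\<lbrakk>\<forall>X\<in>set Xs. rep X; rep M; \<And>i. i < length Xs \<Longrightarrow> rhom (Xs ! i) M (g i)\<rbrakk>
    \<Longrightarrow> \<exists>h. rhom (dsum_list Xs) M h \<and> (\<forall>i<length Xs. \<forall>p\<in>P. \<forall>x\<in>carrier_vec (dm (Xs ! i) p).
       h p *\<^sub>v (linj Xs i p *\<^sub>v x) = g i p *\<^sub>v (x :: 'k::field vec))"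
proof (induction Xs arbitrary: g)
  case Nil
  have "rhom zero_rep M (\<lambda>p. 0\<^sub>m (dm M p) 0)"
    by (rule homI[OF rep_zero Nil(2)])
      (use Nil(2) in \<open>auto simp: zero_rep_def rep_zero_vec intro!: eq_vecI\<close>)
  thus ?case by auto
next
  case (Cons X Xs)
  have X: "rep X" and D: "rep (dsum_list Xs)" and Xs: "\<forall>X\<in>set Xs. rep X"
    using Cons.prems rep_dsum_list by auto
  have g0: "rhom X M (g 0)" using Cons.prems(3)[of 0] by simp
  have "rhom (Xs ! i) M (g (Suc i))" if "i < length Xs" for i using Cons.prems(3)[of "Suc i"] that by simp
  from Cons.IH[OF Xs Cons.prems(2) this] obtain h' where h': "rhom (dsum_list Xs) M h'"
    "\<And>i p x. \<lbrakk>i < length Xs; p \<in> P; x \<in> carrier_vec (dm (Xs ! i) p)\<rbrakk> \<Longrightarrow> h' p *\<^sub>v (linj Xs i p *\<^sub>v x) = g (Suc i) p *\<^sub>v x"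
    by blast
  from dsum_out[OF X D Cons.prems(2) g0 h'(1)] obtain h where h: "rhom (dsum X (dsum_list Xs)) M h"
    "\<And>p x y. \<lbrakk>p \<in> P; x \<in> carrier_vec (dm X p); y \<in> carrier_vec (dm (dsum_list Xs) p)\<rbrakk> \<Longrightarrow>
      h p *\<^sub>v (x @\<^sub>v y) = g 0 p *\<^sub>v x + h' p *\<^sub>v y" by blast
  have "h p *\<^sub>v (linj (X # Xs) i p *\<^sub>v x) = g i p *\<^sub>v x"
    if i: "i < length (X # Xs)" and p: "p \<in> P" and x: "x \<in> carrier_vec (dm ((X # Xs) ! i) p)" for i p x
  proof (cases i)
    case 0
    hence x: "x \<in> carrier_vec (dm X p)" using x by simp
    have "h p *\<^sub>v (linj (X # Xs) i p *\<^sub>v x) = h p *\<^sub>v (x @\<^sub>v 0\<^sub>v (dm (dsum_list Xs) p))"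
      using 0 dsum_vecs(1)[OF x zero_carrier_vec, of "dsum_list Xs"] by simp
    also have "\<dots> = g 0 p *\<^sub>v x + h' p *\<^sub>v 0\<^sub>v (dm (dsum_list Xs) p)" by (rule h(2)[OF p x]) simp
    also have "\<dots> = g i p *\<^sub>v x" using 0 hom_zero_vec[OF h'(1) p] hom_vec[OF g0 p x] by simp
    finally show ?thesis .
  next
    case (Suc j)
    hence x: "x \<in> carrier_vec (dm (Xs ! j) p)" and j: "j < length Xs" using i x by auto
    have "h p *\<^sub>v (linj (X # Xs) i p *\<^sub>v x) = h p *\<^sub>v (0\<^sub>v (dm X p) @\<^sub>v (linj Xs j p *\<^sub>v x))"
      using Suc linj_Suc_vec[OF Cons.prems(1) j p x] by simp
    also have "\<dots> = g 0 p *\<^sub>v 0\<^sub>v (dm X p) + h' p *\<^sub>v (linj Xs j p *\<^sub>v x)"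
      by (rule h(2)[OF p _ hom_vec[OF linj_hom[OF Xs j] p x]]) simp
    also have "\<dots> = g i p *\<^sub>v x"
      using Suc hom_zero_vec[OF g0 p] h'(2)[OF j p x] hom_vec[OF Cons.prems(3) p, of i x] i p x Cons.prems
      by (simp add: Suc)
    finally show ?thesis .
  qed
  thus ?case using h(1) by (intro exI[of _ h]) auto
qed

end

text \<open>Unlike for \<^const>\<open>is_rep\<close>, no relation between p and q is required: this makes direct sums of such
representations strictly associative and unital as records, so no isomorphisms have to be tracked.\<close>

definition well_dim :: "('p, 'k::field) prep \<Rightarrow> bool" where
  "well_dim X \<longleftrightarrow> (\<forall>p q. mp X p q \<in> carrier_mat (dm X q) (dm X p))"

lemma well_dim_zero: "well_dim zero_rep" by (simp add: well_dim_def zero_rep_def)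
lemma well_dim_pow_ind: "well_dim (pow_ind S d)" by (simp add: well_dim_def pow_ind_def)
lemma well_dim_dsum: "well_dim X \<Longrightarrow> well_dim Y \<Longrightarrow> well_dim (dsum X Y)"
  unfolding well_dim_def by (simp add: dsum_def)
lemma well_dim_dsum_list: "\<forall>X\<in>set Xs. well_dim X \<Longrightarrow> well_dim (dsum_list Xs)"
  by (induction Xs) (auto simp: well_dim_zero well_dim_dsum)

lemma dsum_assoc:
  assumes "well_dim X" "well_dim Y" "well_dim Z"
  shows "dsum (dsum X Y) Z = dsum X (dsum Y Z)"
proof -
  have "mp (dsum (dsum X Y) Z) p q = mp (dsum X (dsum Y Z)) p q" for p q
  proof -
    have m: "mp X p q \<in> carrier_mat (dm X q) (dm X p)" "mp Y p q \<in> carrier_mat (dm Y q) (dm Y p)"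
      "mp Z p q \<in> carrier_mat (dm Z q) (dm Z p)" using assms by (auto simp: well_dim_def)
    thus ?thesis
      by (intro eq_matI) (auto simp: dsum_def Let_def)
  qed
  hence "mp (dsum (dsum X Y) Z) = mp (dsum X (dsum Y Z))" by blast
  moreover have "dm (dsum (dsum X Y) Z) = dm (dsum X (dsum Y Z))" by (auto simp: add.assoc)
  ultimately show ?thesis by (intro prep.equality) simp_all
qed

lemma dsum_zero_left: "well_dim X \<Longrightarrow> dsum zero_rep X = X"
proof -
  assume X: "well_dim X"
  have "mp (dsum zero_rep X) p q = mp X p q" for p q
    using X by (intro eq_matI) (auto simp: dsum_def zero_rep_def well_dim_def)
  hence "mp (dsum zero_rep X) = mp X" by blast
  moreover have "dm (dsum zero_rep X) = dm X" by auto
  ultimately show ?thesis by (intro prep.equality) simp_all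
qed

lemma dsum_zero_right: "well_dim X \<Longrightarrow> dsum X zero_rep = X"
proof -
  assume X: "well_dim X"
  have "mp (dsum X zero_rep) p q = mp X p q" for p q
    using X by (intro eq_matI) (auto simp: dsum_def zero_rep_def well_dim_def)
  hence "mp (dsum X zero_rep) = mp X" by blast
  moreover have "dm (dsum X zero_rep) = dm X" by auto
  ultimately show ?thesis by (intro prep.equality) simp_all
qed

lemma dsum_list_append:
  "\<forall>X\<in>set (Xs @ Ys). well_dim X \<Longrightarrow> dsum_list (Xs @ Ys) = dsum (dsum_list Xs) (dsum_list Ys)"
  by (induction Xs) (auto simp: dsum_zero_left dsum_assoc well_dim_dsum_list)

lemma pow_ind_0: "pow_ind S 0 = zero_rep"
proof -
  have "mp (pow_ind S 0) p q = mp zero_rep p q" for p q :: 'a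
    by (auto simp: pow_ind_def zero_rep_def intro!: eq_matI)
  hence "mp (pow_ind S 0) = mp zero_rep" by blast
  moreover have "dm (pow_ind S 0) = dm zero_rep" by (auto simp: pow_ind_def)
  ultimately show ?thesis by (intro prep.equality) simp_all
qed

lemma pow_ind_Suc: "pow_ind S (Suc d) = dsum (indicator_rep S) (pow_ind S d)"
proof -
  have "mp (pow_ind S (Suc d)) p q = mp (dsum (indicator_rep S) (pow_ind S d)) p q" for p q :: 'a
    by (intro eq_matI) (auto simp: pow_ind_def dsum_def indicator_rep_def)
  hence "mp (pow_ind S (Suc d)) = mp (dsum (indicator_rep S) (pow_ind S d))" by blast
  moreover have "dm (pow_ind S (Suc d)) = dm (dsum (indicator_rep S) (pow_ind S d))"
    by (auto simp: pow_ind_def indicator_rep_def)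
  ultimately show ?thesis by (intro prep.equality) simp_all
qed

lemma well_dim_indicator: "well_dim (indicator_rep S)" unfolding pow_ind_1 by (rule well_dim_pow_ind)

lemma dsum_list_replicate: "dsum_list (replicate d (indicator_rep S)) = pow_ind S d"
  by (induction d) (simp_all add: pow_ind_0 pow_ind_Suc)

text \<open>An approximation is assembled from powers, one for each spread, while
  \<open>add_spread\<close> asks for a list of single indicators. The two sums are the same
  record.\<close>

lemma dsum_list_pow_ind:
  "(dsum_list (map (\<lambda>T. pow_ind (f T) (d T)) Ts) :: ('p, 'k::field) prep) =
   dsum_list (map indicator_rep (concat (map (\<lambda>T. replicate (d T) (f T)) Ts)))"
proof (induction Ts)
  case (Cons T Ts)
  have "\<forall>X\<in>set (map indicator_rep (replicate (d T) (f T)) @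
      map indicator_rep (concat (map (\<lambda>T. replicate (d T) (f T)) Ts))). well_dim (X :: ('p, 'k) prep)"
    using well_dim_indicator by auto
  from dsum_list_append[OF this] Cons show ?case by (simp add: dsum_list_replicate)
qed simp

context rposet begin

section \<open>Liftings, retracts, isomorphisms and kernels\<close>

lemma rhom_vecs_eq_iff:
  assumes "A \<in> carrier_mat n m" "B \<in> carrier_mat n m"
  shows "A = B \<longleftrightarrow> (\<forall>v\<in>carrier_vec m. A *\<^sub>v v = B *\<^sub>v (v :: 'k::field vec))"
  using mat_eqI_vec[OF assms] by blast

lemma hom_zero_comp_iff:
  assumes "rhom Z B h" "rhom B D d" "p \<in> P"
  shows "d p * h p = 0\<^sub>m (dm D p) (dm Z p) \<longleftrightarrow>
    (\<forall>v\<in>carrier_vec (dm Z p). d p *\<^sub>v (h p *\<^sub>v v) = 0\<^sub>v (dm D p))"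
  unfolding rhom_vecs_eq_iff[OF mult_carrier_mat[OF hom_mat[OF assms(2,3)] hom_mat[OF assms(1,3)]] zero_carrier_mat]
  using hom_comp_vec[OF assms] by simp

lemma hom_eq_comp_iff:
  assumes "rhom Z B h" "rhom Z C k" "rhom C B f" "p \<in> P"
  shows "h p = f p * k p \<longleftrightarrow> (\<forall>v\<in>carrier_vec (dm Z p). h p *\<^sub>v v = f p *\<^sub>v (k p *\<^sub>v v))"
  unfolding rhom_vecs_eq_iff[OF hom_mat[OF assms(1,4)] mult_carrier_mat[OF hom_mat[OF assms(3,4)] hom_mat[OF assms(2,4)]]]
  using hom_comp_vec[OF assms(2-4)] by simp

text \<open>Surjectivity of Hom(Z, f), stated on vectors. \<open>liftsD\<close> leads back to the
  matrix products in which exactness and resolutions are defined.\<close>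

definition lifts :: "('p, 'k::field) prep \<Rightarrow> ('p, 'k) prep \<Rightarrow> ('p \<Rightarrow> 'k mat) \<Rightarrow> ('p, 'k) prep \<Rightarrow> bool" where
  "lifts Z C f B \<longleftrightarrow> (\<forall>h. rhom Z B h \<longrightarrow>
     (\<exists>k. rhom Z C k \<and> (\<forall>p\<in>P. \<forall>v\<in>carrier_vec (dm Z p). h p *\<^sub>v v = f p *\<^sub>v (k p *\<^sub>v v))))"

text \<open>A direct summand without a named complement. When one has to be produced, it is a
  kernel, as in \<open>split_off\<close>.\<close>

definition retract :: "('p, 'k::field) prep \<Rightarrow> ('p, 'k) prep \<Rightarrow> bool" where
  "retract X C \<longleftrightarrow> (\<exists>s r. rhom X C s \<and> rhom C X r \<and>
     (\<forall>p\<in>P. \<forall>v\<in>carrier_vec (dm X p). r p *\<^sub>v (s p *\<^sub>v v) = v))"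

text \<open>Extend to \<open>W\<close> by the retraction, lift there, restrict by the
  section.\<close>

lemma lifts_retract:
  assumes "rep Z" "rep W" "rep B" "rep C" "retract Z W" "lifts W C f B"
  shows "lifts Z C f B"
  unfolding lifts_def
proof (intro allI impI)
  fix h assume h: "rhom Z B h"
  obtain s r where sr: "rhom Z W s" "rhom W Z r"
    "\<And>p v. p \<in> P \<Longrightarrow> v \<in> carrier_vec (dm Z p) \<Longrightarrow> r p *\<^sub>v (s p *\<^sub>v v) = v"
    using assms(5) unfolding retract_def by blast
  obtain k where k: "rhom W C k"
    "\<And>p v. p \<in> P \<Longrightarrow> v \<in> carrier_vec (dm W p) \<Longrightarrow> (h p * r p) *\<^sub>v v = f p *\<^sub>v (k p *\<^sub>v v)"
    using assms(6) hom_comp[OF assms(2,1,3) sr(2) h] unfolding lifts_def by blast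
  have "h p *\<^sub>v v = f p *\<^sub>v ((k p * s p) *\<^sub>v v)" if "p \<in> P" "v \<in> carrier_vec (dm Z p)" for p v
    using k(2)[OF that(1) hom_vec[OF sr(1) that]] sr(3)[OF that]
      hom_comp_vec[OF sr(2) h that(1) hom_vec[OF sr(1) that]] hom_comp_vec[OF sr(1) k(1) that] by simp
  thus "\<exists>k. rhom Z C k \<and> (\<forall>p\<in>P. \<forall>v\<in>carrier_vec (dm Z p). h p *\<^sub>v v = f p *\<^sub>v (k p *\<^sub>v v))"
    using hom_comp[OF assms(1,2,4) sr(1) k(1)] by (intro exI[of _ "\<lambda>p. k p * s p"]) blast
qed

lemma dsum_list_eqI:
  assumes Xs: "\<forall>X\<in>set Xs. rep X" and f: "rhom (dsum_list Xs) M f" and g: "rhom (dsum_list Xs) M g"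
    and p: "p \<in> P" and w: "w \<in> carrier_vec (dm (dsum_list Xs) p)"
    and eq: "\<And>i x. i < length Xs \<Longrightarrow> x \<in> carrier_vec (dm (Xs ! i) p) \<Longrightarrow>
      f p *\<^sub>v (linj Xs i p *\<^sub>v x) = g p *\<^sub>v (linj Xs i p *\<^sub>v x)"
  shows "f p *\<^sub>v w = g p *\<^sub>v w"
proof -
  let ?n = "dm M p" and ?m = "dm (dsum_list Xs) p"
  have fc: "f p \<in> carrier_mat ?n ?m" and gc: "g p \<in> carrier_mat ?n ?m" using f g p by (auto intro: hom_mat)
  have d: "(f p - g p) *\<^sub>v v = f p *\<^sub>v v - g p *\<^sub>v v" if "v \<in> carrier_vec ?m" for v
    by (rule minus_mult_distrib_mat_vec[OF fc gc that])
  have "(f p - g p) *\<^sub>v w = 0\<^sub>v ?n"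
  proof (rule dsum_list_kill[OF Xs p w])
    show "f p - g p \<in> carrier_mat ?n ?m" using gc by (rule minus_carrier_mat)
    fix i assume i: "i < length Xs"
    have l: "lprj Xs i p *\<^sub>v w \<in> carrier_vec (dm (Xs ! i) p)" by (rule hom_vec[OF lprj_hom[OF Xs i] p w])
    show "(f p - g p) *\<^sub>v (linj Xs i p *\<^sub>v (lprj Xs i p *\<^sub>v w)) = 0\<^sub>v ?n"
      unfolding d[OF hom_vec[OF linj_hom[OF Xs i] p l]] eq[OF i l]
      using hom_vec[OF g p hom_vec[OF linj_hom[OF Xs i] p l]] by simp
  qed
  thus ?thesis unfolding d[OF w] using vec_zero_eq hom_vec[OF f p w] hom_vec[OF g p w] by blast
qed

text \<open>Lift on each summand and glue; the result is checked on the inclusions, which determine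
  a morphism out of the sum.\<close>

lemma lifts_dsum_list:
  assumes Xs: "\<forall>X\<in>set Xs. rep X" and B: "rep B" and C: "rep C" and f: "rhom C B f"
    and l: "\<forall>X\<in>set Xs. lifts X C f B"
  shows "lifts (dsum_list Xs) C f B"
  unfolding lifts_def
proof (intro allI impI)
  fix h assume h: "rhom (dsum_list Xs) B h"
  note D = rep_dsum_list[OF Xs]
  have "\<exists>k. rhom (Xs ! i) C k \<and> (\<forall>p\<in>P. \<forall>v\<in>carrier_vec (dm (Xs ! i) p). (h p * linj Xs i p) *\<^sub>v v = f p *\<^sub>v (k p *\<^sub>v v))"
    if i: "i < length Xs" for i
  proof -
    have "rep (Xs ! i)" "lifts (Xs ! i) C f B" using i Xs l by auto
    thus ?thesis using hom_comp[OF _ D B linj_hom[OF Xs i] h] unfolding lifts_def by blast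
  qed
  then obtain k where k: "\<And>i. i < length Xs \<Longrightarrow> rhom (Xs ! i) C (k i)"
    "\<And>i p v. \<lbrakk>i < length Xs; p \<in> P; v \<in> carrier_vec (dm (Xs ! i) p)\<rbrakk> \<Longrightarrow> (h p * linj Xs i p) *\<^sub>v v = f p *\<^sub>v (k i p *\<^sub>v v)"
    by metis
  obtain K where K: "rhom (dsum_list Xs) C K"
    "\<And>i p x. \<lbrakk>i < length Xs; p \<in> P; x \<in> carrier_vec (dm (Xs ! i) p)\<rbrakk> \<Longrightarrow> K p *\<^sub>v (linj Xs i p *\<^sub>v x) = k i p *\<^sub>v x"
    using dsum_list_out[OF Xs C k(1)] by blast
  have fK: "rhom (dsum_list Xs) B (\<lambda>p. f p * K p)" by (rule hom_comp[OF D C B K(1) f])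
  have "h p *\<^sub>v v = f p *\<^sub>v (K p *\<^sub>v v)" if p: "p \<in> P" and v: "v \<in> carrier_vec (dm (dsum_list Xs) p)" for p v
  proof -
    have "h p *\<^sub>v v = (f p * K p) *\<^sub>v v"
    proof (rule dsum_list_eqI[OF Xs h fK p v])
      fix i and x :: "'a vec" assume i: "i < length Xs" and x: "x \<in> carrier_vec (dm (Xs ! i) p)"
      note ix = hom_vec[OF linj_hom[OF Xs i] p x]
      show "h p *\<^sub>v (linj Xs i p *\<^sub>v x) = (f p * K p) *\<^sub>v (linj Xs i p *\<^sub>v x)"
        unfolding hom_comp_vec[OF K(1) f p ix] K(2)[OF i p x]
        using k(2)[OF i p x] hom_comp_vec[OF linj_hom[OF Xs i] h p x] by simp
    qed
    thus ?thesis using hom_comp_vec[OF K(1) f p v] by simp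
  qed
  thus "\<exists>k. rhom (dsum_list Xs) C k \<and> (\<forall>p\<in>P. \<forall>v\<in>carrier_vec (dm (dsum_list Xs) p). h p *\<^sub>v v = f p *\<^sub>v (k p *\<^sub>v v))"
    using K(1) by blast
qed

lemma isoD:
  assumes "iso P lq X Y"
  obtains f g where "rhom X Y f" "rhom Y X g"
    "\<And>p v. \<lbrakk>p \<in> P; v \<in> carrier_vec (dm X p)\<rbrakk> \<Longrightarrow> g p *\<^sub>v (f p *\<^sub>v v) = v"
    "\<And>p v. \<lbrakk>p \<in> P; v \<in> carrier_vec (dm Y p)\<rbrakk> \<Longrightarrow> f p *\<^sub>v (g p *\<^sub>v v) = v"
proof -
  obtain f g where fg: "rhom X Y f" "rhom Y X g" "\<And>p. p \<in> P \<Longrightarrow> g p * f p = 1\<^sub>m (dm X p) \<and> f p * g p = 1\<^sub>m (dm Y p)"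
    using assms unfolding iso_def by blast
  show ?thesis
  proof (rule that[OF fg(1,2)])
    fix p and v :: "'a vec" assume "p \<in> P" "v \<in> carrier_vec (dm X p)"
    thus "g p *\<^sub>v (f p *\<^sub>v v) = v" using hom_comp_vec[OF fg(1,2)] fg(3) one_mult_mat_vec by metis
  next
    fix p and v :: "'a vec" assume "p \<in> P" "v \<in> carrier_vec (dm Y p)"
    thus "f p *\<^sub>v (g p *\<^sub>v v) = v" using hom_comp_vec[OF fg(2,1)] fg(3) one_mult_mat_vec by metis
  qed
qed

lemma isoI:
  assumes f: "rhom X Y f" and g: "rhom Y X g"
    and gf: "\<And>p v. \<lbrakk>p \<in> P; v \<in> carrier_vec (dm X p)\<rbrakk> \<Longrightarrow> g p *\<^sub>v (f p *\<^sub>v v) = (v :: 'k::field vec)"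
    and fg: "\<And>p v. \<lbrakk>p \<in> P; v \<in> carrier_vec (dm Y p)\<rbrakk> \<Longrightarrow> f p *\<^sub>v (g p *\<^sub>v v) = v"
  shows "iso P lq X Y"
proof -
  have "g p * f p = 1\<^sub>m (dm X p)" if p: "p \<in> P" for p
  proof (rule mat_eqI_vec[OF mult_carrier_mat[OF hom_mat[OF g p] hom_mat[OF f p]] one_carrier_mat])
    fix v :: "'k vec" assume v: "v \<in> carrier_vec (dm X p)"
    show "(g p * f p) *\<^sub>v v = 1\<^sub>m (dm X p) *\<^sub>v v"
      unfolding hom_comp_vec[OF f g p v] gf[OF p v] one_mult_mat_vec[OF v] ..
  qed
  moreover have "f p * g p = 1\<^sub>m (dm Y p)" if p: "p \<in> P" for p
  proof (rule mat_eqI_vec[OF mult_carrier_mat[OF hom_mat[OF f p] hom_mat[OF g p]] one_carrier_mat])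
    fix v :: "'k vec" assume v: "v \<in> carrier_vec (dm Y p)"
    show "(f p * g p) *\<^sub>v v = 1\<^sub>m (dm Y p) *\<^sub>v v"
      unfolding hom_comp_vec[OF g f p v] fg[OF p v] one_mult_mat_vec[OF v] ..
  qed
  ultimately show ?thesis unfolding iso_def using f g by blast
qed

lemma iso_refl: "rep X \<Longrightarrow> iso P lq X X"
  by (rule isoI[OF hom_id hom_id]) auto

lemma iso_trans:
  assumes "rep X" "rep Y" "rep Z" "iso P lq X Y" "iso P lq Y Z"
  shows "iso P lq X Z"
proof -
  obtain f g where fg: "rhom X Y f" "rhom Y X g"
    "\<And>p v. \<lbrakk>p \<in> P; v \<in> carrier_vec (dm X p)\<rbrakk> \<Longrightarrow> g p *\<^sub>v (f p *\<^sub>v v) = v"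
    "\<And>p v. \<lbrakk>p \<in> P; v \<in> carrier_vec (dm Y p)\<rbrakk> \<Longrightarrow> f p *\<^sub>v (g p *\<^sub>v v) = v"
    using isoD[OF assms(4)] by metis
  obtain f' g' where fg': "rhom Y Z f'" "rhom Z Y g'"
    "\<And>p v. \<lbrakk>p \<in> P; v \<in> carrier_vec (dm Y p)\<rbrakk> \<Longrightarrow> g' p *\<^sub>v (f' p *\<^sub>v v) = v"
    "\<And>p v. \<lbrakk>p \<in> P; v \<in> carrier_vec (dm Z p)\<rbrakk> \<Longrightarrow> f' p *\<^sub>v (g' p *\<^sub>v v) = v"
    using isoD[OF assms(5)] by metis
  note F = hom_comp[OF assms(1,2,3) fg(1) fg'(1)] and G = hom_comp[OF assms(3,2,1) fg'(2) fg(2)]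
  show ?thesis
  proof (rule isoI[OF F G])
    fix p and v :: "'a vec" assume h: "p \<in> P" "v \<in> carrier_vec (dm X p)"
    note c = hom_vec[OF fg(1) h] and c' = hom_vec[OF fg'(1) h(1) hom_vec[OF fg(1) h]]
    show "(g p * g' p) *\<^sub>v ((f' p * f p) *\<^sub>v v) = v"
      unfolding hom_comp_vec[OF fg(1) fg'(1) h] hom_comp_vec[OF fg'(2) fg(2) h(1) c'] fg'(3)[OF h(1) c] fg(3)[OF h] ..
  next
    fix p and v :: "'a vec" assume h: "p \<in> P" "v \<in> carrier_vec (dm Z p)"
    note c = hom_vec[OF fg'(2) h] and c' = hom_vec[OF fg(2) h(1) hom_vec[OF fg'(2) h]]
    show "(f' p * f p) *\<^sub>v ((g p * g' p) *\<^sub>v v) = v"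
      unfolding hom_comp_vec[OF fg'(2) fg(2) h] hom_comp_vec[OF fg(1) fg'(1) h(1) c'] fg(4)[OF h(1) c] fg'(4)[OF h] ..
  qed
qed

lemma iso_dsum_right:
  assumes X: "rep X" and Y: "rep Y" and Y': "rep Y'" and i: "iso P lq Y Y'"
  shows "iso P lq (dsum X Y) (dsum X Y')"
proof -
  obtain f g where fg: "rhom Y Y' f" "rhom Y' Y g"
    "\<And>p v. \<lbrakk>p \<in> P; v \<in> carrier_vec (dm Y p)\<rbrakk> \<Longrightarrow> g p *\<^sub>v (f p *\<^sub>v v) = v"
    "\<And>p v. \<lbrakk>p \<in> P; v \<in> carrier_vec (dm Y' p)\<rbrakk> \<Longrightarrow> f p *\<^sub>v (g p *\<^sub>v v) = v"
    using isoD[OF i] by metis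
  have ex: "\<exists>h. rhom (dsum X A) (dsum X B) h \<and> (\<forall>p\<in>P. \<forall>x\<in>carrier_vec (dm X p). \<forall>y\<in>carrier_vec (dm A p).
      h p *\<^sub>v (x @\<^sub>v y) = x @\<^sub>v (a p *\<^sub>v y))" if A: "rep A" and B: "rep B" and a: "rhom A B a" for A B a
  proof -
    note D = rep_dsum[OF X B] and dh = dsum_homs[OF X B]
    obtain h where h: "rhom (dsum X A) (dsum X B) h"
      "\<And>p x y. \<lbrakk>p \<in> P; x \<in> carrier_vec (dm X p); y \<in> carrier_vec (dm A p)\<rbrakk> \<Longrightarrow>
       h p *\<^sub>v (x @\<^sub>v y) = dinl X B p *\<^sub>v x + (dinr X B p * a p) *\<^sub>v y"
      using dsum_out[OF X A D dh(1) hom_comp[OF A B D a dh(2)]] by blast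
    have "h p *\<^sub>v (x @\<^sub>v y) = x @\<^sub>v (a p *\<^sub>v y)" if p: "p \<in> P" and x: "x \<in> carrier_vec (dm X p)"
      and y: "y \<in> carrier_vec (dm A p)" for p x y
    proof -
      note c = hom_vec[OF a p y]
      have "h p *\<^sub>v (x @\<^sub>v y) = (x @\<^sub>v 0\<^sub>v (dm B p)) + (0\<^sub>v (dm X p) @\<^sub>v (a p *\<^sub>v y))"
        unfolding h(2)[OF p x y] hom_comp_vec[OF a dh(2) p y] using dsum_vecs[OF x c] by simp
      also have "\<dots> = x @\<^sub>v (a p *\<^sub>v y)"
        using append_vec_add[OF x zero_carrier_vec zero_carrier_vec c] x c by simp
      finally show ?thesis .
    qed
    thus ?thesis using h(1) by blast
  qed
  obtain F where F: "rhom (dsum X Y) (dsum X Y') F" "\<And>p x y. \<lbrakk>p \<in> P; x \<in> carrier_vec (dm X p); y \<in> carrier_vec (dm Y p)\<rbrakk> \<Longrightarrow>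
      F p *\<^sub>v (x @\<^sub>v y) = x @\<^sub>v (f p *\<^sub>v y)" using ex[OF Y Y' fg(1)] by blast
  obtain G where G: "rhom (dsum X Y') (dsum X Y) G" "\<And>p x y. \<lbrakk>p \<in> P; x \<in> carrier_vec (dm X p); y \<in> carrier_vec (dm Y' p)\<rbrakk> \<Longrightarrow>
      G p *\<^sub>v (x @\<^sub>v y) = x @\<^sub>v (g p *\<^sub>v y)" using ex[OF Y' Y fg(2)] by blast
  show ?thesis
  proof (rule isoI[OF F(1) G(1)])
    fix p and v :: "'a vec" assume p: "p \<in> P" and "v \<in> carrier_vec (dm (dsum X Y) p)"
    then have "v \<in> carrier_vec (dm X p + dm Y p)" by simp
    then obtain x y where xy: "x \<in> carrier_vec (dm X p)" "y \<in> carrier_vec (dm Y p)" "v = x @\<^sub>v y"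
      by (rule append_vec_cases)
    show "G p *\<^sub>v (F p *\<^sub>v v) = v"
      unfolding xy(3) F(2)[OF p xy(1,2)] G(2)[OF p xy(1) hom_vec[OF fg(1) p xy(2)]] fg(3)[OF p xy(2)] ..
  next
    fix p and v :: "'a vec" assume p: "p \<in> P" and "v \<in> carrier_vec (dm (dsum X Y') p)"
    then have "v \<in> carrier_vec (dm X p + dm Y' p)" by simp
    then obtain x y where xy: "x \<in> carrier_vec (dm X p)" "y \<in> carrier_vec (dm Y' p)" "v = x @\<^sub>v y"
      by (rule append_vec_cases)
    show "F p *\<^sub>v (G p *\<^sub>v v) = v"
      unfolding xy(3) G(2)[OF p xy(1,2)] F(2)[OF p xy(1) hom_vec[OF fg(2) p xy(2)]] fg(4)[OF p xy(2)] ..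
  qed
qed

lemma iso_zero:
  assumes X: "rep X" and "\<And>p. p \<in> P \<Longrightarrow> dm X p = 0"
  shows "iso P lq X zero_rep"
proof (rule isoI)
  have z: "v = 0\<^sub>v 0" if "v \<in> carrier_vec 0" for v :: "'a vec" using that by (intro eq_vecI) auto
  show "rhom X zero_rep (\<lambda>p. 0\<^sub>m 0 0)"
    by (rule homI[OF X rep_zero]) (auto simp: assms(2) zero_rep_def intro!: eq_vecI)
  have "dim_vec (mp X p q *\<^sub>v w) = 0" if "p \<in> P" "q \<in> P" "lq p q" for p q w
    using rep_mat[OF X that] assms(2)[OF that(2)] by simp
  thus "rhom zero_rep X (\<lambda>p. 0\<^sub>m 0 0)"
    by (intro homI[OF rep_zero X]) (auto simp: assms(2) zero_rep_def intro!: eq_vecI)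
qed (auto simp: assms(2) intro!: eq_vecI)

lemma retract_trans:
  assumes "rep X" "rep Y" "rep Z" "retract X Y" "retract Y Z"
  shows "retract X Z"
proof -
  obtain f g where fg: "rhom X Y f" "rhom Y X g"
    "\<And>p v. \<lbrakk>p \<in> P; v \<in> carrier_vec (dm X p)\<rbrakk> \<Longrightarrow> g p *\<^sub>v (f p *\<^sub>v v) = v"
    using assms(4) unfolding retract_def by metis
  obtain f' g' where fg': "rhom Y Z f'" "rhom Z Y g'"
    "\<And>p v. \<lbrakk>p \<in> P; v \<in> carrier_vec (dm Y p)\<rbrakk> \<Longrightarrow> g' p *\<^sub>v (f' p *\<^sub>v v) = v"
    using assms(5) unfolding retract_def by metis
  note F = hom_comp[OF assms(1,2,3) fg(1) fg'(1)] and G = hom_comp[OF assms(3,2,1) fg'(2) fg(2)]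
  have "(g p * g' p) *\<^sub>v ((f' p * f p) *\<^sub>v v) = v" if h: "p \<in> P" "v \<in> carrier_vec (dm X p)" for p v
  proof -
    note c = hom_vec[OF fg(1) h] and c' = hom_vec[OF fg'(1) h(1) hom_vec[OF fg(1) h]]
    show ?thesis
      unfolding hom_comp_vec[OF fg(1) fg'(1) h] hom_comp_vec[OF fg'(2) fg(2) h(1) c'] fg'(3)[OF h(1) c] fg(3)[OF h] ..
  qed
  thus ?thesis using F G unfolding retract_def by blast
qed

lemma iso_retract: "iso P lq X Y \<Longrightarrow> retract X Y"
  using isoD unfolding retract_def by metis

lemma retract_dsum: assumes X: "rep X" and Y: "rep Y" shows "retract X (dsum X Y)"
proof -
  have "dprl X Y p *\<^sub>v (dinl X Y p *\<^sub>v v) = v" if "v \<in> carrier_vec (dm X p)" for p v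
    using dsum_vecs[OF that zero_carrier_vec, of Y] by simp
  thus ?thesis unfolding retract_def using dsum_homs[OF X Y] by blast
qed

text \<open>K is a kernel of f with inclusion i; r is a pointwise left inverse of i and is not a morphism.\<close>

definition ker_data :: "('p, 'k::field) prep \<Rightarrow> ('p, 'k) prep \<Rightarrow> ('p \<Rightarrow> 'k mat) \<Rightarrow> ('p, 'k) prep
    \<Rightarrow> ('p \<Rightarrow> 'k mat) \<Rightarrow> ('p \<Rightarrow> 'k mat) \<Rightarrow> bool" where
  "ker_data C D f K i r \<longleftrightarrow> rep K \<and> rhom K C i \<and> (\<forall>p\<in>P. r p \<in> carrier_mat (dm K p) (dm C p) \<and>
     (\<forall>x\<in>carrier_vec (dm K p). r p *\<^sub>v (i p *\<^sub>v x) = x) \<and>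
     (\<forall>v\<in>carrier_vec (dm C p). f p *\<^sub>v v = 0\<^sub>v (dm D p) \<longleftrightarrow> i p *\<^sub>v (r p *\<^sub>v v) = v) \<and>
     dm K p \<le> dm C p \<and> (dm K p = dm C p \<longrightarrow> (\<forall>v\<in>carrier_vec (dm C p). f p *\<^sub>v v = 0\<^sub>v (dm D p))))"

text \<open>A basis of the kernel is chosen independently at each point, so the structure maps of
  \<open>C\<close> have to be rewritten in these bases.\<close>

lemma ker_exists:
  fixes C :: "('p, 'k::field) prep"
  assumes C: "rep C" and D: "rep D" and f: "rhom C D f"
  shows "\<exists>K i r. ker_data C D f K i r"
proof -
  let ?V = "\<lambda>p. {v \<in> carrier_vec (dm C p). f p *\<^sub>v v = 0\<^sub>v (dm D p)}"
  define Q where "Q p d B L \<longleftrightarrow> B \<in> carrier_mat (dm C p) d \<and> L \<in> carrier_mat d (dm C p) \<and> L * B = 1\<^sub>m d \<and>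
    (\<forall>v\<in>carrier_vec (dm C p). v \<in> ?V p \<longleftrightarrow> B *\<^sub>v (L *\<^sub>v v) = v) \<and> d \<le> dm C p \<and>
    (d = dm C p \<longrightarrow> ?V p = carrier_vec (dm C p))" for p d and B L :: "'k mat"
  have "\<exists>d B L. Q p d B L" if p: "p \<in> P" for p
  proof -
    note fm = hom_mat[OF f p]
    show ?thesis unfolding Q_def
    proof (rule subspace_basis)
      fix u v assume "u \<in> ?V p" "v \<in> ?V p"
      thus "u + v \<in> ?V p" using mult_add_distrib_mat_vec[OF fm, of u v] by simp
    next
      fix c v assume "v \<in> ?V p"
      thus "c \<cdot>\<^sub>v v \<in> ?V p" using mult_mat_vec[OF fm, of v c] by auto
    qed (use fm in auto)
  qed
  then obtain d B L where "\<And>p. p \<in> P \<Longrightarrow> Q p (d p) (B p) (L p)" by metis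
  hence dBL: "\<And>p. p \<in> P \<Longrightarrow> B p \<in> carrier_mat (dm C p) (d p)"
    "\<And>p. p \<in> P \<Longrightarrow> L p \<in> carrier_mat (d p) (dm C p)" "\<And>p. p \<in> P \<Longrightarrow> L p * B p = 1\<^sub>m (d p)"
    "\<And>p v. \<lbrakk>p \<in> P; v \<in> carrier_vec (dm C p)\<rbrakk> \<Longrightarrow> v \<in> ?V p \<longleftrightarrow> B p *\<^sub>v (L p *\<^sub>v v) = v"
    "\<And>p. p \<in> P \<Longrightarrow> d p \<le> dm C p" "\<And>p. p \<in> P \<Longrightarrow> d p = dm C p \<Longrightarrow> ?V p = carrier_vec (dm C p)"
    unfolding Q_def by blast+
  have LB: "L p *\<^sub>v (B p *\<^sub>v x) = x" if "p \<in> P" "x \<in> carrier_vec (d p)" for p x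
    using assoc_mult_mat_vec[OF dBL(2)[OF that(1)] dBL(1)[OF that(1)] that(2)] dBL(3)[OF that(1)] that(2) by simp
  have Bc: "B p *\<^sub>v x \<in> carrier_vec (dm C p)" if "p \<in> P" "x \<in> carrier_vec (d p)" for p x
    by (rule mult_mat_vec_carrier[OF dBL(1)[OF that(1)] that(2)])
  have fB: "f p *\<^sub>v (B p *\<^sub>v x) = 0\<^sub>v (dm D p)" if "p \<in> P" "x \<in> carrier_vec (d p)" for p x
    using dBL(4)[OF that(1) Bc[OF that]] LB[OF that] by simp
  have BL: "B p *\<^sub>v (L p *\<^sub>v v) = v" if "p \<in> P" "v \<in> carrier_vec (dm C p)" "f p *\<^sub>v v = 0\<^sub>v (dm D p)" for p v
    using dBL(4)[OF that(1,2)] that by simp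
  \<comment> \<open>Include into \<open>C\<close>, transport there, read off coordinates. Naturality
    of \<open>f\<close> keeps the transported vector in the kernel, where \<open>B q\<close> undoes
    \<open>L q\<close>.\<close>
  define K where "K = \<lparr>dm = d, mp = (\<lambda>p q. L q * (mp C p q * B p))\<rparr>"
  have dK: "dm K = d" by (simp add: K_def)
  have CB: "mp C p q * B p \<in> carrier_mat (dm C q) (d p)" if "p \<in> P" "q \<in> P" "lq p q" for p q
    by (rule mult_carrier_mat[OF rep_mat[OF C that] dBL(1)[OF that(1)]])
  have mK: "mp K p q *\<^sub>v x = L q *\<^sub>v (mp C p q *\<^sub>v (B p *\<^sub>v x))" if h: "p \<in> P" "q \<in> P" "lq p q" "x \<in> carrier_vec (d p)" for p q x
    unfolding K_def using assoc_mult_mat_vec[OF dBL(2)[OF h(2)] CB[OF h(1-3)] h(4)]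
      assoc_mult_mat_vec[OF rep_mat[OF C h(1-3)] dBL(1)[OF h(1)] h(4)] by simp
  have nat: "B q *\<^sub>v (mp K p q *\<^sub>v x) = mp C p q *\<^sub>v (B p *\<^sub>v x)" if h: "p \<in> P" "q \<in> P" "lq p q" "x \<in> carrier_vec (d p)" for p q x
    unfolding mK[OF h]
  proof (rule BL[OF h(2) rep_vec[OF C h(1-3) Bc[OF h(1,4)]]])
    show "f q *\<^sub>v (mp C p q *\<^sub>v (B p *\<^sub>v x)) = 0\<^sub>v (dm D q)"
      unfolding hom_nat[OF C D f h(1-3) Bc[OF h(1,4)]] fB[OF h(1,4)] by (rule rep_zero_vec[OF D h(1-3)])
  qed
  have K: "rep K"
  proof (rule repI)
    fix p q assume h: "p \<in> P" "q \<in> P" "lq p q"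
    show "mp K p q \<in> carrier_mat (dm K q) (dm K p)"
      unfolding K_def using mult_carrier_mat[OF dBL(2)[OF h(2)] CB[OF h]] by simp
  next
    fix p and v :: "'k vec" assume h: "p \<in> P" "v \<in> carrier_vec (dm K p)"
    hence v: "v \<in> carrier_vec (d p)" by (simp add: dK)
    show "mp K p p *\<^sub>v v = v"
      unfolding mK[OF h(1) h(1) refl[OF h(1)] v] rep_id[OF C h(1) Bc[OF h(1) v]] by (rule LB[OF h(1) v])
  next
    fix p q r and v :: "'k vec" assume h: "p \<in> P" "q \<in> P" "r \<in> P" "lq p q" "lq q r" "v \<in> carrier_vec (dm K p)"
    hence v: "v \<in> carrier_vec (d p)" by (simp add: dK)
    have pr: "lq p r" using h trans by blast
    have w: "mp K p q *\<^sub>v v \<in> carrier_vec (d q)"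
      unfolding mK[OF h(1,2,4) v] by (rule mult_mat_vec_carrier[OF dBL(2)[OF h(2)] rep_vec[OF C h(1,2,4) Bc[OF h(1) v]]])
    show "mp K q r *\<^sub>v (mp K p q *\<^sub>v v) = mp K p r *\<^sub>v v"
      unfolding mK[OF h(2,3,5) w] nat[OF h(1,2,4) v] mK[OF h(1,3) pr v] rep_comp[OF C h(1-5) Bc[OF h(1) v]] ..
  qed
  have i: "rhom K C B"
    by (rule homI[OF K C]) (use dBL(1) nat in \<open>auto simp: dK\<close>)
  have all: "\<forall>v\<in>carrier_vec (dm C p). f p *\<^sub>v v = 0\<^sub>v (dm D p)" if "p \<in> P" "d p = dm C p" for p
    using dBL(6)[OF that] by blast
  have "ker_data C D f K B L"
    unfolding ker_data_def dK using K i dBL(2,4,5) LB all by (intro conjI ballI impI) (auto simp: dK)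
  thus ?thesis by blast
qed

lemma ker_dataD:
  assumes "ker_data C D f K i r"
  shows "rep K" "rhom K C i" "p \<in> P \<Longrightarrow> v \<in> carrier_vec (dm C p) \<Longrightarrow> r p *\<^sub>v v \<in> carrier_vec (dm K p)"
    "p \<in> P \<Longrightarrow> x \<in> carrier_vec (dm K p) \<Longrightarrow> r p *\<^sub>v (i p *\<^sub>v x) = x"
    "p \<in> P \<Longrightarrow> v \<in> carrier_vec (dm C p) \<Longrightarrow> f p *\<^sub>v v = 0\<^sub>v (dm D p) \<Longrightarrow> i p *\<^sub>v (r p *\<^sub>v v) = v"
    "p \<in> P \<Longrightarrow> x \<in> carrier_vec (dm K p) \<Longrightarrow> f p *\<^sub>v (i p *\<^sub>v x) = 0\<^sub>v (dm D p)"
    "p \<in> P \<Longrightarrow> dm K p \<le> dm C p"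
    "p \<in> P \<Longrightarrow> dm K p = dm C p \<Longrightarrow> v \<in> carrier_vec (dm C p) \<Longrightarrow> f p *\<^sub>v v = 0\<^sub>v (dm D p)"
    "p \<in> P \<Longrightarrow> r p \<in> carrier_mat (dm K p) (dm C p)"
proof -
  show "p \<in> P \<Longrightarrow> x \<in> carrier_vec (dm K p) \<Longrightarrow> f p *\<^sub>v (i p *\<^sub>v x) = 0\<^sub>v (dm D p)"
    using assms hom_vec unfolding ker_data_def by metis
  show "p \<in> P \<Longrightarrow> v \<in> carrier_vec (dm C p) \<Longrightarrow> r p *\<^sub>v v \<in> carrier_vec (dm K p)"
    using assms mult_mat_vec_carrier unfolding ker_data_def by blast
qed (use assms in \<open>auto simp: ker_data_def\<close>)

text \<open>Although \<open>r\<close> need not be natural, \<open>i\<close> is natural and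
  injective. Hence naturality of the factor can be checked after applying \<open>i\<close>, where it
  is that of \<open>h\<close>.\<close>

lemma ker_lift_hom:
  assumes k: "ker_data C D f K i r" and C: "rep C" and Z: "rep Z" and h: "rhom Z C h"
    and z0: "\<forall>p\<in>P. \<forall>v\<in>carrier_vec (dm Z p). f p *\<^sub>v (h p *\<^sub>v v) = 0\<^sub>v (dm D p)"
  shows "rhom Z K (\<lambda>p. r p * h p)"
    and "p \<in> P \<Longrightarrow> v \<in> carrier_vec (dm Z p) \<Longrightarrow> i p *\<^sub>v ((r p * h p) *\<^sub>v v) = h p *\<^sub>v v"
proof -
  note kd = ker_dataD[OF k]
  have z: "f p *\<^sub>v (h p *\<^sub>v v) = 0\<^sub>v (dm D p)" if "p \<in> P" "v \<in> carrier_vec (dm Z p)" for p v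
    using z0 that by blast
  have e: "(r p * h p) *\<^sub>v v = r p *\<^sub>v (h p *\<^sub>v v)" if "p \<in> P" "v \<in> carrier_vec (dm Z p)" for p v
    by (rule assoc_mult_mat_vec[OF kd(9)[OF that(1)] hom_mat[OF h that(1)] that(2)])
  have ie: "i p *\<^sub>v ((r p * h p) *\<^sub>v v) = h p *\<^sub>v v" if "p \<in> P" "v \<in> carrier_vec (dm Z p)" for p v
    unfolding e[OF that] by (rule kd(5)[OF that(1) hom_vec[OF h that] z[OF that]])
  show "p \<in> P \<Longrightarrow> v \<in> carrier_vec (dm Z p) \<Longrightarrow> i p *\<^sub>v ((r p * h p) *\<^sub>v v) = h p *\<^sub>v v" by (rule ie)
  show "rhom Z K (\<lambda>p. r p * h p)"
  proof (rule homI[OF Z kd(1)])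
    fix p assume "p \<in> P" thus "r p * h p \<in> carrier_mat (dm K p) (dm Z p)"
      using mult_carrier_mat[OF kd(9) hom_mat[OF h]] by blast
  next
    fix p q and v :: "'a vec" assume a: "p \<in> P" "q \<in> P" "lq p q" "v \<in> carrier_vec (dm Z p)"
    let ?x = "(r q * h q) *\<^sub>v (mp Z p q *\<^sub>v v)" and ?y = "mp K p q *\<^sub>v ((r p * h p) *\<^sub>v v)"
    note mv = rep_vec[OF Z a]
    have c: "(r p * h p) *\<^sub>v v \<in> carrier_vec (dm K p)" unfolding e[OF a(1,4)] by (rule kd(3)[OF a(1) hom_vec[OF h a(1,4)]])
    have cx: "?x \<in> carrier_vec (dm K q)" unfolding e[OF a(2) mv] by (rule kd(3)[OF a(2) hom_vec[OF h a(2) mv]])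
    have cy: "?y \<in> carrier_vec (dm K q)" by (rule rep_vec[OF kd(1) a(1-3) c])
    have "i q *\<^sub>v ?x = i q *\<^sub>v ?y"
      unfolding ie[OF a(2) mv] hom_nat[OF kd(1) C kd(2) a(1-3) c] ie[OF a(1,4)] hom_nat[OF Z C h a] ..
    hence "r q *\<^sub>v (i q *\<^sub>v ?x) = r q *\<^sub>v (i q *\<^sub>v ?y)" by simp
    thus "?x = ?y" unfolding kd(4)[OF a(2) cx] kd(4)[OF a(2) cy] .
  qed
qed

section \<open>Liftings, exact sequences and resolutions\<close>

lemma fin_pres_rep: "fin_pres P lq M \<Longrightarrow> rep M"
  by (simp add: fin_pres_def)

lemma rep_indicator: "convex P lq S \<Longrightarrow> rep (indicator_rep S)"
  unfolding pow_ind_1 by (rule rep_pow_ind)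

lemma fp_spread_rep: "fp_spread P lq TYPE('k::field) S \<Longrightarrow> rep (indicator_rep S :: ('p, 'k) prep)"
  by (auto simp: fp_spread_def spread_def intro: rep_indicator)

lemma rep_indicator_list:
  "\<forall>S\<in>set Ss. fp_spread P lq TYPE('k::field) S \<Longrightarrow> \<forall>X\<in>set (map indicator_rep Ss). rep (X :: ('p, 'k) prep)"
  using fp_spread_rep by auto

lemma add_spread_retract:
  fixes X :: "('p, 'k::field) prep"
  assumes "add_spread P lq X"
  shows "\<exists>Ss. (\<forall>S\<in>set Ss. fp_spread P lq TYPE('k) S) \<and> retract X (dsum_list (map indicator_rep Ss))"
proof -
  obtain Y Ss where Y: "rep Y" and Ss: "\<forall>S\<in>set Ss. fp_spread P lq TYPE('k) S"
    and i: "iso P lq (dsum X Y) (dsum_list (map indicator_rep Ss))"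
    using assms unfolding add_spread_def by blast
  have X: "rep X" using assms by (simp add: add_spread_def fin_pres_def)
  have "retract X (dsum_list (map indicator_rep Ss))"
    by (rule retract_trans[OF X rep_dsum[OF X Y] rep_dsum_list[OF rep_indicator_list[OF Ss]]
        retract_dsum[OF X Y] iso_retract[OF i]])
  thus ?thesis using Ss by blast
qed

lemma add_spreadI:
  fixes Ss :: "'p set list"
  defines "D \<equiv> dsum_list (map indicator_rep Ss) :: ('p, 'k::field) prep"
  assumes "fin_pres P lq D" "\<forall>S\<in>set Ss. fp_spread P lq TYPE('k) S"
  shows "add_spread P lq D"
proof -
  have "well_dim D" unfolding D_def using well_dim_indicator by (intro well_dim_dsum_list) auto
  hence "iso P lq (dsum D zero_rep) D" using dsum_zero_right iso_refl[OF fin_pres_rep[OF assms(2)]] by metis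
  thus ?thesis unfolding add_spread_def using assms rep_zero unfolding D_def by blast
qed

text \<open>Reduces approximation properties to single indicators, since an object of
  \<open>add_spread\<close> is a retract of a finite sum of them.\<close>

lemma lifts_add_spread:
  fixes C :: "('p, 'k::field) prep"
  assumes Z: "add_spread P lq Z" and "rep C" "rep B" "rhom C B f"
    and l: "\<And>S. fp_spread P lq TYPE('k) S \<Longrightarrow> lifts (indicator_rep S) C f B"
  shows "lifts Z C f B"
proof -
  obtain Ss where Ss: "\<forall>S\<in>set Ss. fp_spread P lq TYPE('k) S" and r: "retract Z (dsum_list (map indicator_rep Ss))"
    using add_spread_retract[OF Z] by blast
  have "rep Z" using Z by (simp add: add_spread_def fin_pres_def)
  moreover note reps = rep_indicator_list[OF Ss]
  moreover have "lifts (dsum_list (map indicator_rep Ss)) C f B"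
    using l Ss by (intro lifts_dsum_list[OF reps assms(3,2,4)]) auto
  ultimately show ?thesis using lifts_retract[OF _ rep_dsum_list[OF reps] assms(3,2) r] by blast
qed

lemma hom_to_zero: "rep B \<Longrightarrow> rhom B zero_rep (\<lambda>p. 0\<^sub>m 0 (dm B p))"
  by (rule homI[OF _ rep_zero]) (auto simp: zero_rep_def intro!: eq_vecI)

lemma hom_from_zero: "rep B \<Longrightarrow> rhom zero_rep B (\<lambda>p. 0\<^sub>m (dm B p) 0)"
  by (rule homI[OF rep_zero]) (auto simp: zero_rep_def rep_zero_vec intro!: eq_vecI)

lemma liftsD:
  assumes "lifts Z C f B" "rhom C B f" "rhom Z B h"
  shows "\<exists>k. rhom Z C k \<and> (\<forall>p\<in>P. h p = f p * k p)"
proof -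
  obtain k where k: "rhom Z C k" "\<And>p v. \<lbrakk>p \<in> P; v \<in> carrier_vec (dm Z p)\<rbrakk> \<Longrightarrow> h p *\<^sub>v v = f p *\<^sub>v (k p *\<^sub>v v)"
    using assms(1,3) unfolding lifts_def by blast
  thus ?thesis using hom_eq_comp_iff[OF assms(3) k(1) assms(2)] by blast
qed

text \<open>With the zero map to \<open>zero_rep\<close> as differential, the vanishing condition in
  \<open>ker_approx\<close> is void.\<close>

lemma ker_approx_lifts:
  assumes "ker_approx P lq C f B (\<lambda>p. 0\<^sub>m 0 (dm B p)) zero_rep" "rep B" "rhom C B f" "add_spread P lq Z"
  shows "lifts Z C f B"
  unfolding lifts_def
proof (intro allI impI)
  fix h assume h: "rhom Z B h"
  have "0\<^sub>m 0 (dm B p) * h p = 0\<^sub>m (dm (zero_rep :: ('p, 'a) prep) p) (dm Z p)" if "p \<in> P" for p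
    using hom_mat[OF h that] by simp
  then obtain k where "rhom Z C k" "\<forall>p\<in>P. h p = f p * k p"
    using assms(1,4) h unfolding ker_approx_def by blast
  thus "\<exists>k. rhom Z C k \<and> (\<forall>p\<in>P. \<forall>v\<in>carrier_vec (dm Z p). h p *\<^sub>v v = f p *\<^sub>v (k p *\<^sub>v v))"
    using hom_eq_comp_iff[OF h _ assms(3)] by metis
qed

lemma lifts_ker_approx:
  assumes "\<And>Z. add_spread P lq Z \<Longrightarrow> lifts Z C f B" "rhom C B f"
  shows "ker_approx P lq C f B d D"
  unfolding ker_approx_def using liftsD[OF assms(1) assms(2)] by blast

text \<open>Turns an approximation of the kernel object \<open>K\<close> into a statement about
  morphisms to \<open>B\<close> killed by \<open>d\<close>, the form in which resolutions are
  written.\<close>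

lemma ker_approx_comp:
  assumes k: "ker_data B D d K i r" and B: "rep B" and C: "rep C" and D: "rhom B D d" and f: "rhom C K f"
    and l: "\<And>Z. add_spread P lq Z \<Longrightarrow> lifts Z C f K"
  shows "ker_approx P lq C (\<lambda>p. i p * f p) B d D"
  unfolding ker_approx_def
proof (intro allI impI)
  fix Z h assume a: "add_spread P lq Z \<and> rhom Z B h \<and> (\<forall>p\<in>P. d p * h p = 0\<^sub>m (dm D p) (dm Z p))"
  hence Z: "add_spread P lq Z" and h: "rhom Z B h" by auto
  have rZ: "rep Z" using Z by (simp add: add_spread_def fin_pres_def)
  have z: "\<forall>p\<in>P. \<forall>v\<in>carrier_vec (dm Z p). d p *\<^sub>v (h p *\<^sub>v v) = 0\<^sub>v (dm D p)"
    using a hom_zero_comp_iff[OF h D] by blast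
  note kd = ker_dataD[OF k]
  note lh = ker_lift_hom[OF k B rZ h z]
  obtain g where g: "rhom Z C g" "\<And>p v. \<lbrakk>p \<in> P; v \<in> carrier_vec (dm Z p)\<rbrakk> \<Longrightarrow> (r p * h p) *\<^sub>v v = f p *\<^sub>v (g p *\<^sub>v v)"
    using l[OF Z] lh(1) unfolding lifts_def by blast
  note c = hom_comp[OF C kd(1) B f kd(2)]
  have "h p = (i p * f p) * g p" if p: "p \<in> P" for p
  proof (subst hom_eq_comp_iff[OF h g(1) c p], intro ballI)
    fix v :: "'a vec" assume v: "v \<in> carrier_vec (dm Z p)"
    show "h p *\<^sub>v v = (i p * f p) *\<^sub>v (g p *\<^sub>v v)"
      unfolding hom_comp_vec[OF f kd(2) p hom_vec[OF g(1) p v]] g(2)[OF p v, symmetric] lh(2)[OF p v] ..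
  qed
  thus "\<exists>k. rhom Z C k \<and> (\<forall>p\<in>P. h p = i p * f p * k p)" using g(1) by blast
qed

text \<open>Following \<open>d\<close> by a monomorphism does not change what it kills. This is
  needed at the joint of two spliced complexes, where the augmentation to a kernel becomes a map to
  the next term.\<close>

lemma ker_approx_mono_comp:
  assumes a: "ker_approx P lq C f B d K" and k: "ker_data B' D' d' K i r" and d: "rhom B K d"
  shows "ker_approx P lq C f B (\<lambda>p. i p * d p) B'"
proof -
  note kd = ker_dataD[OF k]
  have "d p * h p = 0\<^sub>m (dm K p) (dm Z p)" if h: "rhom Z B h" and p: "p \<in> P"
    and z: "(i p * d p) * h p = 0\<^sub>m (dm B' p) (dm Z p)" for Z h p
  proof (subst hom_zero_comp_iff[OF h d p], intro ballI)
    fix v :: "'a vec" assume v: "v \<in> carrier_vec (dm Z p)"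
    note hv = hom_vec[OF h p v]
    note dhv = hom_vec[OF d p hv]
    have "((i p * d p) * h p) *\<^sub>v v = i p *\<^sub>v (d p *\<^sub>v (h p *\<^sub>v v))"
      using assoc_mult_mat_vec[OF mult_carrier_mat[OF hom_mat[OF kd(2) p] hom_mat[OF d p]] hom_mat[OF h p] v]
        hom_comp_vec[OF d kd(2) p hv] by simp
    hence "i p *\<^sub>v (d p *\<^sub>v (h p *\<^sub>v v)) = 0\<^sub>v (dm B' p)" unfolding z using v by simp
    hence "r p *\<^sub>v (i p *\<^sub>v (d p *\<^sub>v (h p *\<^sub>v v))) = 0\<^sub>v (dm K p)" using kd(9)[OF p] by simp
    thus "d p *\<^sub>v (h p *\<^sub>v v) = 0\<^sub>v (dm K p)" unfolding kd(4)[OF p dhv] .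
  qed
  thus ?thesis using a unfolding ker_approx_def by blast
qed

section \<open>Building resolutions by splicing\<close>

lemma has_finite_spread_res_zero:
  assumes M: "rep M" and z: "\<And>p. p \<in> P \<Longrightarrow> dm M p = 0" and a: "add_spread P lq (zero_rep :: ('p, 'k::field) prep)"
  shows "has_finite_spread_res P lq (M :: ('p, 'k) prep)"
proof -
  have l: "lifts Z zero_rep (\<lambda>p. 0\<^sub>m (dm B p) 0) B" if Z: "rep Z" and "\<And>p. p \<in> P \<Longrightarrow> dm B p = 0" for Z B :: "('p, 'k) prep"
    unfolding lifts_def
  proof (intro allI impI exI[of _ "\<lambda>p. 0\<^sub>m 0 (dm Z p)"] conjI ballI)
    fix h p and v :: "'k vec" assume h: "rhom Z B h" and p: "p \<in> P" and v: "v \<in> carrier_vec (dm Z p)"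
    show "h p *\<^sub>v v = 0\<^sub>m (dm B p) 0 *\<^sub>v (0\<^sub>m 0 (dm Z p) *\<^sub>v v)"
      using hom_mat[OF h p] that(2)[OF p] by (intro eq_vecI) auto
  qed (rule hom_to_zero[OF Z])
  have rz: "rep Z" if "add_spread P lq Z" for Z :: "('p, 'k) prep" using that by (simp add: add_spread_def fin_pres_def)
  have 1: "ker_approx P lq zero_rep (\<lambda>p. 0\<^sub>m (dm M p) 0) M d D" for d D
    by (rule lifts_ker_approx[OF l[OF rz z] hom_from_zero[OF M]])
  have 2: "ker_approx P lq zero_rep (\<lambda>p. 0\<^sub>m 0 0) zero_rep d D" for d and D :: "('p, 'k) prep"
    using lifts_ker_approx[OF l[OF rz] hom_from_zero[OF rep_zero], of d D] by simp
  show ?thesis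
    unfolding has_finite_spread_res_def Let_def
    by (rule exI[of _ 0], rule exI[of _ "\<lambda>i. zero_rep"], rule exI[of _ "\<lambda>i p. 0\<^sub>m (dm M p) 0"])
      (use a 1 2 hom_from_zero[OF M] in simp)
qed

definition spread_res_by :: "('p, 'k::field) prep \<Rightarrow> nat \<Rightarrow> (nat \<Rightarrow> ('p, 'k) prep) \<Rightarrow> (nat \<Rightarrow> 'p \<Rightarrow> 'k mat) \<Rightarrow> bool" where
  "spread_res_by M m Cs fs \<longleftrightarrow>
     (\<forall>i\<le>m. add_spread P lq (Cs i)) \<and>
     (\<forall>i\<le>m. rhom (Cs i) (if i = 0 then M else Cs (i - 1)) (fs i)) \<and>
     (\<forall>i<m. \<forall>p\<in>P. fs i p * fs (Suc i) p = 0\<^sub>m (dm (if i = 0 then M else Cs (i - 1)) p) (dm (Cs (Suc i)) p)) \<and>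
     ker_approx P lq (Cs 0) (fs 0) M (\<lambda>p. 0\<^sub>m 0 (dm M p)) zero_rep \<and>
     (\<forall>i<m. ker_approx P lq (Cs (Suc i)) (fs (Suc i)) (Cs i) (fs i) (if i = 0 then M else Cs (i - 1))) \<and>
     ker_approx P lq zero_rep (\<lambda>p. 0\<^sub>m (dm (Cs m) p) 0) (Cs m) (fs m) (if m = 0 then M else Cs (m - 1))"

lemma has_finite_spread_res_iff: "has_finite_spread_res P lq M \<longleftrightarrow> (\<exists>m Cs fs. spread_res_by M m Cs fs)"
  unfolding has_finite_spread_res_def spread_res_by_def Let_def ..

text \<open>The resolution of the kernel is shifted by one place and its augmentation is followed by
  the inclusion \<open>i\<close>; the other differentials are kept.\<close>

lemma has_finite_spread_res_step:
  assumes M: "rep M" and C: "add_spread P lq C" and g: "rhom C M g"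
    and l: "\<And>Z. add_spread P lq Z \<Longrightarrow> lifts Z C g M"
    and k: "ker_data C M g K i r" and res: "has_finite_spread_res P lq K"
  shows "has_finite_spread_res P lq M"
proof -
  obtain m Cs fs where R: "spread_res_by K m Cs fs" using res unfolding has_finite_spread_res_iff by blast
  note R' = R[unfolded spread_res_by_def]
  note r1 = conjunct1[OF R', rule_format]
    and r2 = conjunct1[OF conjunct2[OF R'], rule_format]
    and r3 = conjunct1[OF conjunct2[OF conjunct2[OF R']], rule_format]
    and r4 = conjunct1[OF conjunct2[OF conjunct2[OF conjunct2[OF R']]]]
    and r5 = conjunct1[OF conjunct2[OF conjunct2[OF conjunct2[OF conjunct2[OF R']]]], rule_format]
    and r6 = conjunct2[OF conjunct2[OF conjunct2[OF conjunct2[OF conjunct2[OF R']]]]]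
  note kd = ker_dataD[OF k]
  have rC: "rep C" using C by (simp add: add_spread_def fin_pres_def)
  have rCs: "rep (Cs j)" if "j \<le> m" for j using r1[OF that] by (simp add: add_spread_def fin_pres_def)
  have f0: "rhom (Cs 0) K (fs 0)" using r2[of 0] by simp
  let ?f = "\<lambda>p. i p * fs 0 p"
  have f: "rhom (Cs 0) C ?f" by (rule hom_comp[OF rCs kd(1) rC f0 kd(2)]) simp
  define Cs' where "Cs' = case_nat C Cs"
  \<comment> \<open>Positions 0 and 1 carry new maps and later positions are shifted copies, hence
    the three-way case distinctions below.\<close>
  define fs' where "fs' = (\<lambda>j. case j of 0 \<Rightarrow> g | Suc j' \<Rightarrow> (case j' of 0 \<Rightarrow> ?f | Suc j'' \<Rightarrow> fs j'))"
  have s: "Cs' 0 = C" "\<And>j. Cs' (Suc j) = Cs j" "fs' 0 = g" "fs' (Suc 0) = ?f" "\<And>j. fs' (Suc (Suc j)) = fs (Suc j)"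
    by (simp_all add: Cs'_def fs'_def)
  have gf: "g p * ?f p = 0\<^sub>m (dm M p) (dm (Cs 0) p)" if p: "p \<in> P" for p
  proof (subst hom_zero_comp_iff[OF f g p], intro ballI)
    fix v :: "'a vec" assume v: "v \<in> carrier_vec (dm (Cs 0) p)"
    show "g p *\<^sub>v ((i p * fs 0 p) *\<^sub>v v) = 0\<^sub>v (dm M p)"
      unfolding hom_comp_vec[OF f0 kd(2) p v] by (rule kd(6)[OF p hom_vec[OF f0 p v]])
  qed
  have f1: "?f p * fs (Suc 0) p = 0\<^sub>m (dm C p) (dm (Cs (Suc 0)) p)" if m: "0 < m" and p: "p \<in> P" for p
  proof -
    have "rhom (Cs (Suc 0)) (Cs 0) (fs (Suc 0))" using r2[of "Suc 0"] m by simp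
    hence "?f p * fs (Suc 0) p = i p * (fs 0 p * fs (Suc 0) p)"
      using assoc_mult_mat[OF hom_mat[OF kd(2) p] hom_mat[OF f0 p] hom_mat[OF _ p]] by blast
    thus ?thesis using r3[OF m p] right_mult_zero_mat[OF hom_mat[OF kd(2) p]] by simp
  qed
  show ?thesis
    unfolding has_finite_spread_res_iff spread_res_by_def
  proof (rule exI[of _ "Suc m"], rule exI[of _ Cs'], rule exI[of _ fs'], intro conjI allI impI ballI)
    fix j assume "j \<le> Suc m"
    thus "add_spread P lq (Cs' j)" using C r1 by (cases j) (auto simp: s)
  next
    fix j assume "j \<le> Suc m"
    moreover have "j = 0 \<or> j = Suc 0 \<or> (\<exists>j'. j = Suc (Suc j'))" by presburger
    ultimately show "rhom (Cs' j) (if j = 0 then M else Cs' (j - 1)) (fs' j)"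
      using g f r2[of "j - 1"] by (auto simp: s)
  next
    fix j p assume "j < Suc m" "p \<in> P"
    moreover have "j = 0 \<or> j = Suc 0 \<or> (\<exists>j'. j = Suc (Suc j'))" by presburger
    ultimately show "fs' j p * fs' (Suc j) p = 0\<^sub>m (dm (if j = 0 then M else Cs' (j - 1)) p) (dm (Cs' (Suc j)) p)"
      using gf f1 r3[of "j - 1" p] by (auto simp: s)
  next
    show "ker_approx P lq (Cs' 0) (fs' 0) M (\<lambda>p. 0\<^sub>m 0 (dm M p)) zero_rep"
      unfolding s by (rule lifts_ker_approx[OF l g])
  next
    fix j assume "j < Suc m"
    moreover have "j = 0 \<or> j = Suc 0 \<or> (\<exists>j'. j = Suc (Suc j'))" by presburger
    moreover have "ker_approx P lq (Cs 0) ?f C g M"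
      by (rule ker_approx_comp[OF k rC rCs g f0 ker_approx_lifts[OF r4 kd(1) f0]]) simp_all
    moreover have "ker_approx P lq (Cs (Suc 0)) (fs (Suc 0)) (Cs 0) ?f C" if "0 < m"
      using ker_approx_mono_comp[OF _ k f0] r5[OF that] by simp
    ultimately show "ker_approx P lq (Cs' (Suc j)) (fs' (Suc j)) (Cs' j) (fs' j) (if j = 0 then M else Cs' (j - 1))"
      using r5[of "j - 1"] by (auto simp: s)
  next
    show "ker_approx P lq zero_rep (\<lambda>p. 0\<^sub>m (dm (Cs' (Suc m)) p) 0) (Cs' (Suc m)) (fs' (Suc m))
      (if Suc m = 0 then M else Cs' (Suc m - 1))"
    proof (cases m)
      case 0
      thus ?thesis using ker_approx_mono_comp[OF _ k f0] r6 by (simp add: s)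
    next
      case (Suc m')
      thus ?thesis using r6 by (simp add: s)
    qed
  qed
qed

text \<open>Hom is left exact, so the first two clauses hold for any representation
  \<open>X\<close>; only surjectivity at the right end comes from the lifting hypothesis.\<close>

lemma hom_exact_of_lifts:
  fixes X :: "('p, 'k::field) prep"
  assumes se: "short_exact P lq L M N f g" and X: "rep X" and l: "lifts X M g N"
  shows "hom_exact P lq X L M N f g"
proof -
  have L: "rep L" and M: "rep M" and N: "rep N" and f: "rhom L M f" and g: "rhom M N g"
    using se by (auto simp: short_exact_def fin_pres_def)
  have inj: "v = 0\<^sub>v (dm L p)" if "p \<in> P" "v \<in> carrier_vec (dm L p)" "f p *\<^sub>v v = 0\<^sub>v (dm M p)" for p v
    using se that by (auto simp: short_exact_def pw_inj_def)
  have inj2: "u = v" if p: "p \<in> P" and u: "u \<in> carrier_vec (dm L p)" and v: "v \<in> carrier_vec (dm L p)"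
    and e: "f p *\<^sub>v u = f p *\<^sub>v v" for p u v
  proof -
    have "f p *\<^sub>v (u - v) = f p *\<^sub>v u - f p *\<^sub>v v" by (rule mult_minus_distrib_mat_vec[OF hom_mat[OF f p] u v])
    also have "\<dots> = 0\<^sub>v (dm M p)" unfolding e using hom_vec[OF f p v] by simp
    finally have "u - v = 0\<^sub>v (dm L p)" using inj[OF p _] u v by auto
    thus ?thesis by (rule vec_zero_eq[OF u v])
  qed
  have ex: "g p *\<^sub>v w = 0\<^sub>v (dm N p) \<longleftrightarrow> (\<exists>v\<in>carrier_vec (dm L p). w = f p *\<^sub>v v)"
    if "p \<in> P" "w \<in> carrier_vec (dm M p)" for p w
    using se that by (auto simp: short_exact_def exact_at_def)
  show ?thesis unfolding hom_exact_def
  proof (intro conjI allI impI ballI)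
    fix h p assume "rhom X L h \<and> (\<forall>p\<in>P. f p * h p = 0\<^sub>m (dm M p) (dm X p))" and p: "p \<in> P"
    hence h: "rhom X L h" and z: "f p * h p = 0\<^sub>m (dm M p) (dm X p)" by auto
    show "h p = 0\<^sub>m (dm L p) (dm X p)"
    proof (rule mat_eqI_vec[OF hom_mat[OF h p] zero_carrier_mat])
      fix v :: "'k vec" assume v: "v \<in> carrier_vec (dm X p)"
      show "h p *\<^sub>v v = 0\<^sub>m (dm L p) (dm X p) *\<^sub>v v"
        using inj[OF p hom_vec[OF h p v]] z hom_zero_comp_iff[OF h f p] v by simp
    qed
  next
    fix h assume h: "rhom X M h"
    show "(\<forall>p\<in>P. g p * h p = 0\<^sub>m (dm N p) (dm X p)) \<longleftrightarrow> (\<exists>k. rhom X L k \<and> (\<forall>p\<in>P. h p = f p * k p))"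
    proof
      assume z: "\<forall>p\<in>P. g p * h p = 0\<^sub>m (dm N p) (dm X p)"
      \<comment> \<open>The factors are chosen point by point; injectivity of \<open>f\<close> then
        makes the choice natural.\<close>
      have "\<exists>K. p \<in> P \<longrightarrow> K \<in> carrier_mat (dm L p) (dm X p) \<and> h p = f p * K" for p
      proof (cases "p \<in> P")
        case True
        have "\<exists>K\<in>carrier_mat (dm L p) (dm X p). h p = f p * K"
        proof (rule mat_factor[OF hom_mat[OF f True] hom_mat[OF h True]])
          fix v :: "'k vec" assume v: "v \<in> carrier_vec (dm X p)"
          show "\<exists>u\<in>carrier_vec (dm L p). h p *\<^sub>v v = f p *\<^sub>v u"
            using ex[OF True hom_vec[OF h True v]] z hom_zero_comp_iff[OF h g True] True v by blast
        qed
        thus ?thesis by blast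
      qed blast
      then obtain k where k: "\<And>p. p \<in> P \<Longrightarrow> k p \<in> carrier_mat (dm L p) (dm X p)" "\<And>p. p \<in> P \<Longrightarrow> h p = f p * k p"
        by metis
      have hk: "h p *\<^sub>v v = f p *\<^sub>v (k p *\<^sub>v v)" if "p \<in> P" "v \<in> carrier_vec (dm X p)" for p v
        unfolding k(2)[OF that(1)] by (rule assoc_mult_mat_vec[OF hom_mat[OF f that(1)] k(1)[OF that(1)] that(2)])
      have kc: "k p *\<^sub>v v \<in> carrier_vec (dm L p)" if "p \<in> P" "v \<in> carrier_vec (dm X p)" for p v
        by (rule mult_mat_vec_carrier[OF k(1)[OF that(1)] that(2)])
      have "rhom X L k"
      proof (rule homI[OF X L k(1)])
        fix p q and v :: "'k vec" assume a: "p \<in> P" "q \<in> P" "lq p q" "v \<in> carrier_vec (dm X p)"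
        note mv = rep_vec[OF X a]
        show "k q *\<^sub>v (mp X p q *\<^sub>v v) = mp L p q *\<^sub>v (k p *\<^sub>v v)"
        proof (rule inj2[OF a(2) kc[OF a(2) mv] rep_vec[OF L a(1-3) kc[OF a(1,4)]]])
          show "f q *\<^sub>v (k q *\<^sub>v (mp X p q *\<^sub>v v)) = f q *\<^sub>v (mp L p q *\<^sub>v (k p *\<^sub>v v))"
            unfolding hk[OF a(2) mv, symmetric] hom_nat[OF L M f a(1-3) kc[OF a(1,4)]] hk[OF a(1,4), symmetric]
            by (rule hom_nat[OF X M h a])
        qed
      qed
      thus "\<exists>k. rhom X L k \<and> (\<forall>p\<in>P. h p = f p * k p)" using k(2) by blast
    next
      assume "\<exists>k. rhom X L k \<and> (\<forall>p\<in>P. h p = f p * k p)"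
      then obtain k where k: "rhom X L k" "\<And>p. p \<in> P \<Longrightarrow> h p = f p * k p" by blast
      show "\<forall>p\<in>P. g p * h p = 0\<^sub>m (dm N p) (dm X p)"
      proof
        fix p assume p: "p \<in> P"
        show "g p * h p = 0\<^sub>m (dm N p) (dm X p)"
        proof (subst hom_zero_comp_iff[OF h g p], intro ballI)
          fix v :: "'k vec" assume v: "v \<in> carrier_vec (dm X p)"
          have "h p *\<^sub>v v = f p *\<^sub>v (k p *\<^sub>v v)" unfolding k(2)[OF p] by (rule hom_comp_vec[OF k(1) f p v])
          thus "g p *\<^sub>v (h p *\<^sub>v v) = 0\<^sub>v (dm N p)"
            using ex[OF p hom_vec[OF h p v]] hom_vec[OF k(1) p v] by blast
        qed
      qed
    qed
  next
    fix h assume h: "rhom X N h"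
    show "\<exists>k. rhom X M k \<and> (\<forall>p\<in>P. h p = g p * k p)" by (rule liftsD[OF l g h])
  qed
qed

lemma lifts_of_hom_exact:
  assumes "hom_exact P lq X L M N f g" "rhom M N g"
  shows "lifts X M g N"
  unfolding lifts_def
proof (intro allI impI)
  fix h assume h: "rhom X N h"
  obtain k where "rhom X M k" "\<And>p. p \<in> P \<Longrightarrow> h p = g p * k p" using assms(1) h unfolding hom_exact_def by blast
  thus "\<exists>k. rhom X M k \<and> (\<forall>p\<in>P. \<forall>v\<in>carrier_vec (dm X p). h p *\<^sub>v v = g p *\<^sub>v (k p *\<^sub>v v))"
    using hom_comp_vec[OF _ assms(2)] by metis
qed

text \<open>Yoneda: an element at \<open>q\<close> is spread over the up-set of \<open>q\<close> by
  transport.\<close>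

lemma vhom_up:
  assumes F: "rep F" and q: "q \<in> P" and c: "c \<in> carrier_vec (dm F q)"
  shows "vhom (up P lq {q}) F (\<lambda>p. mp F q p *\<^sub>v c)"
  unfolding vhom_def
proof (intro conjI ballI impI)
  fix z assume "z \<in> up P lq {q}" thus "mp F q z *\<^sub>v c \<in> carrier_vec (dm F z)"
    by (intro rep_vec[OF F q _ _ c]) (auto simp: up_def)
next
  fix z p assume z: "z \<in> up P lq {q}" and p: "p \<in> P" "lq z p"
  hence z': "z \<in> P" "lq q z" by (auto simp: up_def)
  have "lq q p" using trans[OF q z'(1) p(1) z'(2) p(2)] .
  hence "p \<in> up P lq {q}" using p by (simp add: up_def)
  thus "mp F z p *\<^sub>v (mp F q z *\<^sub>v c) = (if p \<in> up P lq {q} then mp F q p *\<^sub>v c else 0\<^sub>v (dm F p))"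
    using rep_comp[OF F q z'(1) p(1) z'(2) p(2) c] by simp
qed

text \<open>The easy implication, valid over any poset: the lifting property that the exact
  structure grants to spreads passes to finite sums and along isomorphisms.\<close>

lemma E_projective_spread_sum:
  fixes X :: "('p, 'k::field) prep"
  assumes X: "rep X" and Ss: "\<forall>S\<in>set Ss. fp_spread P lq TYPE('k) S"
    and i: "iso P lq X (dsum_list (map indicator_rep Ss))"
  shows "E_projective P lq X"
  unfolding E_projective_def
proof (intro allI impI)
  fix L M N f g assume e: "in_spread_E P lq L M N f (g :: 'p \<Rightarrow> 'k mat)"
  hence se: "short_exact P lq L M N f g" by (simp add: in_spread_E_def)
  have M: "rep M" and N: "rep N" and g: "rhom M N g" using se by (auto simp: short_exact_def fin_pres_def)
  note reps = rep_indicator_list[OF Ss]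
  have "lifts (indicator_rep S) M g N" if "S \<in> set Ss" for S
    using e Ss that lifts_of_hom_exact[OF _ g] unfolding in_spread_E_def by blast
  hence "lifts (dsum_list (map indicator_rep Ss)) M g N" by (intro lifts_dsum_list[OF reps N M g]) auto
  hence "lifts X M g N" by (rule lifts_retract[OF X rep_dsum_list[OF reps] N M iso_retract[OF i]])
  thus "hom_exact P lq X L M N f g" by (rule hom_exact_of_lifts[OF se X])
qed

end

section \<open>Representations determined by a finite subset\<close>

text \<open>\<open>fl\<close> picks the greatest element of \<open>Q\<close> below a point, provided
  that some element of \<open>Q\<close> is below. \<open>join\<close> is the condition that a
  general poset may violate: an upper bound of \<open>z\<close> and \<open>z'\<close> can be found
  without leaving the floor fibre of \<open>z'\<close>.\<close>

locale qposet = rposet P lq for P :: "'p set" and lq +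
  fixes Q :: "'p set" and fl :: "'p \<Rightarrow> 'p"
  assumes finQ: "finite Q" and QP: "Q \<subseteq> P"
    and floor: "\<lbrakk>p \<in> P; q \<in> Q; lq q p\<rbrakk> \<Longrightarrow> fl p \<in> Q \<and> lq (fl p) p \<and> lq q (fl p)"
    and join: "\<lbrakk>z \<in> P; z' \<in> P; \<exists>q\<in>Q. lq q z; \<exists>q\<in>Q. lq q z'; lq (fl z) (fl z')\<rbrakk>
      \<Longrightarrow> \<exists>w\<in>P. lq z w \<and> lq z' w \<and> fl w = fl z'"
begin

text \<open>The domain on which \<open>fl\<close> is meaningful; nothing is assumed about its values
  elsewhere.\<close>

definition above where "above = {p \<in> P. \<exists>q\<in>Q. lq q p}"

lemma above_P: "p \<in> above \<Longrightarrow> p \<in> P" by (simp add: above_def)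
lemma fl_Q: "p \<in> above \<Longrightarrow> fl p \<in> Q" and fl_le: "p \<in> above \<Longrightarrow> lq (fl p) p"
  using floor by (auto simp: above_def)
lemma fl_P: "p \<in> above \<Longrightarrow> fl p \<in> P" using fl_Q QP by blast
lemma Q_above: "q \<in> Q \<Longrightarrow> q \<in> above" using QP refl by (auto simp: above_def)
lemma above_up:
  assumes "p \<in> above" "p' \<in> P" "lq p p'" shows "p' \<in> above"
proof -
  obtain q where q: "q \<in> Q" "lq q p" using assms(1) by (auto simp: above_def)
  hence "lq q p'" using trans[of q p p'] QP above_P assms by auto
  thus ?thesis using q assms(2) by (auto simp: above_def)
qed
lemma fl_mono:
  assumes "p \<in> above" "p' \<in> P" "lq p p'" shows "lq (fl p) (fl p')"
  using floor[OF assms(2) fl_Q[OF assms(1)] trans[OF fl_P[OF assms(1)] above_P[OF assms(1)] assms(2) fl_le[OF assms(1)] assms(3)]]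
  by simp
lemma fl_id:
  assumes "q \<in> Q" shows "fl q = q"
proof -
  have q: "q \<in> P" using assms QP by auto
  show ?thesis using floor[OF q assms refl[OF q]] antisym[OF q, of "fl q"] QP by auto
qed
lemma fl_above: "p \<in> above \<Longrightarrow> fl p \<in> above" by (rule Q_above[OF fl_Q])
lemma join':
  assumes "z \<in> above" "z' \<in> above" "lq (fl z) (fl z')" shows "\<exists>w\<in>above. lq z w \<and> lq z' w \<and> fl w = fl z'"
proof -
  obtain w where "w \<in> P" "lq z w \<and> lq z' w \<and> fl w = fl z'"
    using join[of z z'] assms by (auto simp: above_def)
  thus ?thesis using above_up[OF assms(1)] by blast
qed

text \<open>M is the extension along the floor map of its restriction to Q, by zero outside the up-set of Q.
The finitely presented representations of a grid are those that are qconst for some finite subgrid.\<close>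

definition qconst :: "('p, 'k::field) prep \<Rightarrow> bool" where
  "qconst M \<longleftrightarrow> rep M \<and> (\<forall>p\<in>P - above. dm M p = 0) \<and>
    (\<forall>p\<in>above. (\<forall>x\<in>carrier_vec (dm M (fl p)). mp M (fl p) p *\<^sub>v x = 0\<^sub>v (dm M p) \<longrightarrow> x = 0\<^sub>v (dm M (fl p))) \<and>
      (\<forall>y\<in>carrier_vec (dm M p). \<exists>x\<in>carrier_vec (dm M (fl p)). y = mp M (fl p) p *\<^sub>v x))"

definition saturated where "saturated S \<longleftrightarrow> S \<subseteq> above \<and> (\<forall>p\<in>above. p \<in> S \<longleftrightarrow> fl p \<in> S)"

lemma qconstD:
  assumes "qconst M"
  shows "rep M" "p \<in> P \<Longrightarrow> p \<notin> above \<Longrightarrow> dm M p = 0"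
    "\<lbrakk>p \<in> above; x \<in> carrier_vec (dm M (fl p)); mp M (fl p) p *\<^sub>v x = 0\<^sub>v (dm M p)\<rbrakk> \<Longrightarrow> x = 0\<^sub>v (dm M (fl p))"
    "\<lbrakk>p \<in> above; y \<in> carrier_vec (dm M p)\<rbrakk> \<Longrightarrow> \<exists>x\<in>carrier_vec (dm M (fl p)). y = mp M (fl p) p *\<^sub>v x"
  using assms unfolding qconst_def by blast+

lemma qconstI:
  assumes "rep M" "\<And>p. p \<in> P \<Longrightarrow> p \<notin> above \<Longrightarrow> dm M p = 0"
    "\<And>p x. \<lbrakk>p \<in> above; x \<in> carrier_vec (dm M (fl p)); mp M (fl p) p *\<^sub>v x = 0\<^sub>v (dm M p)\<rbrakk> \<Longrightarrow> x = 0\<^sub>v (dm M (fl p))"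
    "\<And>p y. \<lbrakk>p \<in> above; y \<in> carrier_vec (dm M p)\<rbrakk> \<Longrightarrow> \<exists>x\<in>carrier_vec (dm M (fl p)). y = mp M (fl p) p *\<^sub>v x"
  shows "qconst M"
  using assms unfolding qconst_def by blast

lemma rep_inj_eq:
  assumes M: "qconst M" and p: "p \<in> above" and x: "x \<in> carrier_vec (dm M (fl p))" and y: "y \<in> carrier_vec (dm M (fl p))"
    and e: "mp M (fl p) p *\<^sub>v x = mp M (fl p) p *\<^sub>v y"
  shows "x = y"
proof -
  have m: "mp M (fl p) p \<in> carrier_mat (dm M p) (dm M (fl p))"
    by (rule rep_mat[OF qconstD(1)[OF M] fl_P[OF p] above_P[OF p] fl_le[OF p]])
  have "mp M (fl p) p *\<^sub>v (x - y) = mp M (fl p) p *\<^sub>v x - mp M (fl p) p *\<^sub>v y"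
    by (rule mult_minus_distrib_mat_vec[OF m x y])
  also have "\<dots> = 0\<^sub>v (dm M p)" unfolding e using mult_mat_vec_carrier[OF m y] by simp
  finally have "x - y = 0\<^sub>v (dm M (fl p))" by (intro qconstD(3)[OF M p]) (use x y in auto)
  thus ?thesis by (rule vec_zero_eq[OF x y])
qed

section \<open>Closure of \<open>qconst\<close> under sums, kernels and cokernels\<close>

lemma qconst_zero: "qconst zero_rep"
  by (rule qconstI[OF rep_zero]) (auto simp: zero_rep_def intro!: carrier_vec0 eq_vecI)

lemma qconst_pow_ind:
  assumes c: "convex P lq S" and s: "saturated S"
  shows "qconst (pow_ind S d)"
proof (rule qconstI[OF rep_pow_ind[OF c]])
  fix p assume "p \<in> P" "p \<notin> above" thus "dm (pow_ind S d) p = 0" using s by (auto simp: saturated_def pow_ind_def)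
next
  fix p and x :: "'a vec" assume h: "p \<in> above" "x \<in> carrier_vec (dm (pow_ind S d) (fl p))"
    "mp (pow_ind S d) (fl p) p *\<^sub>v x = 0\<^sub>v (dm (pow_ind S d) p)"
  show "x = 0\<^sub>v (dm (pow_ind S d) (fl p))"
    using h s by (cases "p \<in> S") (auto simp: saturated_def pow_ind_def intro: carrier_vec0)
next
  fix p and y :: "'a vec" assume h: "p \<in> above" "y \<in> carrier_vec (dm (pow_ind S d) p)"
  show "\<exists>x\<in>carrier_vec (dm (pow_ind S d) (fl p)). y = mp (pow_ind S d) (fl p) p *\<^sub>v x"
  proof (cases "p \<in> S")
    case True thus ?thesis using h s by (intro bexI[of _ y]) (auto simp: saturated_def pow_ind_def)
  next
    case False
    hence "y = 0\<^sub>v 0" "fl p \<notin> S" using h s carrier_vec0[of y] by (auto simp: saturated_def pow_ind_def)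
    thus ?thesis using False by (intro bexI[of _ "0\<^sub>v 0"]) (auto simp: pow_ind_def)
  qed
qed

lemma qconst_dsum:
  assumes X: "qconst X" and Y: "qconst Y" shows "qconst (dsum X Y)"
proof (rule qconstI[OF rep_dsum[OF qconstD(1)[OF X] qconstD(1)[OF Y]]])
  fix p assume "p \<in> P" "p \<notin> above" thus "dm (dsum X Y) p = 0" using qconstD(2)[OF X] qconstD(2)[OF Y] by simp
next
  note rX = qconstD(1)[OF X] and rY = qconstD(1)[OF Y]
  fix p and v :: "'a vec" assume p: "p \<in> above" and v: "v \<in> carrier_vec (dm (dsum X Y) (fl p))"
    and z: "mp (dsum X Y) (fl p) p *\<^sub>v v = 0\<^sub>v (dm (dsum X Y) p)"
  note h = fl_P[OF p] above_P[OF p] fl_le[OF p]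
  from v have "v \<in> carrier_vec (dm X (fl p) + dm Y (fl p))" by simp
  then obtain x y where xy: "x \<in> carrier_vec (dm X (fl p))" "y \<in> carrier_vec (dm Y (fl p))" "v = x @\<^sub>v y"
    by (rule append_vec_cases)
  have z0: "0\<^sub>v (dm (dsum X Y) p) = 0\<^sub>v (dm X p) @\<^sub>v (0\<^sub>v (dm Y p) :: 'a vec)" by (intro eq_vecI) auto
  have "mp X (fl p) p *\<^sub>v x = 0\<^sub>v (dm X p) \<and> mp Y (fl p) p *\<^sub>v y = 0\<^sub>v (dm Y p)"
    using z unfolding xy(3) dsum_vec[OF rX rY h xy(1,2)] z0
    using append_vec_eq[OF rep_vec[OF rX h xy(1)] zero_carrier_vec] by blast
  hence "x = 0\<^sub>v (dm X (fl p))" "y = 0\<^sub>v (dm Y (fl p))" using qconstD(3)[OF X p xy(1)] qconstD(3)[OF Y p xy(2)] by auto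
  thus "v = 0\<^sub>v (dm (dsum X Y) (fl p))" unfolding xy(3) by (intro eq_vecI) auto
next
  note rX = qconstD(1)[OF X] and rY = qconstD(1)[OF Y]
  fix p and v :: "'a vec" assume p: "p \<in> above" and v: "v \<in> carrier_vec (dm (dsum X Y) p)"
  note h = fl_P[OF p] above_P[OF p] fl_le[OF p]
  from v have "v \<in> carrier_vec (dm X p + dm Y p)" by simp
  then obtain x y where xy: "x \<in> carrier_vec (dm X p)" "y \<in> carrier_vec (dm Y p)" "v = x @\<^sub>v y"
    by (rule append_vec_cases)
  obtain x' where x': "x' \<in> carrier_vec (dm X (fl p))" "x = mp X (fl p) p *\<^sub>v x'" using qconstD(4)[OF X p xy(1)] by blast
  obtain y' where y': "y' \<in> carrier_vec (dm Y (fl p))" "y = mp Y (fl p) p *\<^sub>v y'" using qconstD(4)[OF Y p xy(2)] by blast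
  show "\<exists>x\<in>carrier_vec (dm (dsum X Y) (fl p)). v = mp (dsum X Y) (fl p) p *\<^sub>v x"
    using dsum_vec[OF rX rY h x'(1) y'(1)] xy(3) x' y' by (intro bexI[of _ "x' @\<^sub>v y'"]) auto
qed

lemma qconst_dsum_list: "\<forall>X\<in>set Xs. qconst X \<Longrightarrow> qconst (dsum_list Xs)"
  by (induction Xs) (auto simp: qconst_zero qconst_dsum)

text \<open>Transport from the floor is bijective on \<open>C\<close> and on \<open>D\<close>. A
  kernel element at \<open>p\<close> has a preimage in \<open>C\<close> at the floor, and this
  preimage is in the kernel because transport on \<open>D\<close> is injective.\<close>

lemma qconst_ker:
  assumes k: "ker_data C D f K i r" and C: "qconst C" and D: "qconst D" and f: "rhom C D f"
  shows "qconst K"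
proof -
  note kd = ker_dataD[OF k] and rC = qconstD(1)[OF C] and rD = qconstD(1)[OF D]
  show ?thesis
  proof (rule qconstI[OF kd(1)])
    fix p assume "p \<in> P" "p \<notin> above" thus "dm K p = 0" using kd(7)[of p] qconstD(2)[OF C] by simp
  next
    fix p and x :: "'a vec" assume p: "p \<in> above" and x: "x \<in> carrier_vec (dm K (fl p))" and z: "mp K (fl p) p *\<^sub>v x = 0\<^sub>v (dm K p)"
    note h = fl_P[OF p] above_P[OF p] fl_le[OF p]
    have ix: "i (fl p) *\<^sub>v x \<in> carrier_vec (dm C (fl p))" by (rule hom_vec[OF kd(2) h(1) x])
    have "mp C (fl p) p *\<^sub>v (i (fl p) *\<^sub>v x) = 0\<^sub>v (dm C p)"
      unfolding hom_nat[OF kd(1) rC kd(2) h x, symmetric] z by (rule hom_zero_vec[OF kd(2) h(2)])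
    hence "i (fl p) *\<^sub>v x = 0\<^sub>v (dm C (fl p))" by (rule qconstD(3)[OF C p ix])
    hence "r (fl p) *\<^sub>v (i (fl p) *\<^sub>v x) = 0\<^sub>v (dm K (fl p))" using kd(9)[OF h(1)] by simp
    thus "x = 0\<^sub>v (dm K (fl p))" unfolding kd(4)[OF h(1) x] .
  next
    fix p and y :: "'a vec" assume p: "p \<in> above" and y: "y \<in> carrier_vec (dm K p)"
    note h = fl_P[OF p] above_P[OF p] fl_le[OF p]
    have iy: "i p *\<^sub>v y \<in> carrier_vec (dm C p)" by (rule hom_vec[OF kd(2) h(2) y])
    obtain x where x: "x \<in> carrier_vec (dm C (fl p))" "i p *\<^sub>v y = mp C (fl p) p *\<^sub>v x" using qconstD(4)[OF C p iy] by blast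
    have "mp D (fl p) p *\<^sub>v (f (fl p) *\<^sub>v x) = 0\<^sub>v (dm D p)"
      unfolding hom_nat[OF rC rD f h x(1), symmetric] x(2)[symmetric] by (rule kd(6)[OF h(2) y])
    hence "f (fl p) *\<^sub>v x = 0\<^sub>v (dm D (fl p))" by (rule qconstD(3)[OF D p hom_vec[OF f h(1) x(1)]])
    note ir = kd(5)[OF h(1) x(1) this]
    note rx = kd(3)[OF h(1) x(1)]
    have c: "mp K (fl p) p *\<^sub>v (r (fl p) *\<^sub>v x) \<in> carrier_vec (dm K p)" by (rule rep_vec[OF kd(1) h rx])
    have "i p *\<^sub>v (mp K (fl p) p *\<^sub>v (r (fl p) *\<^sub>v x)) = i p *\<^sub>v y"
      unfolding hom_nat[OF kd(1) rC kd(2) h rx] ir x(2) ..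
    hence "r p *\<^sub>v (i p *\<^sub>v (mp K (fl p) p *\<^sub>v (r (fl p) *\<^sub>v x))) = r p *\<^sub>v (i p *\<^sub>v y)" by simp
    hence "mp K (fl p) p *\<^sub>v (r (fl p) *\<^sub>v x) = y" unfolding kd(4)[OF h(2) c] kd(4)[OF h(2) y] .
    thus "\<exists>x\<in>carrier_vec (dm K (fl p)). y = mp K (fl p) p *\<^sub>v x" using rx by blast
  qed
qed

text \<open>A relation at \<open>p\<close> is pulled back to the floor by surjectivity of transport
  on \<open>F1\<close> and injectivity on \<open>F0\<close>, so nothing nonzero dies between the
  floor and \<open>p\<close>.\<close>

lemma qconst_coker:
  assumes F1: "qconst F1" and F0: "qconst F0" and M: "rep M" and a: "rhom F1 F0 a" and b: "rhom F0 M b"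
    and ex: "exact_at P F1 F0 M a b" and sj: "pw_surj P F0 M b"
  shows "qconst M"
proof -
  note r1 = qconstD(1)[OF F1] and r0 = qconstD(1)[OF F0]
  have ex: "b p *\<^sub>v w = 0\<^sub>v (dm M p) \<longleftrightarrow> (\<exists>v\<in>carrier_vec (dm F1 p). w = a p *\<^sub>v v)" if "p \<in> P" "w \<in> carrier_vec (dm F0 p)" for p w
    using ex that by (simp add: exact_at_def)
  have sj: "\<exists>w\<in>carrier_vec (dm F0 p). u = b p *\<^sub>v w" if "p \<in> P" "u \<in> carrier_vec (dm M p)" for p u
    using sj that by (simp add: pw_surj_def)
  show ?thesis
  proof (rule qconstI[OF M])
    fix p assume p: "p \<in> P" "p \<notin> above"
    show "dm M p = 0"
    proof (rule ccontr)
      assume n: "dm M p \<noteq> 0"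
      obtain w where w: "w \<in> carrier_vec (dm F0 p)" "unit_vec (dm M p) 0 = b p *\<^sub>v w" using sj[OF p(1), of "unit_vec (dm M p) 0"] by auto
      have "w = 0\<^sub>v (dm F0 p)" using w(1) qconstD(2)[OF F0 p] carrier_vec0 by simp
      hence "unit_vec (dm M p) 0 = (0\<^sub>v (dm M p) :: 'a vec)" using w(2) hom_zero_vec[OF b p(1)] by simp
      hence "(unit_vec (dm M p) 0 :: 'a vec) $ 0 = 0\<^sub>v (dm M p) $ 0" by simp
      thus False using n by simp
    qed
  next
    fix p and m :: "'a vec" assume p: "p \<in> above" and m: "m \<in> carrier_vec (dm M (fl p))" and z: "mp M (fl p) p *\<^sub>v m = 0\<^sub>v (dm M p)"
    note h = fl_P[OF p] above_P[OF p] fl_le[OF p]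
    obtain w where w: "w \<in> carrier_vec (dm F0 (fl p))" "m = b (fl p) *\<^sub>v w" using sj[OF h(1) m] by blast
    note fw = rep_vec[OF r0 h w(1)]
    have "b p *\<^sub>v (mp F0 (fl p) p *\<^sub>v w) = 0\<^sub>v (dm M p)" unfolding hom_nat[OF r0 M b h w(1)] w(2)[symmetric] by (rule z)
    then obtain v where v: "v \<in> carrier_vec (dm F1 p)" "mp F0 (fl p) p *\<^sub>v w = a p *\<^sub>v v" using ex[OF h(2) fw] by blast
    obtain v' where v': "v' \<in> carrier_vec (dm F1 (fl p))" "v = mp F1 (fl p) p *\<^sub>v v'" using qconstD(4)[OF F1 p v(1)] by blast
    have "w = a (fl p) *\<^sub>v v'"
    proof (rule rep_inj_eq[OF F0 p w(1) hom_vec[OF a h(1) v'(1)]])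
      show "mp F0 (fl p) p *\<^sub>v w = mp F0 (fl p) p *\<^sub>v (a (fl p) *\<^sub>v v')"
        unfolding hom_nat[OF r1 r0 a h v'(1), symmetric] v'(2)[symmetric] by (rule v(2))
    qed
    thus "m = 0\<^sub>v (dm M (fl p))" using ex[OF h(1) w(1)] v'(1) w(2) by blast
  next
    fix p and u :: "'a vec" assume p: "p \<in> above" and u: "u \<in> carrier_vec (dm M p)"
    note h = fl_P[OF p] above_P[OF p] fl_le[OF p]
    obtain w where w: "w \<in> carrier_vec (dm F0 p)" "u = b p *\<^sub>v w" using sj[OF h(2) u] by blast
    obtain w' where w': "w' \<in> carrier_vec (dm F0 (fl p))" "w = mp F0 (fl p) p *\<^sub>v w'" using qconstD(4)[OF F0 p w(1)] by blast
    show "\<exists>x\<in>carrier_vec (dm M (fl p)). u = mp M (fl p) p *\<^sub>v x"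
      using hom_nat[OF r0 M b h w'(1)] hom_vec[OF b h(1) w'(1)] w(2) w'(2) by metis
  qed
qed

section \<open>Surjections from sums of principal up-sets\<close>

abbreviation "upq q \<equiv> up P lq {q}"

lemma up_convex: "q \<in> P \<Longrightarrow> convex P lq (upq q)"
  unfolding convex_def up_def using trans by blast

text \<open>The universal property of the floor: an element of \<open>Q\<close> lies below a point
  exactly if it lies below the floor of that point.\<close>

lemma up_saturated:
  assumes q: "q \<in> Q" shows "saturated (upq q)"
proof -
  have qP: "q \<in> P" using q QP by auto
  have "p \<in> upq q \<longleftrightarrow> fl p \<in> upq q" if p: "p \<in> above" for p
    using floor[OF above_P[OF p] q] fl_P[OF p] above_P[OF p] trans[OF qP fl_P[OF p] above_P[OF p] _ fl_le[OF p]]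
    by (auto simp: up_def)
  thus ?thesis unfolding saturated_def using q by (auto simp: up_def above_def)
qed

lemma up_connected: "q \<in> P \<Longrightarrow> connected_sub P lq (upq q)"
  unfolding connected_sub_def
proof (intro conjI ballI)
  assume q: "q \<in> P"
  show "upq q \<subseteq> P" by (auto simp: up_def)
  have qq: "q \<in> upq q" using q refl by (simp add: up_def)
  thus "upq q \<noteq> {}" by blast
  fix x y assume xy: "x \<in> upq q" "y \<in> upq q"
  let ?R = "\<lambda>a b. a \<in> upq q \<and> b \<in> upq q \<and> (lq a b \<or> lq b a)"
  have "?R\<^sup>*\<^sup>* x q" by (rule r_into_rtranclp) (use xy qq in \<open>simp add: up_def\<close>)
  moreover have "?R\<^sup>*\<^sup>* q y" by (rule r_into_rtranclp) (use xy qq in \<open>simp add: up_def\<close>)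
  ultimately show "?R\<^sup>*\<^sup>* x y" by (rule rtranclp_trans)
qed

lemma up_spread: "q \<in> P \<Longrightarrow> spread P lq (upq q)"
  by (simp add: spread_def up_convex up_connected)

text \<open>By Yoneda each \<open>q\<close> in \<open>Q\<close> contributes one copy of its up-set
  for every basis vector at \<open>q\<close>. At a point \<open>p\<close> the copies belonging to
  the floor of \<open>p\<close> already reach everything, since transport from the floor is
  onto.\<close>

lemma qconst_cover:
  fixes M :: "('p, 'k::field) prep"
  assumes M: "qconst M"
  shows "\<exists>as g. set as \<subseteq> Q \<and> rhom (dsum_list (map (\<lambda>a. indicator_rep (upq a)) as)) M g \<and>
     pw_surj P (dsum_list (map (\<lambda>a. indicator_rep (upq a)) as)) M g"
proof -
  note rM = qconstD(1)[OF M]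
  obtain Qs where Qs: "set Qs = Q" using finite_list[OF finQ] by blast
  define X where "X q = (pow_ind (upq q) (dm M q) :: ('p, 'k) prep)" for q
  let ?as = "concat (map (\<lambda>q. replicate (dm M q) q) Qs)"
  have F: "dsum_list (map X Qs) = dsum_list (map (\<lambda>a. indicator_rep (upq a)) ?as)"
    unfolding X_def dsum_list_pow_ind by (simp add: map_concat o_def map_replicate)
  have as: "set ?as \<subseteq> Q" using Qs by auto
  have rX: "\<forall>Y\<in>set (map X Qs). rep Y" using Qs QP up_convex rep_pow_ind by (auto simp: X_def)
  define A where "A q H \<longleftrightarrow> rhom (X q) M H \<and> (\<forall>p\<in>P. lq q p \<longrightarrow> H p = mp M q p)" for q H
  have "\<exists>H. A q H" if q: "q \<in> Q" for q
  proof -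
    have qP: "q \<in> P" using q QP by auto
    have v: "vhom (upq q) M (\<lambda>p. mp M q p *\<^sub>v unit_vec (dm M q) j)" for j
      by (rule vhom_up[OF rM qP]) simp
    have "\<exists>H. rhom (pow_ind (upq q) (dm M q)) M H \<and>
        (\<forall>j<dm M q. \<forall>p\<in>upq q. H p *\<^sub>v unit_vec (dm M q) j = mp M q p *\<^sub>v unit_vec (dm M q) j)"
      by (rule hom_of_vhoms[OF up_convex[OF qP] rM]) (rule v)
    then obtain H where H: "rhom (X q) M H"
      "\<forall>j<dm M q. \<forall>p\<in>upq q. H p *\<^sub>v unit_vec (dm M q) j = mp M q p *\<^sub>v unit_vec (dm M q) j"
      unfolding X_def by (elim exE conjE)
    have "H p = mp M q p" if p: "p \<in> P" "lq q p" for p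
    proof (rule mat_eqI_unit)
      have pu: "p \<in> upq q" using p by (simp add: up_def)
      show "H p \<in> carrier_mat (dm M p) (dm M q)" using hom_mat[OF H(1) p(1)] pu by (simp add: X_def dm_pow_ind)
      show "mp M q p \<in> carrier_mat (dm M p) (dm M q)" by (rule rep_mat[OF rM qP p])
      fix j assume "j < dm M q" thus "H p *\<^sub>v unit_vec (dm M q) j = mp M q p *\<^sub>v unit_vec (dm M q) j"
        using H(2) pu by blast
    qed
    hence "A q H" using H(1) unfolding A_def by simp
    thus ?thesis by (intro exI[of _ H])
  qed
  then obtain H where "\<And>q. q \<in> Q \<Longrightarrow> A q (H q)" by metis
  hence H: "\<And>q. q \<in> Q \<Longrightarrow> rhom (X q) M (H q)" "\<And>q p. \<lbrakk>q \<in> Q; p \<in> P; lq q p\<rbrakk> \<Longrightarrow> H q p = mp M q p"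
    unfolding A_def by blast+
  have "rhom (map X Qs ! i) M (H (Qs ! i))" if "i < length (map X Qs)" for i
  proof -
    have "Qs ! i \<in> Q" using that Qs nth_mem by auto
    thus ?thesis using H(1) that by simp
  qed
  from dsum_list_out[OF rX rM this] obtain g where g: "rhom (dsum_list (map X Qs)) M g"
    "\<And>i p x. \<lbrakk>i < length (map X Qs); p \<in> P; x \<in> carrier_vec (dm (map X Qs ! i) p)\<rbrakk> \<Longrightarrow>
      g p *\<^sub>v (linj (map X Qs) i p *\<^sub>v x) = H (Qs ! i) p *\<^sub>v x" by blast
  have "pw_surj P (dsum_list (map X Qs)) M g"
    unfolding pw_surj_def
  proof (intro ballI)
    fix p and u :: "'k vec" assume p: "p \<in> P" and u: "u \<in> carrier_vec (dm M p)"
    show "\<exists>w\<in>carrier_vec (dm (dsum_list (map X Qs)) p). u = g p *\<^sub>v w"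
    proof (cases "p \<in> above")
      case False
      hence "u = 0\<^sub>v (dm M p)" using u qconstD(2)[OF M p] carrier_vec0 by simp
      thus ?thesis using hom_zero_vec[OF g(1) p] by (intro bexI[of _ "0\<^sub>v (dm (dsum_list (map X Qs)) p)"]) auto
    next
      case True
      obtain x where x: "x \<in> carrier_vec (dm M (fl p))" "u = mp M (fl p) p *\<^sub>v x" using qconstD(4)[OF M True u] by blast
      obtain i where i: "i < length Qs" "Qs ! i = fl p" using fl_Q[OF True] Qs by (metis in_set_conv_nth)
      have i': "i < length (map X Qs)" using i by simp
      have x': "x \<in> carrier_vec (dm (map X Qs ! i) p)"
        using x(1) i fl_le[OF True] p by (simp add: X_def dm_pow_ind up_def)
      have "u = g p *\<^sub>v (linj (map X Qs) i p *\<^sub>v x)"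
        unfolding g(2)[OF i' p x'] i(2) H(2)[OF fl_Q[OF True] p fl_le[OF True]] by (rule x(2))
      thus ?thesis using hom_vec[OF linj_hom[OF rX i'] p x'] by blast
    qed
  qed
  thus ?thesis using g(1) as unfolding F by blast
qed

lemma qconst_up_list: 
  "set as \<subseteq> Q \<Longrightarrow> qconst (dsum_list (map (\<lambda>a. indicator_rep (upq a)) as) :: ('p, 'k::field) prep)"
  unfolding pow_ind_1 using QP by (intro qconst_dsum_list) (auto intro!: qconst_pow_ind up_convex up_saturated)

text \<open>A converse to \<open>qconst_coker\<close>: cover \<open>M\<close>, then cover the kernel
  of that surjection, which is again \<open>qconst\<close>.\<close>

lemma qconst_fin_pres:
  fixes M :: "('p, 'k::field) prep"
  assumes M: "qconst M"
  shows "fin_pres P lq M"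
proof -
  note rM = qconstD(1)[OF M]
  let ?F = "\<lambda>as. dsum_list (map (\<lambda>a. indicator_rep (upq a)) as) :: ('p, 'k) prep"
  obtain as g where g: "set as \<subseteq> Q" "rhom (?F as) M g" "pw_surj P (?F as) M g" using qconst_cover[OF M] by blast
  note F0 = qconst_up_list[OF g(1), where 'k = 'k]
  obtain K i r where k: "ker_data (?F as) M g K i r" using ker_exists[OF qconstD(1)[OF F0] rM g(2)] by blast
  note K = qconst_ker[OF k F0 M g(2)] and kd = ker_dataD[OF k]
  obtain bs h where h: "set bs \<subseteq> Q" "rhom (?F bs) K h" "pw_surj P (?F bs) K h" using qconst_cover[OF K] by blast
  note F1 = qconst_up_list[OF h(1), where 'k = 'k]
  let ?phi = "\<lambda>p. i p * h p"
  have phi: "rhom (?F bs) (?F as) ?phi" by (rule hom_comp[OF qconstD(1)[OF F1] kd(1) qconstD(1)[OF F0] h(2) kd(2)])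
  have "exact_at P (?F bs) (?F as) M ?phi g"
    unfolding exact_at_def
  proof (intro ballI iffI)
    fix p and w :: "'k vec" assume p: "p \<in> P" and w: "w \<in> carrier_vec (dm (?F as) p)" and z: "g p *\<^sub>v w = 0\<^sub>v (dm M p)"
    obtain v where v: "v \<in> carrier_vec (dm (?F bs) p)" "r p *\<^sub>v w = h p *\<^sub>v v"
      using h(3) p kd(3)[OF p w] unfolding pw_surj_def by blast
    have "w = ?phi p *\<^sub>v v"
      unfolding hom_comp_vec[OF h(2) kd(2) p v(1)] v(2)[symmetric] kd(5)[OF p w z] ..
    thus "\<exists>v\<in>carrier_vec (dm (?F bs) p). w = ?phi p *\<^sub>v v" using v(1) by blast
  next
    fix p and w :: "'k vec" assume p: "p \<in> P" and "\<exists>v\<in>carrier_vec (dm (?F bs) p). w = ?phi p *\<^sub>v v"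
    then obtain v where v: "v \<in> carrier_vec (dm (?F bs) p)" "w = ?phi p *\<^sub>v v" by blast
    show "g p *\<^sub>v w = 0\<^sub>v (dm M p)"
      unfolding v(2) hom_comp_vec[OF h(2) kd(2) p v(1)] by (rule kd(6)[OF p hom_vec[OF h(2) p v(1)]])
  qed
  thus ?thesis unfolding fin_pres_def Let_def using rM g h QP phi by blast
qed

lemma fp_spreadI: "spread P lq S \<Longrightarrow> saturated S \<Longrightarrow> fp_spread P lq TYPE('k::field) S"
  unfolding fp_spread_def pow_ind_1 using qconst_fin_pres[OF qconst_pow_ind] by (auto simp: spread_def)

text \<open>The support Z0 of a morphism from the indicator of Z to F is spread out over the floor fibres it meets.
Values over the same fibre agree after transport to an upper bound lying in that fibre, so the
morphism factors through the indicator of a saturated convex set.\<close>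

lemma vhom_extend:
  fixes F :: "('p, 'k::field) prep"
  assumes F: "qconst F" and ZP: "Z \<subseteq> P" and v: "vhom Z F v"
  defines "Z0 \<equiv> {z \<in> Z. v z \<noteq> 0\<^sub>v (dm F z)}"
  shows "\<exists>S v'. convex P lq S \<and> saturated S \<and> vhom S F v' \<and> Z0 \<subseteq> S \<and> (\<forall>z\<in>Z0. v' z = v z) \<and>
     (\<forall>z\<in>Z0. \<forall>p\<in>S. lq z p \<longrightarrow> p \<in> Z0) \<and> (\<forall>z\<in>Z. \<forall>p\<in>Z0. lq z p \<longrightarrow> z \<in> Z0) \<and>
     (\<forall>p\<in>S. \<exists>z\<in>Z0. fl z = fl p)"
proof -
  note rF = qconstD(1)[OF F]
  have vc: "v z \<in> carrier_vec (dm F z)" if "z \<in> Z" for z using vhomD(1)[OF v that] .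
  have Z0U: "Z0 \<subseteq> above"
  proof
    fix z assume z: "z \<in> Z0"
    show "z \<in> above"
    proof (rule ccontr)
      assume "z \<notin> above"
      hence "dm F z = 0" using z ZP qconstD(2)[OF F] by (auto simp: Z0_def)
      thus False using z vc[of z] carrier_vec0[of "v z"] by (auto simp: Z0_def)
    qed
  qed
  \<comment> \<open>\<open>x\<close> is the value at the floor \<open>q\<close> whose transport is
    \<open>v z\<close> for a support point \<open>z\<close> over \<open>q\<close>. The case
    \<open>q = q'\<close> of \<open>cmp\<close> shows that it does not depend on
    \<open>z\<close>.\<close>
  define N where "N q x \<longleftrightarrow> x \<in> carrier_vec (dm F q) \<and> (\<exists>z\<in>Z0. fl z = q \<and> mp F q z *\<^sub>v x = v z)" for q x
  have NQ: "q \<in> Q" "q \<in> P" if "N q x" for q x using that Z0U fl_Q QP by (auto simp: N_def)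
  have N0: "x \<noteq> 0\<^sub>v (dm F q)" if n: "N q x" for q x
  proof
    assume x: "x = 0\<^sub>v (dm F q)"
    obtain z where z: "z \<in> Z0" "fl z = q" "mp F q z *\<^sub>v x = v z" using n by (auto simp: N_def)
    have zU: "z \<in> above" using z Z0U by auto
    have "v z = 0\<^sub>v (dm F z)"
      using z(3) rep_zero_vec[OF rF fl_P[OF zU] above_P[OF zU] fl_le[OF zU]] unfolding x z(2) by simp
    thus False using z(1) by (simp add: Z0_def)
  qed
  have up: "p \<in> Z \<and> v p = mp F z p *\<^sub>v v z" if "z \<in> Z" "p \<in> P" "lq z p" "mp F z p *\<^sub>v v z \<noteq> 0\<^sub>v (dm F p)" for z p
    using vhomD(2)[OF v that(1-3)] that(4) by (auto split: if_splits)
  have inj: "mp F q w *\<^sub>v x \<noteq> 0\<^sub>v (dm F w)" if "w \<in> above" "q = fl w" "x \<in> carrier_vec (dm F q)" "x \<noteq> 0\<^sub>v (dm F q)" for q w x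
    using qconstD(3)[OF F that(1)] that by blast
  \<comment> \<open>Join \<open>z\<close> with the point \<open>q'\<close>, which is its own floor.
    This gives \<open>w\<close> above \<open>z\<close> in the fibre of \<open>q'\<close>, and since
    transport within a fibre is injective, \<open>v\<close> is still nonzero at
    \<open>w\<close>.\<close>
  have ext: "N q' (mp F q q' *\<^sub>v x)" if n: "N q x" and q': "q' \<in> Q" "lq q q'" and nz: "mp F q q' *\<^sub>v x \<noteq> 0\<^sub>v (dm F q')" for q q' x
  proof -
    have x: "x \<in> carrier_vec (dm F q)" using n by (simp add: N_def)
    obtain z where z: "z \<in> Z0" "fl z = q" "mp F q z *\<^sub>v x = v z" using n by (auto simp: N_def)
    have zU: "z \<in> above" and zZ: "z \<in> Z" using z Z0U by (auto simp: Z0_def)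
    obtain w where w: "w \<in> above" "lq z w" "lq q' w" "fl w = q'"
      using join'[OF zU Q_above[OF q'(1)]] fl_id[OF q'(1)] q'(2) z(2) by auto
    have q'P: "q' \<in> P" and qP: "q \<in> P" using q' QP NQ[OF n] by auto
    have xx: "mp F q q' *\<^sub>v x \<in> carrier_vec (dm F q')" by (rule rep_vec[OF rF qP q'P q'(2) x])
    have e: "mp F z w *\<^sub>v v z = mp F q' w *\<^sub>v (mp F q q' *\<^sub>v x)"
      unfolding z(3)[symmetric]
      using rep_comp[OF rF qP above_P[OF zU] above_P[OF w(1)] _ w(2) x] fl_le[OF zU] z(2)
        rep_comp[OF rF qP q'P above_P[OF w(1)] q'(2) w(3) x] by simp
    have "mp F z w *\<^sub>v v z \<noteq> 0\<^sub>v (dm F w)" unfolding e by (rule inj[OF w(1) w(4)[symmetric] xx nz])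
    hence "w \<in> Z0" and "v w = mp F q' w *\<^sub>v (mp F q q' *\<^sub>v x)"
      using up[OF zZ above_P[OF w(1)] w(2)] e by (auto simp: Z0_def)
    thus ?thesis unfolding N_def using xx w(4) by auto
  qed
  \<comment> \<open>Both values are compared at an upper bound \<open>w\<close> of \<open>z\<close>
    and \<open>z'\<close> in the fibre of \<open>q'\<close>; injectivity then cancels the transport
    from \<open>q'\<close> to \<open>w\<close>.\<close>
  have cmp: "mp F q q' *\<^sub>v x = x'" if n: "N q x" and n': "N q' x'" and qq: "lq q q'" for q q' x x'
  proof -
    have x: "x \<in> carrier_vec (dm F q)" and x': "x' \<in> carrier_vec (dm F q')" using n n' by (auto simp: N_def)
    obtain z where z: "z \<in> Z0" "fl z = q" "mp F q z *\<^sub>v x = v z" using n by (auto simp: N_def)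
    obtain z' where z': "z' \<in> Z0" "fl z' = q'" "mp F q' z' *\<^sub>v x' = v z'" using n' by (auto simp: N_def)
    have zU: "z \<in> above" "z' \<in> above" and zZ: "z \<in> Z" "z' \<in> Z" using z z' Z0U by (auto simp: Z0_def)
    obtain w where w: "w \<in> above" "lq z w" "lq z' w" "fl w = q'"
      using join'[OF zU] qq z(2) z'(2) by auto
    have qP: "q \<in> P" "q' \<in> P" using NQ[OF n] NQ[OF n'] by auto
    have q'w: "lq q' w" using fl_le[OF w(1)] w(4) by simp
    have e': "mp F z' w *\<^sub>v v z' = mp F q' w *\<^sub>v x'"
      unfolding z'(3)[symmetric]
      using rep_comp[OF rF qP(2) above_P[OF zU(2)] above_P[OF w(1)] _ w(3) x'] fl_le[OF zU(2)] z'(2) by simp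
    have "mp F z' w *\<^sub>v v z' \<noteq> 0\<^sub>v (dm F w)" unfolding e' by (rule inj[OF w(1) w(4)[symmetric] x' N0[OF n']])
    hence wZ: "w \<in> Z" and vw: "v w = mp F q' w *\<^sub>v x'" using up[OF zZ(2) above_P[OF w(1)] w(3)] e' by auto
    have "mp F q' w *\<^sub>v (mp F q q' *\<^sub>v x) = mp F q w *\<^sub>v x"
      by (rule rep_comp[OF rF qP above_P[OF w(1)] qq q'w x])
    also have "\<dots> = mp F z w *\<^sub>v v z"
      unfolding z(3)[symmetric]
      using rep_comp[OF rF qP(1) above_P[OF zU(1)] above_P[OF w(1)] _ w(2) x] fl_le[OF zU(1)] z(2) by simp
    also have "\<dots> = v w" using vhomD(2)[OF v zZ(1) above_P[OF w(1)] w(2)] wZ by simp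
    finally have "mp F q' w *\<^sub>v (mp F q q' *\<^sub>v x) = mp F q' w *\<^sub>v x'" using vw by simp
    thus ?thesis
      using rep_inj_eq[OF F w(1), of "mp F q q' *\<^sub>v x" x'] w(4) x' rep_vec[OF rF qP qq x] by simp
  qed
  define S0 where "S0 = {q. \<exists>x. N q x}"
  define X where "X q = (SOME x. N q x)" for q
  have NX: "N q (X q)" if "q \<in> S0" for q using that unfolding S0_def X_def by (auto intro: someI)
  have Xc: "X q \<in> carrier_vec (dm F q)" if "q \<in> S0" for q using NX[OF that] by (simp add: N_def)
  have Z0S0: "fl z \<in> S0 \<and> mp F (fl z) z *\<^sub>v X (fl z) = v z" if z: "z \<in> Z0" for z
  proof -
    have zU: "z \<in> above" and zZ: "z \<in> Z" using z Z0U by (auto simp: Z0_def)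
    obtain x where x: "x \<in> carrier_vec (dm F (fl z))" "v z = mp F (fl z) z *\<^sub>v x" using qconstD(4)[OF F zU vc[OF zZ]] by blast
    have n: "N (fl z) x" using x z by (auto simp: N_def)
    hence s: "fl z \<in> S0" by (auto simp: S0_def)
    have "mp F (fl z) (fl z) *\<^sub>v x = X (fl z)" using cmp[OF n NX[OF s]] refl[OF fl_P[OF zU]] by blast
    hence "x = X (fl z)" using rep_id[OF rF fl_P[OF zU] x(1)] by simp
    thus ?thesis using s x(2) by simp
  qed
  have S0ex: "\<exists>z\<in>Z0. fl z = q" if "q \<in> S0" for q using that by (auto simp: S0_def N_def)
  define S where "S = {p \<in> above. fl p \<in> S0}"
  define v' where "v' p = mp F (fl p) p *\<^sub>v X (fl p)" for p
  have v'nz: "v' p \<noteq> 0\<^sub>v (dm F p)" if "p \<in> S" for p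
    using that inj[of p "fl p" "X (fl p)"] Xc N0[OF NX] by (auto simp: S_def v'_def)
  have "convex P lq S"
    unfolding convex_def
  proof (intro conjI ballI impI)
    show "S \<subseteq> P" using above_P by (auto simp: S_def)
    fix s p s' assume s: "s \<in> S" "p \<in> P" "s' \<in> S" and le: "lq s p \<and> lq p s'"
    have sU: "s \<in> above" "s' \<in> above" and s0: "fl s \<in> S0" "fl s' \<in> S0" using s by (auto simp: S_def)
    have pU: "p \<in> above" using above_up[OF sU(1) s(2)] le by blast
    have m: "lq (fl s) (fl p)" "lq (fl p) (fl s')" using fl_mono[OF sU(1) s(2)] fl_mono[OF pU above_P[OF sU(2)]] le by auto
    have m': "lq (fl s) (fl s')" by (rule trans[OF fl_P[OF sU(1)] fl_P[OF pU] fl_P[OF sU(2)] m])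
    \<comment> \<open>The value carried from \<open>fl s\<close> arrives at \<open>fl s'\<close> as
      the nonzero \<open>X (fl s')\<close>, so it cannot have vanished at \<open>fl p\<close> on the
      way; \<open>ext\<close> applies.\<close>
    have "mp F (fl p) (fl s') *\<^sub>v (mp F (fl s) (fl p) *\<^sub>v X (fl s)) = X (fl s')"
      using rep_comp[OF rF fl_P[OF sU(1)] fl_P[OF pU] fl_P[OF sU(2)] m Xc[OF s0(1)]] cmp[OF NX[OF s0(1)] NX[OF s0(2)] m'] by simp
    hence "mp F (fl s) (fl p) *\<^sub>v X (fl s) \<noteq> 0\<^sub>v (dm F (fl p))"
      using N0[OF NX[OF s0(2)]] rep_zero_vec[OF rF fl_P[OF pU] fl_P[OF sU(2)] m(2)] by auto
    hence "fl p \<in> S0" using ext[OF NX[OF s0(1)] fl_Q[OF pU] m(1)] by (auto simp: S0_def)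
    thus "p \<in> S" using pU by (simp add: S_def)
  qed
  moreover have "saturated S"
    unfolding saturated_def S_def using fl_above fl_id[OF fl_Q] by auto
  moreover have "vhom S F v'"
    unfolding vhom_def
  proof (intro conjI ballI impI)
    fix p assume "p \<in> S" thus "v' p \<in> carrier_vec (dm F p)"
      unfolding v'_def S_def using rep_vec[OF rF fl_P above_P fl_le Xc] by blast
  next
    fix p p' assume p: "p \<in> S" and p': "p' \<in> P" "lq p p'"
    have pU: "p \<in> above" and s0: "fl p \<in> S0" using p by (auto simp: S_def)
    have p'U: "p' \<in> above" by (rule above_up[OF pU p'])
    note f = fl_P[OF pU] fl_P[OF p'U]
    have m: "lq (fl p) (fl p')" by (rule fl_mono[OF pU p'])
    have e: "mp F p p' *\<^sub>v v' p = mp F (fl p') p' *\<^sub>v (mp F (fl p) (fl p') *\<^sub>v X (fl p))"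
      unfolding v'_def rep_comp[OF rF f(1) above_P[OF pU] p'(1) fl_le[OF pU] p'(2) Xc[OF s0]]
        rep_comp[OF rF f p'(1) m fl_le[OF p'U] Xc[OF s0]] ..
    show "mp F p p' *\<^sub>v v' p = (if p' \<in> S then v' p' else 0\<^sub>v (dm F p'))"
    proof (cases "p' \<in> S")
      case True
      hence "fl p' \<in> S0" by (simp add: S_def)
      thus ?thesis using True e cmp[OF NX[OF s0] NX m] by (simp add: v'_def)
    next
      case False
      hence "fl p' \<notin> S0" using p'U by (simp add: S_def)
      hence "mp F (fl p) (fl p') *\<^sub>v X (fl p) = 0\<^sub>v (dm F (fl p'))"
        using ext[OF NX[OF s0] fl_Q[OF p'U] m] by (auto simp: S0_def)
      thus ?thesis using False e rep_zero_vec[OF rF f(2) p'(1) fl_le[OF p'U]] by simp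
    qed
  qed
  moreover have ZS: "Z0 \<subseteq> S" using Z0U Z0S0 by (auto simp: S_def)
  moreover have vv: "\<forall>z\<in>Z0. v' z = v z" using Z0S0 by (auto simp: v'_def)
  \<comment> \<open>This closure property and the next make \<open>Z0\<close> the support of a
    morphism from the indicator of \<open>Z\<close> to that of \<open>S\<close>; following it by
    \<open>v'\<close> gives back \<open>v\<close>.\<close>
  moreover have "p \<in> Z0" if z: "z \<in> Z0" and p: "p \<in> S" and le: "lq z p" for z p
  proof -
    have pP: "p \<in> P" using p above_P by (auto simp: S_def)
    have "mp F z p *\<^sub>v v z = v' p" using vhomD(2)[OF \<open>vhom S F v'\<close> _ pP le] z ZS p vv by auto
    thus ?thesis using up[of z p] z pP le v'nz[OF p] by (auto simp: Z0_def)
  qed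
  moreover have "z \<in> Z0" if z: "z \<in> Z" and p: "p \<in> Z0" and le: "lq z p" for z p
  proof (rule ccontr)
    assume "z \<notin> Z0"
    hence z0: "v z = 0\<^sub>v (dm F z)" using z by (simp add: Z0_def)
    have zP: "z \<in> P" "p \<in> P" "p \<in> Z" using z p ZP by (auto simp: Z0_def)
    have "v p = 0\<^sub>v (dm F p)"
      using vhomD(2)[OF v z zP(2) le] zP rep_zero_vec[OF rF zP(1,2) le] unfolding z0 by simp
    thus False using p by (simp add: Z0_def)
  qed
  moreover have "\<forall>p\<in>S. \<exists>z\<in>Z0. fl z = fl p" using S0ex by (auto simp: S_def)
  ultimately show ?thesis by blast
qed

end

section \<open>Saturated spreads and their order\<close>

text \<open>Walk along a zigzag starting at \<open>a\<close>: no step between comparable points of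
  \<open>T\<close> can leave \<open>Z\<close>.\<close>

lemma clopen_all:
  assumes c: "connected_sub P lq T" and Z: "Z \<subseteq> T" "a \<in> Z"
    and d: "\<And>z t. \<lbrakk>z \<in> Z; t \<in> T; lq t z\<rbrakk> \<Longrightarrow> t \<in> Z" and u: "\<And>z t. \<lbrakk>z \<in> Z; t \<in> T; lq z t\<rbrakk> \<Longrightarrow> t \<in> Z"
  shows "Z = T"
proof -
  have "t \<in> Z" if "t \<in> T" for t
  proof -
    let ?R = "\<lambda>a b. a \<in> T \<and> b \<in> T \<and> (lq a b \<or> lq b a)"
    have h: "\<forall>x\<in>T. \<forall>y\<in>T. ?R\<^sup>*\<^sup>* x y" using c unfolding connected_sub_def by (elim conjE)
    have a: "a \<in> T" using Z by blast
    have "?R\<^sup>*\<^sup>* a t" by (rule bspec[OF bspec[OF h a] that])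
    thus ?thesis
    proof (induction rule: rtranclp_induct)
      case base show ?case by (rule Z(2))
    next
      case (step y z)
      from step.hyps(2) have zT: "z \<in> T" and yz: "lq y z \<or> lq z y" by simp_all
      from yz show ?case using d[OF step.IH zT] u[OF step.IH zT] by (elim disjE)
    qed
  qed
  thus ?thesis using Z by blast
qed

context rposet begin

text \<open>A morphism between indicator representations of convex sets is supported on a set Z that is
down-closed in its source T and up-closed in its target S; link a T S says that one can be nonzero at a.\<close>

definition link :: "'p \<Rightarrow> 'p set \<Rightarrow> 'p set \<Rightarrow> bool" where
  "link a T S \<longleftrightarrow> (\<exists>Z. Z \<subseteq> T \<inter> S \<and> a \<in> Z \<and> (\<forall>z\<in>Z. \<forall>t\<in>T. lq t z \<longrightarrow> t \<in> Z) \<and> (\<forall>z\<in>Z. \<forall>s\<in>S. lq z s \<longrightarrow> s \<in> Z))"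

lemma link_refl: "a \<in> T \<Longrightarrow> link a T T"
  unfolding link_def by (intro exI[of _ T]) auto

text \<open>The supports are intersected, as in a composite of morphisms between indicators.\<close>

lemma link_trans:
  assumes "link a T S" "link a S R" shows "link a T R"
proof -
  obtain Z where Z: "Z \<subseteq> T \<inter> S" "a \<in> Z" "\<forall>z\<in>Z. \<forall>t\<in>T. lq t z \<longrightarrow> t \<in> Z" "\<forall>z\<in>Z. \<forall>s\<in>S. lq z s \<longrightarrow> s \<in> Z"
    using assms(1) unfolding link_def by (elim exE conjE)
  obtain W where W: "W \<subseteq> S \<inter> R" "a \<in> W" "\<forall>z\<in>W. \<forall>t\<in>S. lq t z \<longrightarrow> t \<in> W" "\<forall>z\<in>W. \<forall>s\<in>R. lq z s \<longrightarrow> s \<in> W"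
    using assms(2) unfolding link_def by (elim exE conjE)
  show ?thesis unfolding link_def
  proof (rule exI[of _ "Z \<inter> W"], intro conjI ballI impI)
    show "Z \<inter> W \<subseteq> T \<inter> R" "a \<in> Z \<inter> W" using Z(1,2) W(1,2) by auto
  next
    fix z t assume z: "z \<in> Z \<inter> W" and t: "t \<in> T" "lq t z"
    have "t \<in> Z" using Z(3)[rule_format, of z t] z t by simp
    thus "t \<in> Z \<inter> W" using Z(1) W(3)[rule_format, of z t] z t by auto
  next
    fix z t assume z: "z \<in> Z \<inter> W" and t: "t \<in> R" "lq z t"
    have "t \<in> W" using W(4)[rule_format, of z t] z t by simp
    thus "t \<in> Z \<inter> W" using W(1) Z(4)[rule_format, of z t] z t by auto
  qed
qed

text \<open>The intersection of the two supports is closed under comparability in \<open>T\<close>,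
  so by connectedness it is all of \<open>T\<close>, and it is contained in
  \<open>S\<close>.\<close>

lemma link_antisym_subset:
  assumes c: "connected_sub P lq T" and "link a T S" "link a S T" shows "T \<subseteq> S"
proof -
  obtain Z where Z: "Z \<subseteq> T \<inter> S" "a \<in> Z" "\<forall>z\<in>Z. \<forall>t\<in>T. lq t z \<longrightarrow> t \<in> Z" "\<forall>z\<in>Z. \<forall>s\<in>S. lq z s \<longrightarrow> s \<in> Z"
    using assms(2) unfolding link_def by (elim exE conjE)
  obtain W where W: "W \<subseteq> S \<inter> T" "a \<in> W" "\<forall>z\<in>W. \<forall>t\<in>S. lq t z \<longrightarrow> t \<in> W" "\<forall>z\<in>W. \<forall>s\<in>T. lq z s \<longrightarrow> s \<in> W"
    using assms(3) unfolding link_def by (elim exE conjE)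
  have "Z \<inter> W = T"
  proof (rule clopen_all[OF c])
    show "Z \<inter> W \<subseteq> T" "a \<in> Z \<inter> W" using Z(1,2) W(1,2) by auto
  next
    fix z t assume z: "z \<in> Z \<inter> W" and t: "t \<in> T" "lq t z"
    have "t \<in> Z" using Z(3)[rule_format, of z t] z t by simp
    thus "t \<in> Z \<inter> W" using Z(1) W(3)[rule_format, of z t] z t by auto
  next
    fix z t assume z: "z \<in> Z \<inter> W" and t: "t \<in> T" "lq z t"
    have "t \<in> W" using W(4)[rule_format, of z t] z t by simp
    thus "t \<in> Z \<inter> W" using W(1) Z(4)[rule_format, of z t] z t by auto
  qed
  thus ?thesis using Z(1) by blast
qed

lemma link_antisym:
  assumes "connected_sub P lq T" "connected_sub P lq S" "link a T S" "link a S T" shows "T = S"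
  by (rule equalityI[OF link_antisym_subset[OF assms(1,3,4)] link_antisym_subset[OF assms(2,4,3)]])

text \<open>The support of the family is the required set: closed downwards in \<open>T\<close>
  because zero stays zero under transport, closed upwards in \<open>S\<close> because the target has
  identity maps there.\<close>

lemma link_of_vhom:
  fixes w :: "'p \<Rightarrow> 'k::field vec"
  assumes S: "convex P lq S" and T: "T \<subseteq> P" and w: "vhom T (pow_ind S d) w" and a: "a \<in> T"
    and nz: "w a \<noteq> 0\<^sub>v (dm (pow_ind S d :: ('p, 'k) prep) a)"
  shows "link a T S"
proof -
  let ?J = "pow_ind S d :: ('p, 'k) prep"
  let ?Z = "{z \<in> T. w z \<noteq> 0\<^sub>v (dm ?J z)}"
  have SP: "S \<subseteq> P" using S by (simp add: convex_def)
  have ZS: "z \<in> S" if z: "z \<in> ?Z" for z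
  proof (rule ccontr)
    assume "z \<notin> S"
    hence d0: "dm ?J z = 0" by (simp add: dm_pow_ind)
    have "w z \<in> carrier_vec (dm ?J z)" using vhomD(1)[OF w] z by blast
    hence "w z = 0\<^sub>v (dm ?J z)" unfolding d0 by (rule carrier_vec0)
    thus False using z by blast
  qed
  show ?thesis unfolding link_def
  proof (rule exI[of _ ?Z], intro conjI ballI impI)
    show "?Z \<subseteq> T \<inter> S" using ZS by blast
    show "a \<in> ?Z" using a nz by simp
  next
    fix z t assume z: "z \<in> ?Z" and t: "t \<in> T" "lq t z"
    have zP: "z \<in> P" "t \<in> P" using z t T by auto
    have e: "mp ?J t z *\<^sub>v w t = w z" using vhomD(2)[OF w t(1) zP(1) t(2)] z by simp
    have "w t \<noteq> 0\<^sub>v (dm ?J t)"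
    proof
      assume wt: "w t = 0\<^sub>v (dm ?J t)"
      have "w z = 0\<^sub>v (dm ?J z)" unfolding e[symmetric] wt by (rule rep_zero_vec[OF rep_pow_ind[OF S] zP(2,1) t(2)])
      thus False using z by blast
    qed
    thus "t \<in> ?Z" using t(1) by blast
  next
    fix z s assume z: "z \<in> ?Z" and s: "s \<in> S" "lq z s"
    have zS: "z \<in> S" and sP: "s \<in> P" and zT: "z \<in> T" using ZS[OF z] s SP z by auto
    have wz: "w z \<in> carrier_vec d" using vhomD(1)[OF w zT] zS by (simp add: dm_pow_ind)
    have "mp ?J z s = 1\<^sub>m d" using zS s by (simp add: pow_ind_def)
    hence e: "w z = (if s \<in> T then w s else 0\<^sub>v (dm ?J s))" using vhomD(2)[OF w zT sP s(2)] wz by simp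
    have dd: "dm ?J s = dm ?J z" using zS s by (simp add: dm_pow_ind)
    show "s \<in> ?Z" using e z dd by (auto split: if_splits)
  qed
qed

section \<open>Linear operations on value families and their liftings\<close>

lemma vhom_add:
  assumes Z: "Z \<subseteq> P" and F: "rep F" and v: "vhom Z F v" and w: "vhom Z F w"
  shows "vhom Z F (\<lambda>z. v z + w z)"
  unfolding vhom_def
proof (intro conjI ballI impI)
  fix z assume "z \<in> Z" thus "v z + w z \<in> carrier_vec (dm F z)" using vhomD(1)[OF v] vhomD(1)[OF w] by simp
next
  fix z p assume z: "z \<in> Z" and p: "p \<in> P" "lq z p"
  have zP: "z \<in> P" using z Z by auto
  have "mp F z p *\<^sub>v (v z + w z) = mp F z p *\<^sub>v v z + mp F z p *\<^sub>v w z"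
    by (rule mult_add_distrib_mat_vec[OF rep_mat[OF F zP p] vhomD(1)[OF v z] vhomD(1)[OF w z]])
  thus "mp F z p *\<^sub>v (v z + w z) = (if p \<in> Z then v p + w p else 0\<^sub>v (dm F p))"
    using vhomD(2)[OF v z p] vhomD(2)[OF w z p] by simp
qed

lemma vhom_smult:
  assumes Z: "Z \<subseteq> P" and F: "rep F" and v: "vhom Z F v"
  shows "vhom Z F (\<lambda>z. c \<cdot>\<^sub>v v z)"
  unfolding vhom_def
proof (intro conjI ballI impI)
  fix z assume "z \<in> Z" thus "c \<cdot>\<^sub>v v z \<in> carrier_vec (dm F z)" using vhomD(1)[OF v] by simp
next
  fix z p assume z: "z \<in> Z" and p: "p \<in> P" "lq z p"
  have zP: "z \<in> P" using z Z by auto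
  have "mp F z p *\<^sub>v (c \<cdot>\<^sub>v v z) = c \<cdot>\<^sub>v (mp F z p *\<^sub>v v z)"
    by (rule mult_mat_vec[OF rep_mat[OF F zP p] vhomD(1)[OF v z]])
  thus "mp F z p *\<^sub>v (c \<cdot>\<^sub>v v z) = (if p \<in> Z then c \<cdot>\<^sub>v v p else 0\<^sub>v (dm F p))"
    using vhomD(2)[OF v z p] by (cases "p \<in> Z") auto
qed

lemma vhom_zero:
  assumes Z: "Z \<subseteq> P" and F: "rep F" shows "vhom Z F (\<lambda>z. 0\<^sub>v (dm F z))"
proof -
  have "mp F z p *\<^sub>v 0\<^sub>v (dm F z) = 0\<^sub>v (dm F p)" if "z \<in> Z" "p \<in> P" "lq z p" for z p
    using rep_zero_vec[OF F] that Z by auto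
  thus ?thesis unfolding vhom_def by auto
qed

text \<open>Precomposition with the morphism from the indicator of \<open>Z\<close> to that of
  \<open>S\<close> which is the identity on \<open>Z0\<close> and zero elsewhere. The two closure
  hypotheses say that this is a morphism.\<close>

lemma vhom_pull:
  assumes v: "vhom S F v" and Z: "Z \<subseteq> P" and F: "rep F" and Z0: "Z0 \<subseteq> Z \<inter> S"
    and u: "\<forall>z\<in>Z0. \<forall>p\<in>S. lq z p \<longrightarrow> p \<in> Z0" and d: "\<forall>z\<in>Z. \<forall>p\<in>Z0. lq z p \<longrightarrow> z \<in> Z0"
  shows "vhom Z F (\<lambda>z. if z \<in> Z0 then v z else 0\<^sub>v (dm F z))"
  unfolding vhom_def
proof (intro conjI ballI impI)
  fix z assume "z \<in> Z" thus "(if z \<in> Z0 then v z else 0\<^sub>v (dm F z)) \<in> carrier_vec (dm F z)"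
    using vhomD(1)[OF v] Z0 by auto
next
  fix z p assume z: "z \<in> Z" and p: "p \<in> P" "lq z p"
  have zP: "z \<in> P" using z Z by auto
  show "mp F z p *\<^sub>v (if z \<in> Z0 then v z else 0\<^sub>v (dm F z)) =
    (if p \<in> Z then if p \<in> Z0 then v p else 0\<^sub>v (dm F p) else 0\<^sub>v (dm F p))"
  proof (cases "z \<in> Z0")
    case True
    have zS: "z \<in> S" using True Z0 by auto
    have "p \<in> S \<longleftrightarrow> p \<in> Z0" using True u p Z0 by auto
    thus ?thesis using True vhomD(2)[OF v zS p] Z0 by auto
  next
    case False
    hence "p \<notin> Z0" using d z p by auto
    thus ?thesis using False rep_zero_vec[OF F zP p] by auto
  qed
qed

text \<open>Lifting of a single family before it is packed into a morphism. At this level families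
  can be added and cut down to parts of their domain.\<close>

definition vlift where
  "vlift C g Z v \<longleftrightarrow> (\<exists>w. vhom Z C w \<and> (\<forall>z\<in>Z. g z *\<^sub>v w z = v z))"

lemma vlift_cong: "vlift C g Z v \<Longrightarrow> (\<And>z. z \<in> Z \<Longrightarrow> v' z = v z) \<Longrightarrow> vlift C g Z v'"
  unfolding vlift_def by auto

lemma vlift_add:
  assumes Z: "Z \<subseteq> P" and C: "rep C" and g: "rhom C F g" and v: "vlift C g Z v" and w: "vlift C g Z w"
  shows "vlift C g Z (\<lambda>z. v z + w z)"
proof -
  obtain v' w' where v': "vhom Z C v'" "\<And>z. z \<in> Z \<Longrightarrow> g z *\<^sub>v v' z = v z"
    and w': "vhom Z C w'" "\<And>z. z \<in> Z \<Longrightarrow> g z *\<^sub>v w' z = w z"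
    using v w unfolding vlift_def by blast
  have "g z *\<^sub>v (v' z + w' z) = v z + w z" if z: "z \<in> Z" for z
  proof -
    have zP: "z \<in> P" using z Z by auto
    show ?thesis
      unfolding mult_add_distrib_mat_vec[OF hom_mat[OF g zP] vhomD(1)[OF v'(1) z] vhomD(1)[OF w'(1) z]]
      using v'(2)[OF z] w'(2)[OF z] by simp
  qed
  thus ?thesis unfolding vlift_def using vhom_add[OF Z C v'(1) w'(1)] by blast
qed

lemma vlift_pull:
  assumes l: "vlift C g S v" and Z: "Z \<subseteq> P" and C: "rep C" and g: "rhom C F g" and Z0: "Z0 \<subseteq> Z \<inter> S"
    and u: "\<forall>z\<in>Z0. \<forall>p\<in>S. lq z p \<longrightarrow> p \<in> Z0" and d: "\<forall>z\<in>Z. \<forall>p\<in>Z0. lq z p \<longrightarrow> z \<in> Z0"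
  shows "vlift C g Z (\<lambda>z. if z \<in> Z0 then v z else 0\<^sub>v (dm F z))"
proof -
  obtain w where w: "vhom S C w" "\<forall>z\<in>S. g z *\<^sub>v w z = v z" using l unfolding vlift_def by blast
  have "g z *\<^sub>v (if z \<in> Z0 then w z else 0\<^sub>v (dm C z)) = (if z \<in> Z0 then v z else 0\<^sub>v (dm F z))" if "z \<in> Z" for z
    using w(2) Z0 hom_zero_vec[OF g, of z] that Z by auto
  thus ?thesis unfolding vlift_def using vhom_pull[OF w(1) Z C Z0 u d] by blast
qed

text \<open>A morphism out of an indicator is determined by its values on the single basis vector
  over \<open>S\<close>, so it is enough to lift that family.\<close>

lemma vlift_lifts:
  fixes C :: "('p, 'k::field) prep"
  assumes S: "convex P lq S" and C: "rep C" and F: "rep F" and g: "rhom C F g"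
    and l: "\<And>v. vhom S F v \<Longrightarrow> vlift C g S v"
  shows "lifts (indicator_rep S) C g F"
  unfolding lifts_def
proof (intro allI impI)
  let ?I = "indicator_rep S :: ('p, 'k) prep"
  fix h assume h: "rhom ?I F h"
  have I: "rep ?I" by (rule rep_indicator[OF S])
  have "vhom S F (\<lambda>p. h p *\<^sub>v unit_vec 1 0)"
    by (rule vhom_of_hom[OF S F, of 1]) (use h in \<open>auto simp: pow_ind_1\<close>)
  then obtain w where w: "vhom S C w" "\<forall>z\<in>S. g z *\<^sub>v w z = h z *\<^sub>v unit_vec 1 0"
    using l unfolding vlift_def by blast
  obtain k where k: "rhom ?I C k" "\<forall>j<1. \<forall>p\<in>S. k p *\<^sub>v unit_vec 1 j = w p"
    using hom_of_vhoms[OF S C, of 1 "\<lambda>_. w"] w(1) unfolding pow_ind_1 by blast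
  note gk = hom_comp[OF I C F k(1) g]
  have "h p *\<^sub>v v = g p *\<^sub>v (k p *\<^sub>v v)" if p: "p \<in> P" and v: "v \<in> carrier_vec (dm ?I p)" for p v
  proof -
    have "h p = g p * k p"
    proof (rule mat_eqI_unit[OF hom_mat[OF h p] hom_mat[OF gk p]])
      fix j assume j: "j < dm ?I p"
      hence pS: "p \<in> S" "j = 0" "dm ?I p = 1" by (auto simp: indicator_rep_def split: if_splits)
      have uc: "(unit_vec 1 0 :: 'k vec) \<in> carrier_vec (dm ?I p)" using pS by simp
      show "h p *\<^sub>v unit_vec (dm ?I p) j = (g p * k p) *\<^sub>v unit_vec (dm ?I p) j"
        unfolding pS(2,3) hom_comp_vec[OF k(1) g p uc] using w(2) k(2) pS by auto
    qed
    thus ?thesis using hom_comp_vec[OF k(1) g p v] by simp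
  qed
  thus "\<exists>k. rhom ?I C k \<and> (\<forall>p\<in>P. \<forall>v\<in>carrier_vec (dm ?I p). h p *\<^sub>v v = g p *\<^sub>v (k p *\<^sub>v v))"
    using k(1) by blast
qed

end

context qposet begin

section \<open>The finite set of saturated spreads and its strict order\<close>

definition spreads where "spreads = {S. spread P lq S \<and> saturated S}"

lemma spreadsD: "S \<in> spreads \<Longrightarrow> convex P lq S" "S \<in> spreads \<Longrightarrow> connected_sub P lq S" "S \<in> spreads \<Longrightarrow> saturated S" "S \<in> spreads \<Longrightarrow> S \<subseteq> P"
  unfolding spreads_def spread_def connected_sub_def by blast+

lemma saturated_iff: "saturated S \<Longrightarrow> p \<in> above \<Longrightarrow> p \<in> S \<longleftrightarrow> fl p \<in> S" and saturated_above: "saturated S \<Longrightarrow> S \<subseteq> above"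
  unfolding saturated_def by blast+

lemma saturated_eq:
  assumes "saturated S" shows "S = {p \<in> above. fl p \<in> S \<inter> Q}"
  using saturated_iff[OF assms] saturated_above[OF assms] fl_Q by blast

text \<open>A saturated set is the floor preimage of its trace on \<open>Q\<close>.\<close>

lemma finite_spreads: "finite spreads"
proof (rule finite_subset)
  show "spreads \<subseteq> (\<lambda>A. {p \<in> above. fl p \<in> A}) ` Pow Q"
  proof
    fix S assume "S \<in> spreads"
    thus "S \<in> (\<lambda>A. {p \<in> above. fl p \<in> A}) ` Pow Q"
      by (intro image_eqI[where f = "\<lambda>A. {p \<in> above. fl p \<in> A}", of _ "S \<inter> Q"] saturated_eq[OF spreadsD(3)]) simp_all
  qed
  show "finite ((\<lambda>A. {p \<in> above. fl p \<in> A}) ` Pow Q)" using finQ by simp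
qed

lemma linear_ext:
  "\<exists>e :: 'p \<Rightarrow> nat. inj_on e Q \<and> (\<forall>q\<in>Q. \<forall>q'\<in>Q. lq q q' \<and> q \<noteq> q' \<longrightarrow> e q < e q')"
proof -
  obtain f :: "'p \<Rightarrow> nat" and n where f: "f ` Q = {i. i < n}" "inj_on f Q"
    using finite_imp_inj_to_nat_seg[OF finQ] by blast
  have fn: "f q < n" if "q \<in> Q" for q using f that by blast
  define c where "c q = card {q' \<in> Q. lq q' q}" for q
  have c: "c q < c q'" if q: "q \<in> Q" "q' \<in> Q" "lq q q'" "q \<noteq> q'" for q q'
    unfolding c_def
  proof (rule psubset_card_mono)
    show "finite {x \<in> Q. lq x q'}" using finQ by simp
    have "q' \<notin> {x \<in> Q. lq x q}" using antisym[of q q'] q QP by auto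
    moreover have "q' \<in> {x \<in> Q. lq x q'}" using q QP refl by auto
    moreover have "{x \<in> Q. lq x q} \<subseteq> {x \<in> Q. lq x q'}" using trans[of _ q q'] q QP by auto
    ultimately show "{x \<in> Q. lq x q} \<subset> {x \<in> Q. lq x q'}" by blast
  qed
  \<comment> \<open>The main key \<open>c\<close> counts the elements of \<open>Q\<close> below;
    \<open>f\<close> numbers \<open>Q\<close> by values below \<open>n\<close> and breaks
    ties.\<close>
  let ?e = "\<lambda>q. c q * n + f q"
  have mono: "?e q < ?e q'" if "q \<in> Q" "q' \<in> Q" "c q < c q'" for q q'
  proof -
    have "c q * n + f q < Suc (c q) * n" using fn[OF that(1)] by simp
    also have "\<dots> \<le> c q' * n" using that(3) by (intro mult_le_mono1) simp
    finally show ?thesis by simp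
  qed
  have "inj_on ?e Q"
  proof (rule inj_onI)
    fix q q' assume q: "q \<in> Q" "q' \<in> Q" "?e q = ?e q'"
    have "c q = c q'" using mono[OF q(1,2)] mono[OF q(2,1)] q(3) by linarith
    thus "q = q'" using q f(2) by (simp add: inj_on_def)
  qed
  thus ?thesis using c mono by (intro exI[of _ ?e]) blast
qed

definition rank :: "'p \<Rightarrow> nat" where
  "rank = (SOME e. inj_on e Q \<and> (\<forall>q\<in>Q. \<forall>q'\<in>Q. lq q q' \<and> q \<noteq> q' \<longrightarrow> e q < e q'))"

lemma rank_inj: "\<lbrakk>q \<in> Q; q' \<in> Q; rank q = rank q'\<rbrakk> \<Longrightarrow> q = q'"
  and rank_mono: "\<lbrakk>q \<in> Q; q' \<in> Q; lq q q'; q \<noteq> q'\<rbrakk> \<Longrightarrow> rank q < rank q'"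
proof -
  have "inj_on rank Q \<and> (\<forall>q\<in>Q. \<forall>q'\<in>Q. lq q q' \<and> q \<noteq> q' \<longrightarrow> rank q < rank q')"
    unfolding rank_def by (rule someI_ex[OF linear_ext])
  thus "\<lbrakk>q \<in> Q; q' \<in> Q; rank q = rank q'\<rbrakk> \<Longrightarrow> q = q'" "\<lbrakk>q \<in> Q; q' \<in> Q; lq q q'; q \<noteq> q'\<rbrakk> \<Longrightarrow> rank q < rank q'"
    by (auto simp: inj_on_def)
qed

definition first :: "'p set \<Rightarrow> 'p" where "first S = arg_min rank (\<lambda>q. q \<in> S \<inter> Q)"

lemma first_in: "S \<in> spreads \<Longrightarrow> first S \<in> S \<inter> Q"
proof -
  assume S: "S \<in> spreads"
  have "S \<noteq> {}" using spreadsD(2)[OF S] by (simp add: connected_sub_def)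
  then obtain p where p: "p \<in> S" by blast
  hence "fl p \<in> S \<inter> Q" using saturated_iff[OF spreadsD(3)[OF S]] saturated_above[OF spreadsD(3)[OF S]] fl_Q by blast
  thus ?thesis unfolding first_def by (rule arg_min_natI)
qed

lemma first_le: "q \<in> S \<inter> Q \<Longrightarrow> rank (first S) \<le> rank q"
  unfolding first_def by (rule arg_min_nat_le)

lemma first_P: "S \<in> spreads \<Longrightarrow> first S \<in> P" using first_in QP by blast

lemma upq_spreads: "q \<in> Q \<Longrightarrow> upq q \<in> spreads"
  using up_spread up_saturated QP by (auto simp: spreads_def)

text \<open>\<open>rank\<close> refines the order, so the least element of an up-set comes first.
  Hence vectors at a given \<open>q\<close> are detected by the spread \<open>upq q\<close>.\<close>

lemma first_upq: "q \<in> Q \<Longrightarrow> first (upq q) = q"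
proof (rule ccontr)
  assume q: "q \<in> Q" and n: "first (upq q) \<noteq> q"
  have f: "first (upq q) \<in> upq q \<inter> Q" by (rule first_in[OF upq_spreads[OF q]])
  hence "rank q < rank (first (upq q))" using rank_mono[OF q, of "first (upq q)"] n by (auto simp: up_def)
  moreover have "rank (first (upq q)) \<le> rank q" using q QP refl by (intro first_le) (auto simp: up_def)
  ultimately show False by simp
qed

definition prec where "prec T S \<longleftrightarrow> rank (first S) < rank (first T) \<or> (first S = first T \<and> T \<noteq> S \<and> link (first T) T S)"

text \<open>The delicate case has three equal first points: \<open>R = T\<close> would give links
  both ways between \<open>T\<close> and \<open>S\<close> and thus \<open>T = S\<close>.\<close>

lemma prec_trans:
  assumes T: "T \<in> spreads" and S: "S \<in> spreads" and l: "prec T S" "prec S R" shows "prec T R"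
proof (cases "first S = first T \<and> first R = first S")
  case True
  hence l': "T \<noteq> S" "link (first T) T S" "link (first T) S R" using l unfolding prec_def by auto
  have "T \<noteq> R" using link_antisym[OF spreadsD(2)[OF T] spreadsD(2)[OF S] l'(2)] l' by auto
  thus ?thesis using True link_trans[OF l'(2,3)] unfolding prec_def by auto
next
  case False
  thus ?thesis using l unfolding prec_def by auto
qed

lemma prec_irrefl: "\<not> prec T T" by (simp add: prec_def)

text \<open>Counting predecessors instead of measuring chains: transitivity and irreflexivity make
  the count strictly increase along \<open>prec\<close>.\<close>

definition height where "height S = card {T \<in> spreads. prec T S}"

lemma prec_height: "\<lbrakk>T \<in> spreads; S \<in> spreads; prec T S\<rbrakk> \<Longrightarrow> height T < height S"
  unfolding height_def
proof (rule psubset_card_mono)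
  show "finite {R \<in> spreads. prec R S}" using finite_spreads by simp
  assume h: "T \<in> spreads" "S \<in> spreads" "prec T S"
  have "{R \<in> spreads. prec R T} \<subseteq> {R \<in> spreads. prec R S}" using prec_trans[OF _ h(1) _ h(3)] by blast
  moreover have "T \<in> {R \<in> spreads. prec R S}" "T \<notin> {R \<in> spreads. prec R T}" using h prec_irrefl by auto
  ultimately show "{R \<in> spreads. prec R T} \<subset> {R \<in> spreads. prec R S}" by blast
qed

text \<open>Only the value at the first point is tested, because that is what the generators of an
  approximation control. By \<open>occurs_none\<close> this still suffices to detect a nonzero
  \<open>F\<close>.\<close>

definition occurs :: "('p, 'k::field) prep \<Rightarrow> 'p set \<Rightarrow> bool" where
  "occurs F T \<longleftrightarrow> (\<exists>v. vhom T F v \<and> v (first T) \<noteq> 0\<^sub>v (dm F (first T)))"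

text \<open>H is the evaluation from d copies of the indicator of T, where d is the dimension of the space of
values at first T of morphisms to F.  Its matrix at first T is injective with left inverse L.\<close>

lemma spread_gen:
  fixes F :: "('p, 'k::field) prep"
  assumes F: "rep F" and T: "T \<in> spreads"
  shows "\<exists>d H L. rhom (pow_ind T d) F H \<and> L \<in> carrier_mat d (dm F (first T)) \<and>
     (\<forall>c\<in>carrier_vec d. L *\<^sub>v (H (first T) *\<^sub>v c) = c) \<and>
     (\<forall>v. vhom T F v \<longrightarrow> H (first T) *\<^sub>v (L *\<^sub>v v (first T)) = v (first T))"
proof -
  let ?a = "first T"
  have a: "?a \<in> T" "?a \<in> P" using first_in[OF T] first_P[OF T] by auto
  note c = spreadsD(1)[OF T] and TP = spreadsD(4)[OF T]
  define G where "G = {x. \<exists>v. vhom T F v \<and> x = v ?a}"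
  have "\<exists>d B L. B \<in> carrier_mat (dm F ?a) d \<and> L \<in> carrier_mat d (dm F ?a) \<and> L * B = 1\<^sub>m d \<and>
    (\<forall>v\<in>carrier_vec (dm F ?a). v \<in> G \<longleftrightarrow> B *\<^sub>v (L *\<^sub>v v) = v) \<and> d \<le> dm F ?a \<and> (d = dm F ?a \<longrightarrow> G = carrier_vec (dm F ?a))"
  proof (rule subspace_basis)
    show "G \<subseteq> carrier_vec (dm F ?a)" using vhomD(1) a(1) by (auto simp: G_def)
    show "0\<^sub>v (dm F ?a) \<in> G" using vhom_zero[OF TP F] by (auto simp: G_def)
    show "u + v \<in> G" if uv: "u \<in> G" "v \<in> G" for u v
    proof -
      obtain u' v' where "vhom T F u'" "u = u' ?a" "vhom T F v'" "v = v' ?a" using uv by (auto simp: G_def)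
      thus ?thesis using vhom_add[OF TP F, of u' v'] by (auto simp: G_def)
    qed
    show "k \<cdot>\<^sub>v v \<in> G" if vG: "v \<in> G" for k v
    proof -
      obtain v' where "vhom T F v'" "v = v' ?a" using vG by (auto simp: G_def)
      thus ?thesis using vhom_smult[OF TP F, of v' k] by (auto simp: G_def)
    qed
  qed
  then obtain d B L where B: "B \<in> carrier_mat (dm F ?a) d" and L: "L \<in> carrier_mat d (dm F ?a)" and LB: "L * B = 1\<^sub>m d"
    and BL: "\<forall>v\<in>carrier_vec (dm F ?a). v \<in> G \<longleftrightarrow> B *\<^sub>v (L *\<^sub>v v) = v" by (elim exE conjE)
  have LBv: "L *\<^sub>v (B *\<^sub>v x) = x" if x: "x \<in> carrier_vec d" for x
    using assoc_mult_mat_vec[OF L B x] LB one_mult_mat_vec[OF x] by simp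
  have "\<exists>v. vhom T F v \<and> B *\<^sub>v unit_vec d j = v ?a" for j
  proof -
    have u: "(unit_vec d j :: 'k vec) \<in> carrier_vec d" by simp
    have "B *\<^sub>v unit_vec d j \<in> G" using BL mult_mat_vec_carrier[OF B u] LBv[OF u] by simp
    thus ?thesis by (simp add: G_def)
  qed
  hence "\<exists>v. \<forall>j. vhom T F (v j) \<and> B *\<^sub>v unit_vec d j = v j ?a" by (intro choice) simp
  then obtain v where v: "\<And>j. vhom T F (v j)" "\<And>j. B *\<^sub>v unit_vec d j = v j ?a" by blast
  have "\<exists>H. rhom (pow_ind T d) F H \<and> (\<forall>j<d. \<forall>p\<in>T. H p *\<^sub>v unit_vec d j = v j p)"
    by (rule hom_of_vhoms[OF c F]) (rule v(1))
  then obtain H where H: "rhom (pow_ind T d) F H" "\<forall>j<d. \<forall>p\<in>T. H p *\<^sub>v unit_vec d j = v j p" by (elim exE conjE)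
  have "H ?a = B"
  proof (rule mat_eqI_unit[OF _ B])
    show "H ?a \<in> carrier_mat (dm F ?a) d" using hom_mat[OF H(1) a(2)] a(1) by (simp add: dm_pow_ind)
    fix j assume "j < d" thus "H ?a *\<^sub>v unit_vec d j = B *\<^sub>v unit_vec d j" using H(2) a(1) v(2) by simp
  qed
  moreover have "B *\<^sub>v (L *\<^sub>v v (first T)) = v (first T)" if "vhom T F v" for v
    using BL vhomD(1)[OF that a(1)] that by (auto simp: G_def)
  ultimately show ?thesis using H(1) L LBv
    by (intro exI[of _ d] exI[of _ H] exI[of _ L]) simp
qed

section \<open>Spread approximations\<close>

text \<open>Comparable points are never separated, and a point is comparable to its floor. So
  convexity, saturation and the family are all inherited.\<close>

lemma split_part:
  assumes S: "convex P lq S" "saturated S" and v: "vhom S F v" and A: "A \<subseteq> S"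
    and cl: "\<And>s t. \<lbrakk>s \<in> S; t \<in> A; lq s t \<or> lq t s\<rbrakk> \<Longrightarrow> s \<in> A"
  shows "convex P lq A" "saturated A" "vhom A F v"
proof -
  have SP: "S \<subseteq> P" and SU: "S \<subseteq> above" using S(1) saturated_above[OF S(2)] by (auto simp: convex_def)
  show "convex P lq A" unfolding convex_def
  proof (intro conjI ballI impI)
    show "A \<subseteq> P" using A SP by blast
    fix s p s' assume h: "s \<in> A" "p \<in> P" "s' \<in> A" "lq s p \<and> lq p s'"
    have "s \<in> S" "s' \<in> S" using h A by auto
    hence "p \<in> S" using S(1) h(2,4) unfolding convex_def by blast
    thus "p \<in> A" using cl[OF _ h(1), of p] h(4) by simp
  qed
  show "saturated A" unfolding saturated_def
  proof (intro conjI ballI)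
    show "A \<subseteq> above" using A SU by blast
    fix p assume p: "p \<in> above"
    show "p \<in> A \<longleftrightarrow> fl p \<in> A"
    proof
      assume pA: "p \<in> A"
      hence "fl p \<in> S" using saturated_iff[OF S(2) p] A by blast
      thus "fl p \<in> A" using cl[OF _ pA] fl_le[OF p] by simp
    next
      assume pA: "fl p \<in> A"
      hence "p \<in> S" using saturated_iff[OF S(2) p] A by blast
      thus "p \<in> A" using cl[OF _ pA] fl_le[OF p] by simp
    qed
  qed
  show "vhom A F v" unfolding vhom_def
  proof (intro conjI ballI impI)
    fix z assume "z \<in> A" thus "v z \<in> carrier_vec (dm F z)" using vhomD(1)[OF v] A by blast
  next
    fix z p assume z: "z \<in> A" and p: "p \<in> P" "lq z p"
    have zS: "z \<in> S" using z A by blast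
    have "p \<in> S \<longleftrightarrow> p \<in> A" using cl[OF _ z, of p] p(2) A by blast
    thus "mp F z p *\<^sub>v v z = (if p \<in> A then v p else 0\<^sub>v (dm F p))" using vhomD(2)[OF v zS p] by simp
  qed
qed

text \<open>Induction on the number of points of Q in S.  A disconnected S splits into two clopen pieces; on a
spread, subtracting a multiple of the top generators kills the value at first S and shrinks the support.\<close>

lemma vlift_all:
  fixes F :: "('p, 'k::field) prep"
  assumes F: "qconst F" and C: "rep C" and g: "rhom C F g"
    and top: "\<And>T v. T \<in> spreads \<Longrightarrow> vhom T F v \<Longrightarrow>
       \<exists>v1. vlift C g T v1 \<and> vhom T F v1 \<and> v1 (first T) = v (first T)"
  shows "\<lbrakk>convex P lq S; saturated S; vhom S F v\<rbrakk> \<Longrightarrow> vlift C g S v"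
proof (induction "card (S \<inter> Q)" arbitrary: S v rule: less_induct)
  case less
  note rF = qconstD(1)[OF F]
  have SP: "S \<subseteq> P" and SU: "S \<subseteq> above" using less.prems(1) saturated_above[OF less.prems(2)] by (auto simp: convex_def)
  have fin: "finite (S \<inter> Q)" using finQ by simp
  consider (e) "S = {}" | (c) "connected_sub P lq S" | (d) "S \<noteq> {}" "\<not> connected_sub P lq S" by blast
  thus ?case
  proof cases
    case e
    thus ?thesis unfolding vlift_def vhom_def by simp
  next
    case c
    have T: "S \<in> spreads" using c less.prems(1,2) by (simp add: spreads_def spread_def)
    let ?a = "first S"
    have a: "?a \<in> S" "?a \<in> Q" using first_in[OF T] by auto
    have aP: "?a \<in> P" using a SP by auto
    obtain v1 where v1: "vlift C g S v1" "vhom S F v1" "v1 ?a = v ?a" using top[OF T less.prems(3)] by blast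
    \<comment> \<open>\<open>v1\<close> lifts and agrees with \<open>v\<close> at the first point,
      so the remainder vanishes there.\<close>
    define w where "w z = v z + (- 1) \<cdot>\<^sub>v v1 z" for z
    have w: "vhom S F w" unfolding w_def by (rule vhom_add[OF SP rF less.prems(3) vhom_smult[OF SP rF v1(2)]])
    have wa: "w ?a = 0\<^sub>v (dm F ?a)" unfolding w_def v1(3) using vhomD(1)[OF less.prems(3) a(1)] by (intro eq_vecI) auto
    let ?Z = "{z \<in> S. w z \<noteq> 0\<^sub>v (dm F z)}"
    obtain S' v' where S': "convex P lq S'" "saturated S'" "vhom S' F v'" and ZS': "?Z \<subseteq> S'" and vv: "\<forall>z\<in>?Z. v' z = w z"
      and u: "\<forall>z\<in>?Z. \<forall>p\<in>S'. lq z p \<longrightarrow> p \<in> ?Z" and d: "\<forall>z\<in>S. \<forall>p\<in>?Z. lq z p \<longrightarrow> z \<in> ?Z"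
      and fz: "\<forall>p\<in>S'. \<exists>z\<in>?Z. fl z = fl p"
      using vhom_extend[OF F SP w] by (elim exE conjE)
    \<comment> \<open>If the new set contained \<open>first S\<close>, then \<open>w\<close> would
      be nonzero at some point over \<open>first S\<close>, although its value there is transported
      from the zero at \<open>first S\<close>.\<close>
    have S'S: "p \<in> S \<and> p \<noteq> ?a" if p: "p \<in> S'" "p \<in> Q" for p
    proof -
      obtain z where z: "z \<in> S" "w z \<noteq> 0\<^sub>v (dm F z)" "fl z = p" using bspec[OF fz p(1)] fl_id[OF p(2)] by auto
      have zU: "z \<in> above" using z(1) SU by blast
      have "p \<in> S" using saturated_iff[OF less.prems(2) zU] z by simp
      moreover have "p \<noteq> ?a"
      proof
        assume pa: "p = ?a"
        have le: "lq ?a z" using fl_le[OF zU] z(3) pa by simp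
        have "w z = mp F ?a z *\<^sub>v w ?a" using vhomD(2)[OF w a(1) above_P[OF zU] le] z(1) by simp
        hence "w z = 0\<^sub>v (dm F z)" unfolding wa using rep_zero_vec[OF rF aP above_P[OF zU] le] by simp
        thus False using z(2) by simp
      qed
      ultimately show ?thesis by simp
    qed
    have "card (S' \<inter> Q) < card (S \<inter> Q)"
      by (rule psubset_card_mono[OF fin]) (use S'S a in blast)
    hence l': "vlift C g S' v'" by (rule less.hyps[OF _ S'])
    have "vlift C g S (\<lambda>z. if z \<in> ?Z then v' z else 0\<^sub>v (dm F z))"
      by (rule vlift_pull[OF l' SP C g _ u d]) (use ZS' in blast)
    hence "vlift C g S w" by (rule vlift_cong) (use vv in auto)
    hence "vlift C g S (\<lambda>z. w z + v1 z)" by (rule vlift_add[OF SP C g _ v1(1)])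
    thus ?thesis
    proof (rule vlift_cong)
      fix z assume "z \<in> S"
      hence "v z \<in> carrier_vec (dm F z)" "v1 z \<in> carrier_vec (dm F z)" using vhomD(1) less.prems(3) v1(2) by auto
      thus "v z = w z + v1 z" unfolding w_def by (intro eq_vecI) auto
    qed
  next
    case d
    let ?R = "\<lambda>a b. a \<in> S \<and> b \<in> S \<and> (lq a b \<or> lq b a)"
    obtain x y where xy: "x \<in> S" "y \<in> S" "\<not> ?R\<^sup>*\<^sup>* x y" using d SP unfolding connected_sub_def by blast
    \<comment> \<open>The zigzag component of \<open>x\<close>, which misses \<open>y\<close>. The
      floor of \<open>x\<close> lies in this piece and that of \<open>y\<close> in the other, so
      both have fewer points in \<open>Q\<close> than \<open>S\<close>.\<close>
    define A where "A = {t \<in> S. ?R\<^sup>*\<^sup>* x t}"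
    define B where "B = S - A"
    have clA: "s \<in> A" if s: "s \<in> S" "t \<in> A" "lq s t \<or> lq t s" for s t
    proof -
      have xt: "?R\<^sup>*\<^sup>* x t" and tS: "t \<in> S" using s(2) by (auto simp: A_def)
      have "?R t s" using s tS by blast
      with xt have "?R\<^sup>*\<^sup>* x s" by (rule rtranclp.rtrancl_into_rtrancl)
      thus ?thesis using s(1) by (simp add: A_def)
    qed
    have AS: "A \<subseteq> S" and BS: "B \<subseteq> S" by (auto simp: A_def B_def)
    have clB: "s \<in> B" if s: "s \<in> S" "t \<in> B" "lq s t \<or> lq t s" for s t
    proof (rule ccontr)
      assume "s \<notin> B"
      hence sA: "s \<in> A" using s(1) by (simp add: B_def)
      have "t \<in> A" using clA[OF _ sA, of t] s BS by blast
      thus False using s(2) by (simp add: B_def)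
    qed
    note pA = split_part[OF less.prems AS clA] and pB = split_part[OF less.prems BS clB]
    have xA: "x \<in> A" using xy(1) by (simp add: A_def)
    have yB: "y \<in> B" using xy by (simp add: A_def B_def)
    have xU: "x \<in> above" "y \<in> above" using xy SU by auto
    have fxA: "fl x \<in> A" "fl x \<in> Q" "fl y \<in> B" "fl y \<in> Q"
      using saturated_iff[OF pA(2) xU(1)] saturated_iff[OF pB(2) xU(2)] xA yB fl_Q xU by auto
    have AB: "A \<inter> B = {}" by (auto simp: B_def)
    have "card (A \<inter> Q) < card (S \<inter> Q)"
      by (rule psubset_card_mono[OF fin]) (use AS BS AB fxA in blast)
    hence lA: "vlift C g A v" by (rule less.hyps[OF _ pA])
    have "card (B \<inter> Q) < card (S \<inter> Q)"
      by (rule psubset_card_mono[OF fin]) (use AS BS AB fxA in blast)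
    hence lB: "vlift C g B v" by (rule less.hyps[OF _ pB])
    have 1: "vlift C g S (\<lambda>z. if z \<in> A then v z else 0\<^sub>v (dm F z))"
      by (rule vlift_pull[OF lA SP C g]) (use AS clA in auto)
    have 2: "vlift C g S (\<lambda>z. if z \<in> B then v z else 0\<^sub>v (dm F z))"
      by (rule vlift_pull[OF lB SP C g]) (use BS clB in auto)
    show ?thesis
    proof (rule vlift_cong[OF vlift_add[OF SP C g 1 2]])
      fix z assume z: "z \<in> S"
      hence vz: "v z \<in> carrier_vec (dm F z)" by (rule vhomD(1)[OF less.prems(3)])
      show "v z = (if z \<in> A then v z else 0\<^sub>v (dm F z)) + (if z \<in> B then v z else 0\<^sub>v (dm F z))"
        using z vz by (cases "z \<in> A") (auto simp: B_def)
    qed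
  qed
qed

text \<open>For sets whose shape has nothing to do with \<open>Q\<close>: lift the saturated
  extension and pull the lifting back along the support.\<close>

lemma vlift_any:
  fixes F :: "('p, 'k::field) prep"
  assumes F: "qconst F" and C: "rep C" and g: "rhom C F g" and ZP: "Z \<subseteq> P" and v: "vhom Z F v"
    and l: "\<And>S v. \<lbrakk>convex P lq S; saturated S; vhom S F v\<rbrakk> \<Longrightarrow> vlift C g S v"
  shows "vlift C g Z v"
proof -
  let ?Z = "{z \<in> Z. v z \<noteq> 0\<^sub>v (dm F z)}"
  obtain S' v' where S': "convex P lq S'" "saturated S'" "vhom S' F v'" and ZS': "?Z \<subseteq> S'" and vv: "\<forall>z\<in>?Z. v' z = v z"
    and u: "\<forall>z\<in>?Z. \<forall>p\<in>S'. lq z p \<longrightarrow> p \<in> ?Z" and d: "\<forall>z\<in>Z. \<forall>p\<in>?Z. lq z p \<longrightarrow> z \<in> ?Z"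
    using vhom_extend[OF F ZP v] by (elim exE conjE)
  have "vlift C g Z (\<lambda>z. if z \<in> ?Z then v' z else 0\<^sub>v (dm F z))"
    by (rule vlift_pull[OF l[OF S'] ZP C g _ u d]) (use ZS' in blast)
  thus ?thesis by (rule vlift_cong) (use vv in auto)
qed

lemma qconst_eq_zero:
  assumes F: "qconst F" and z: "\<And>q. q \<in> Q \<Longrightarrow> dm F q = 0" and p: "p \<in> P"
  shows "dm (F :: ('p, 'k::field) prep) p = 0"
proof (cases "p \<in> above")
  case False thus ?thesis using qconstD(2)[OF F p] by simp
next
  case True
  note rF = qconstD(1)[OF F]
  have d0: "dm F (fl p) = 0" by (rule z[OF fl_Q[OF True]])
  show ?thesis
  proof (rule ccontr)
    assume n: "dm F p \<noteq> 0"
    obtain x where x: "x \<in> carrier_vec (dm F (fl p))" "(unit_vec (dm F p) 0 :: 'k vec) = mp F (fl p) p *\<^sub>v x"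
      using qconstD(4)[OF F True, of "unit_vec (dm F p) 0"] by auto
    have "x = 0\<^sub>v (dm F (fl p))" using x(1) unfolding d0 by (rule carrier_vec0)
    hence "(unit_vec (dm F p) 0 :: 'k vec) = 0\<^sub>v (dm F p)"
      using x(2) rep_zero_vec[OF rF fl_P[OF True] p fl_le[OF True]] by simp
    hence "(unit_vec (dm F p) 0 :: 'k vec) $ 0 = 0\<^sub>v (dm F p) $ 0" by simp
    thus False using n by simp
  qed
qed

text \<open>A nonzero vector at \<open>q\<close> yields, by Yoneda, a morphism from
  \<open>upq q\<close> that is nonzero at \<open>q\<close>, its first point.\<close>

lemma occurs_none:
  assumes F: "qconst F" and n: "\<And>T. T \<in> spreads \<Longrightarrow> \<not> occurs F T" and p: "p \<in> P"
  shows "dm (F :: ('p, 'k::field) prep) p = 0"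
proof (rule qconst_eq_zero[OF F _ p])
  note rF = qconstD(1)[OF F]
  fix q assume q: "q \<in> Q"
  hence qP: "q \<in> P" using QP by auto
  show "dm F q = 0"
  proof (rule ccontr)
    assume d: "dm F q \<noteq> 0"
    let ?c = "unit_vec (dm F q) 0 :: 'k vec"
    have c: "?c \<in> carrier_vec (dm F q)" by simp
    have "vhom (upq q) F (\<lambda>p. mp F q p *\<^sub>v ?c)" by (rule vhom_up[OF rF qP c])
    moreover have "mp F q q *\<^sub>v ?c \<noteq> 0\<^sub>v (dm F q)"
    proof
      assume "mp F q q *\<^sub>v ?c = 0\<^sub>v (dm F q)"
      hence "?c = 0\<^sub>v (dm F q)" using rep_id[OF rF qP c] by simp
      hence "?c $ 0 = (0\<^sub>v (dm F q) :: 'k vec) $ 0" by simp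
      thus False using d by simp
    qed
    ultimately have "occurs F (upq q)" unfolding occurs_def first_upq[OF q] by blast
    thus False using n[OF upq_spreads[OF q]] by simp
  qed
qed

lemma dsum_list_zero:
  assumes Xs: "\<forall>X\<in>set Xs. rep X" and p: "p \<in> P" and w: "w \<in> carrier_vec (dm (dsum_list Xs) p)"
    and z: "\<And>i. i < length Xs \<Longrightarrow> lprj Xs i p *\<^sub>v w = 0\<^sub>v (dm (Xs ! i) p)"
  shows "w = 0\<^sub>v (dm (dsum_list Xs) p)"
proof -
  have "1\<^sub>m (dm (dsum_list Xs) p) *\<^sub>v w = 0\<^sub>v (dm (dsum_list Xs) p)"
  proof (rule dsum_list_kill[OF Xs p w one_carrier_mat])
    fix i assume i: "i < length Xs"
    have "linj Xs i p *\<^sub>v (lprj Xs i p *\<^sub>v w) = 0\<^sub>v (dm (dsum_list Xs) p)"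
      unfolding z[OF i] by (rule hom_zero_vec[OF linj_hom[OF Xs i] p])
    thus "1\<^sub>m (dm (dsum_list Xs) p) *\<^sub>v (linj Xs i p *\<^sub>v (lprj Xs i p *\<^sub>v w)) = 0\<^sub>v (dm (dsum_list Xs) p)" by simp
  qed
  thus ?thesis using w by simp
qed

text \<open>The last conjunct is what makes resolutions finite: the part of w that comes from T itself is detected
by the injective matrix of spread_gen, so w needs a component at some spread strictly above T.\<close>

lemma approximation:
  fixes F :: "('p, 'k::field) prep"
  assumes F: "qconst F"
  shows "\<exists>Ss g. set Ss \<subseteq> spreads \<and> rhom (dsum_list (map indicator_rep Ss)) F g \<and>
     (\<forall>Z v. Z \<subseteq> P \<longrightarrow> vhom Z F v \<longrightarrow> vlift (dsum_list (map indicator_rep Ss)) g Z v) \<and>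
     (\<forall>T\<in>spreads. \<forall>w. vhom T (dsum_list (map indicator_rep Ss)) w \<longrightarrow> g (first T) *\<^sub>v w (first T) = 0\<^sub>v (dm F (first T)) \<longrightarrow>
        w (first T) \<noteq> 0\<^sub>v (dm (dsum_list (map indicator_rep Ss) :: ('p, 'k) prep) (first T)) \<longrightarrow> (\<exists>S\<in>spreads. occurs F S \<and> prec T S))"
proof -
  note rF = qconstD(1)[OF F]
  define A where "A T d H L \<longleftrightarrow> rhom (pow_ind T d) F H \<and> L \<in> carrier_mat d (dm F (first T)) \<and>
     (\<forall>c\<in>carrier_vec d. L *\<^sub>v (H (first T) *\<^sub>v c) = c) \<and>
     (\<forall>v. vhom T F v \<longrightarrow> H (first T) *\<^sub>v (L *\<^sub>v v (first T)) = v (first T))" for T d H L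
  have "\<exists>d H L. A T d H L" if "T \<in> spreads" for T using spread_gen[OF rF that] unfolding A_def .
  then obtain d H L where A: "\<And>T. T \<in> spreads \<Longrightarrow> A T (d T) (H T) (L T)" by metis
  have H: "rhom (pow_ind T (d T)) F (H T)" and Lc: "L T \<in> carrier_mat (d T) (dm F (first T))"
    and LH: "c \<in> carrier_vec (d T) \<Longrightarrow> L T *\<^sub>v (H T (first T) *\<^sub>v c) = c"
    and HL: "vhom T F v \<Longrightarrow> H T (first T) *\<^sub>v (L T *\<^sub>v v (first T)) = v (first T)" if "T \<in> spreads" for T c v
    using A[OF that] unfolding A_def by simp_all
  obtain Ts where Ts: "set Ts = spreads" "distinct Ts" using finite_distinct_list[OF finite_spreads] by blast
  define Xs where "Xs = map (\<lambda>T. pow_ind T (d T) :: ('p, 'k) prep) Ts"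
  define Ss where "Ss = concat (map (\<lambda>T. replicate (d T) T) Ts)"
  define C where "C = dsum_list Xs"
  have CSs: "dsum_list (map indicator_rep Ss) = C"
    unfolding C_def Xs_def Ss_def dsum_list_pow_ind[of "\<lambda>T. T" d Ts] ..
  have "set Ss \<subseteq> set Ts" by (auto simp: Ss_def)
  hence Ss: "set Ss \<subseteq> spreads" unfolding Ts(1) .
  have rXs: "\<forall>X\<in>set Xs. rep X"
  proof
    fix X assume "X \<in> set Xs"
    then obtain T where "T \<in> spreads" "X = pow_ind T (d T)" using Ts(1) by (auto simp: Xs_def)
    thus "rep X" using rep_pow_ind[OF spreadsD(1)] by simp
  qed
  have ex_i: "\<exists>i. i < length Xs \<and> Ts ! i = T" if "T \<in> spreads" for T
    using that unfolding Ts(1)[symmetric] in_set_conv_nth by (simp add: Xs_def)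
  have rC: "rep C" unfolding C_def by (rule rep_dsum_list[OF rXs])
  have len: "length Xs = length Ts" by (simp add: Xs_def)
  have Xi: "Xs ! i = pow_ind (Ts ! i) (d (Ts ! i))" "Ts ! i \<in> spreads" if "i < length Xs" for i
    using that Ts(1) nth_mem[of i Ts] by (auto simp: Xs_def)
  have hi: "rhom (Xs ! i) F (H (Ts ! i))" if "i < length Xs" for i using H[OF Xi(2)[OF that]] Xi(1)[OF that] by simp
  have "\<exists>g. rhom (dsum_list Xs) F g \<and> (\<forall>i<length Xs. \<forall>p\<in>P. \<forall>x\<in>carrier_vec (dm (Xs ! i) p).
      g p *\<^sub>v (linj Xs i p *\<^sub>v x) = H (Ts ! i) p *\<^sub>v x)"
    by (rule dsum_list_out[OF rXs rF]) (rule hi)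
  then obtain g where g: "rhom C F g"
    and gi: "\<forall>i<length Xs. \<forall>p\<in>P. \<forall>x\<in>carrier_vec (dm (Xs ! i) p). g p *\<^sub>v (linj Xs i p *\<^sub>v x) = H (Ts ! i) p *\<^sub>v x"
    unfolding C_def by (elim exE conjE)
  \<comment> \<open>The value of \<open>v\<close> at the first point is a combination
    \<open>?c\<close> of the generators for \<open>T\<close>; the summand at \<open>T\<close>
    realises and lifts it.\<close>
  have top: "\<exists>v1. vlift C g T v1 \<and> vhom T F v1 \<and> v1 (first T) = v (first T)" if T: "T \<in> spreads" and v: "vhom T F v" for T v
  proof -
    obtain i where i: "i < length Xs" "Ts ! i = T" using ex_i[OF T] by (elim exE conjE)
    have a: "first T \<in> T" "first T \<in> P" using first_in[OF T] first_P[OF T] by auto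
    let ?c = "L T *\<^sub>v v (first T)"
    have c: "?c \<in> carrier_vec (d T)" by (rule mult_mat_vec_carrier[OF Lc[OF T] vhomD(1)[OF v a(1)]])
    have Xi': "Xs ! i = pow_ind T (d T)" using Xi(1)[OF i(1)] i(2) by simp
    have lh: "rhom (pow_ind T (d T)) C (linj Xs i)" using linj_hom[OF rXs i(1)] unfolding Xi' C_def .
    have w: "vhom T C (\<lambda>p. linj Xs i p *\<^sub>v ?c)" by (rule vhom_of_hom[OF spreadsD(1)[OF T] rC lh c])
    have v1: "vhom T F (\<lambda>p. H T p *\<^sub>v ?c)" by (rule vhom_of_hom[OF spreadsD(1)[OF T] rF H[OF T] c])
    have "g z *\<^sub>v (linj Xs i z *\<^sub>v ?c) = H T z *\<^sub>v ?c" if z: "z \<in> T" for z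
    proof -
      have zP: "z \<in> P" using z spreadsD(4)[OF T] by blast
      have cz: "?c \<in> carrier_vec (dm (Xs ! i) z)" using c z unfolding Xi' by (simp add: dm_pow_ind)
      show ?thesis using gi[rule_format, OF i(1) zP cz] i(2) by simp
    qed
    hence "vlift C g T (\<lambda>p. H T p *\<^sub>v ?c)" unfolding vlift_def using w by (intro exI conjI ballI)
    thus ?thesis using v1 HL[OF T v] by (intro exI[of _ "\<lambda>p. H T p *\<^sub>v ?c"] conjI)
  qed
  have lift: "vlift C g Z v" if "Z \<subseteq> P" "vhom Z F v" for Z v
  proof (rule vlift_any[OF F rC g that])
    fix S v assume a: "convex P lq S" "saturated S" "vhom S F v"
    show "vlift C g S v" by (rule vlift_all[OF F rC g _ a]) (rule top)
  qed
  have dec: "\<exists>S\<in>spreads. occurs F S \<and> prec T S" if T: "T \<in> spreads" and w: "vhom T C w"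
    and gw: "g (first T) *\<^sub>v w (first T) = 0\<^sub>v (dm F (first T))" and nz: "w (first T) \<noteq> 0\<^sub>v (dm C (first T))" for T w
  proof (rule ccontr)
    assume no: "\<not> (\<exists>S\<in>spreads. occurs F S \<and> prec T S)"
    let ?a = "first T"
    have a: "?a \<in> T" "?a \<in> P" "?a \<in> Q" using first_in[OF T] first_P[OF T] by auto
    note TP = spreadsD(4)[OF T]
    have wa: "w ?a \<in> carrier_vec (dm (dsum_list Xs) ?a)" using vhomD(1)[OF w a(1)] by (simp add: C_def)
    \<comment> \<open>A component at another spread \<open>?S\<close> gives a link at
      \<open>first T\<close>, so \<open>?S\<close> contains that point and its own first point is no
      later. The component being nonzero, \<open>?S\<close> has a generator and so occurs in
      \<open>F\<close>: this is the spread whose existence was denied.\<close>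
    have only: "Ts ! j = T" if j: "j < length Xs" and u: "lprj Xs j ?a *\<^sub>v w ?a \<noteq> 0\<^sub>v (dm (Xs ! j) ?a)" for j
    proof (rule ccontr)
      let ?S = "Ts ! j"
      assume ne: "?S \<noteq> T"
      have S: "?S \<in> spreads" by (rule Xi(2)[OF j])
      have lp: "rhom C (pow_ind ?S (d ?S)) (lprj Xs j)" using lprj_hom[OF rXs j] unfolding Xi(1)[OF j] C_def .
      have vj: "vhom T (pow_ind ?S (d ?S)) (\<lambda>z. lprj Xs j z *\<^sub>v w z)"
        by (rule vhom_comp[OF TP rC rep_pow_ind[OF spreadsD(1)[OF S]] w lp])
      have uj: "lprj Xs j ?a *\<^sub>v w ?a \<noteq> 0\<^sub>v (dm (pow_ind ?S (d ?S) :: ('p, 'k) prep) ?a)" using u unfolding Xi(1)[OF j] .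
      have lk: "link ?a T ?S" by (rule link_of_vhom[OF spreadsD(1)[OF S] TP vj a(1) uj])
      hence aS: "?a \<in> ?S" unfolding link_def by blast
      have ujc: "lprj Xs j ?a *\<^sub>v w ?a \<in> carrier_vec (d ?S)" using vhomD(1)[OF vj a(1)] aS by (simp add: dm_pow_ind)
      have d0: "d ?S \<noteq> 0"
      proof
        assume "d ?S = 0"
        hence "lprj Xs j ?a *\<^sub>v w ?a = 0\<^sub>v 0" using ujc carrier_vec0 by simp
        thus False using uj aS \<open>d ?S = 0\<close> by (simp add: dm_pow_ind)
      qed
      have occ: "occurs F ?S"
      proof -
        let ?c = "unit_vec (d ?S) 0 :: 'k vec"
        have c: "?c \<in> carrier_vec (d ?S)" by simp
        have "vhom ?S F (\<lambda>p. H ?S p *\<^sub>v ?c)" by (rule vhom_of_hom[OF spreadsD(1)[OF S] rF H[OF S] c])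
        moreover have "H ?S (first ?S) *\<^sub>v ?c \<noteq> 0\<^sub>v (dm F (first ?S))"
        proof
          assume "H ?S (first ?S) *\<^sub>v ?c = 0\<^sub>v (dm F (first ?S))"
          hence "?c = 0\<^sub>v (d ?S)" using LH[OF S c] mult_mat_zero_vec[OF Lc[OF S]] by simp
          hence "?c $ 0 = (0\<^sub>v (d ?S) :: 'k vec) $ 0" by simp
          thus False using d0 by simp
        qed
        ultimately show ?thesis unfolding occurs_def by blast
      qed
      have le: "rank (first ?S) \<le> rank ?a" by (rule first_le) (use aS a(3) in blast)
      have "prec T ?S"
      proof (cases "rank (first ?S) = rank ?a")
        case True
        have "first ?S = ?a" by (rule rank_inj[OF _ a(3) True]) (use first_in[OF S] in blast)
        thus ?thesis using ne lk unfolding prec_def by auto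
      next
        case False thus ?thesis using le unfolding prec_def by simp
      qed
      thus False using no S occ by blast
    qed
    obtain i where i: "i < length Xs" "Ts ! i = T" using ex_i[OF T] by (elim exE conjE)
    have uniq: "j = i" if "j < length Xs" "Ts ! j = T" for j
      using that i Ts(2) len nth_eq_iff_index_eq[of Ts j i] by simp
    have Xi': "Xs ! i = pow_ind T (d T)" using Xi(1)[OF i(1)] i(2) by simp
    let ?pi = "lprj Xs i ?a"
    have pc: "?pi \<in> carrier_mat (d T) (dm (dsum_list Xs) ?a)"
      using hom_mat[OF lprj_hom[OF rXs i(1)] a(2)] a(1) unfolding Xi' by (simp add: dm_pow_ind)
    have Hc: "H T ?a \<in> carrier_mat (dm F ?a) (d T)" using hom_mat[OF H[OF T] a(2)] a(1) by (simp add: dm_pow_ind)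
    have gc: "g ?a \<in> carrier_mat (dm F ?a) (dm (dsum_list Xs) ?a)" using hom_mat[OF g a(2)] by (simp add: C_def)
    have Hpc: "H T ?a * ?pi \<in> carrier_mat (dm F ?a) (dm (dsum_list Xs) ?a)" by (rule mult_carrier_mat[OF Hc pc])
    \<comment> \<open>\<open>g\<close> without the contribution of the summand at \<open>T\<close>.
      At this point \<open>w\<close> has no other component, so \<open>?M\<close> kills it; as
      \<open>g\<close> kills it too, so does \<open>H T\<close> after the projection, and
      \<open>L T\<close> shows that the component at \<open>T\<close> is zero as well.\<close>
    let ?M = "g ?a - H T ?a * ?pi"
    have Mc: "?M \<in> carrier_mat (dm F ?a) (dm (dsum_list Xs) ?a)" using Hpc by (rule minus_carrier_mat)
    have Mv: "?M *\<^sub>v x = g ?a *\<^sub>v x - H T ?a *\<^sub>v (?pi *\<^sub>v x)" if x: "x \<in> carrier_vec (dm (dsum_list Xs) ?a)" for x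
      unfolding minus_mult_distrib_mat_vec[OF gc Hpc x] assoc_mult_mat_vec[OF Hc pc x] ..
    have "?M *\<^sub>v w ?a = 0\<^sub>v (dm F ?a)"
    proof (rule dsum_list_kill[OF rXs a(2) wa Mc])
      fix j assume j: "j < length Xs"
      let ?u = "lprj Xs j ?a *\<^sub>v w ?a"
      have uc: "?u \<in> carrier_vec (dm (Xs ! j) ?a)" by (rule hom_vec[OF lprj_hom[OF rXs j] a(2) wa])
      have ic: "linj Xs j ?a *\<^sub>v ?u \<in> carrier_vec (dm (dsum_list Xs) ?a)" by (rule hom_vec[OF linj_hom[OF rXs j] a(2) uc])
      show "?M *\<^sub>v (linj Xs j ?a *\<^sub>v ?u) = 0\<^sub>v (dm F ?a)"
      proof (cases "?u = 0\<^sub>v (dm (Xs ! j) ?a)")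
        case True
        have "linj Xs j ?a *\<^sub>v ?u = 0\<^sub>v (dm (dsum_list Xs) ?a)" unfolding True by (rule hom_zero_vec[OF linj_hom[OF rXs j] a(2)])
        thus ?thesis using mult_mat_zero_vec[OF Mc] by simp
      next
        case False
        have ji: "j = i" by (rule uniq[OF j only[OF j False]])
        have "g ?a *\<^sub>v (linj Xs j ?a *\<^sub>v ?u) = H T ?a *\<^sub>v ?u" using gi[rule_format, OF j a(2) uc] ji i(2) by simp
        moreover have "?pi *\<^sub>v (linj Xs j ?a *\<^sub>v ?u) = ?u"
          using lprj_linj[OF rXs i(1) j a(2) uc] ji by simp
        moreover have "H T ?a *\<^sub>v ?u \<in> carrier_vec (dm F ?a)"
          using hom_vec[OF hi[OF j] a(2) uc] ji i(2) by simp
        ultimately show ?thesis unfolding Mv[OF ic] by simp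
      qed
    qed
    hence "0\<^sub>v (dm F ?a) - H T ?a *\<^sub>v (?pi *\<^sub>v w ?a) = 0\<^sub>v (dm F ?a)" unfolding Mv[OF wa] gw .
    moreover have pw: "?pi *\<^sub>v w ?a \<in> carrier_vec (d T)" by (rule mult_mat_vec_carrier[OF pc wa])
    ultimately have "0\<^sub>v (dm F ?a) = H T ?a *\<^sub>v (?pi *\<^sub>v w ?a)"
      by (intro vec_zero_eq[OF zero_carrier_vec mult_mat_vec_carrier[OF Hc]]) auto
    hence "L T *\<^sub>v (0\<^sub>v (dm F ?a)) = L T *\<^sub>v (H T ?a *\<^sub>v (?pi *\<^sub>v w ?a))" by simp
    hence pz: "?pi *\<^sub>v w ?a = 0\<^sub>v (d T)" unfolding LH[OF T pw] mult_mat_zero_vec[OF Lc[OF T]] by simp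
    have "w ?a = 0\<^sub>v (dm (dsum_list Xs) ?a)"
    proof (rule dsum_list_zero[OF rXs a(2) wa], rule ccontr)
      fix j assume j: "j < length Xs" and n: "lprj Xs j ?a *\<^sub>v w ?a \<noteq> 0\<^sub>v (dm (Xs ! j) ?a)"
      have "j = i" by (rule uniq[OF j only[OF j n]])
      thus False using n pz a(1) unfolding Xi' by (simp add: Xi' dm_pow_ind)
    qed
    thus False using nz by (simp add: C_def)
  qed
  show ?thesis
  proof (rule exI[of _ Ss], rule exI[of _ g], unfold CSs, intro conjI allI impI ballI)
    show "set Ss \<subseteq> spreads" "rhom C F g" by fact+
    show "vlift C g Z v" if "Z \<subseteq> P" "vhom Z F v" for Z v by (rule lift[OF that])
    show "\<exists>S\<in>spreads. occurs F S \<and> prec T S" if "T \<in> spreads" "vhom T C w" "g (first T) *\<^sub>v w (first T) = 0\<^sub>v (dm F (first T))"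
      "w (first T) \<noteq> 0\<^sub>v (dm C (first T))" for T w by (rule dec[OF that])
  qed
qed

lemma spreads_fp: "S \<in> spreads \<Longrightarrow> fp_spread P lq TYPE('k::field) S"
  by (intro fp_spreadI) (auto simp: spreads_def)

lemma qconst_spread_sum:
  "set Ss \<subseteq> spreads \<Longrightarrow> qconst (dsum_list (map indicator_rep Ss) :: ('p, 'k::field) prep)"
  unfolding pow_ind_1 using spreadsD by (intro qconst_dsum_list) (auto intro!: qconst_pow_ind)

text \<open>Passes from families to morphisms and to the kernel. Surjectivity is lifting tested on
  principal up-sets. An occurrence in \<open>K\<close> stays nonzero under the injective inclusion
  and is killed by \<open>g\<close>, so the last clause of \<open>approximation\<close> applies to
  it.\<close>

lemma approximation_ker:
  fixes F :: "('p, 'k::field) prep"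
  assumes F: "qconst F"
  shows "\<exists>Ss g K i r. set Ss \<subseteq> spreads \<and> rhom (dsum_list (map indicator_rep Ss)) F g \<and>
     (\<forall>S. convex P lq S \<longrightarrow> lifts (indicator_rep S) (dsum_list (map indicator_rep Ss)) g F) \<and>
     pw_surj P (dsum_list (map indicator_rep Ss)) F g \<and>
     ker_data (dsum_list (map indicator_rep Ss)) F g K i r \<and> qconst K \<and>
     (\<forall>T\<in>spreads. occurs K T \<longrightarrow> (\<exists>S\<in>spreads. occurs F S \<and> prec T S))"
proof -
  note rF = qconstD(1)[OF F]
  obtain Ss g where Ss: "set Ss \<subseteq> spreads" and g0: "rhom (dsum_list (map indicator_rep Ss)) F g"
    and l0: "\<forall>Z v. Z \<subseteq> P \<longrightarrow> vhom Z F v \<longrightarrow> vlift (dsum_list (map indicator_rep Ss)) g Z v"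
    and d0: "\<forall>T\<in>spreads. \<forall>w. vhom T (dsum_list (map indicator_rep Ss)) w \<longrightarrow> g (first T) *\<^sub>v w (first T) = 0\<^sub>v (dm F (first T)) \<longrightarrow>
        w (first T) \<noteq> 0\<^sub>v (dm (dsum_list (map indicator_rep Ss) :: ('p, 'k) prep) (first T)) \<longrightarrow> (\<exists>S\<in>spreads. occurs F S \<and> prec T S)"
    using approximation[OF F] by (elim exE conjE)
  define C where "C = (dsum_list (map indicator_rep Ss) :: ('p, 'k) prep)"
  note g = g0[folded C_def] and l = l0[folded C_def] and d = d0[folded C_def]
  have C: "qconst C" unfolding C_def by (rule qconst_spread_sum[OF Ss])
  note rC = qconstD(1)[OF C]
  obtain K i r where k: "ker_data C F g K i r" using ker_exists[OF rC rF g] by (elim exE)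
  note kd = ker_dataD[OF k] and K = qconst_ker[OF k C F g]
  have lf: "lifts (indicator_rep S) C g F" if S: "convex P lq S" for S
  proof (rule vlift_lifts[OF S rC rF g])
    have SP: "S \<subseteq> P" using S by (simp add: convex_def)
    fix v assume "vhom S F v" thus "vlift C g S v" using l SP by simp
  qed
  have sq: "\<exists>w\<in>carrier_vec (dm C q). u = g q *\<^sub>v w" if q: "q \<in> P" and u: "u \<in> carrier_vec (dm F q)" for q u
  proof -
    have "vlift C g (upq q) (\<lambda>p. mp F q p *\<^sub>v u)" using l vhom_up[OF rF q u] by (simp add: up_def)
    then obtain w where w: "vhom (upq q) C w" "\<forall>z\<in>upq q. g z *\<^sub>v w z = mp F q z *\<^sub>v u" unfolding vlift_def by (elim exE conjE)
    have qq: "q \<in> upq q" using q refl by (simp add: up_def)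
    have "u = g q *\<^sub>v w q" using bspec[OF w(2) qq] rep_id[OF rF q u] by simp
    thus ?thesis using vhomD(1)[OF w(1) qq] by blast
  qed
  have dec: "\<exists>S\<in>spreads. occurs F S \<and> prec T S" if T: "T \<in> spreads" and o: "occurs K T" for T
  proof -
    let ?a = "first T"
    have a: "?a \<in> T" "?a \<in> P" using first_in[OF T] first_P[OF T] by auto
    obtain v where v: "vhom T K v" "v ?a \<noteq> 0\<^sub>v (dm K ?a)" using o unfolding occurs_def by (elim exE conjE)
    note va = vhomD(1)[OF v(1) a(1)]
    have w: "vhom T C (\<lambda>z. i z *\<^sub>v v z)" by (rule vhom_comp[OF spreadsD(4)[OF T] kd(1) rC v(1) kd(2)])
    have "i ?a *\<^sub>v v ?a \<noteq> 0\<^sub>v (dm C ?a)"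
    proof
      assume "i ?a *\<^sub>v v ?a = 0\<^sub>v (dm C ?a)"
      hence "r ?a *\<^sub>v (i ?a *\<^sub>v v ?a) = 0\<^sub>v (dm K ?a)" using mult_mat_zero_vec[OF kd(9)[OF a(2)]] by simp
      thus False using kd(4)[OF a(2) va] v(2) by simp
    qed
    thus ?thesis using d T w kd(6)[OF a(2) va] by blast
  qed
  have "set Ss \<subseteq> spreads \<and> rhom C F g \<and> (\<forall>S. convex P lq S \<longrightarrow> lifts (indicator_rep S) C g F) \<and>
     pw_surj P C F g \<and> ker_data C F g K i r \<and> qconst K \<and> (\<forall>T\<in>spreads. occurs K T \<longrightarrow> (\<exists>S\<in>spreads. occurs F S \<and> prec T S))"
    using Ss g lf sq k K dec unfolding pw_surj_def by simp
  thus ?thesis unfolding C_def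
    by (intro exI[of _ Ss] exI[of _ g] exI[of _ K] exI[of _ i] exI[of _ r])
qed

lemma add_spread_zero: "add_spread P lq (zero_rep :: ('p, 'k::field) prep)"
  using add_spreadI[of "[]", where 'k = 'k] qconst_fin_pres[OF qconst_zero] by simp

text \<open>Induction on a strict bound for the heights of the spreads that occur. Each passage to
  the kernel of an approximation lowers the bound by one, and once nothing can occur the
  representation is zero.\<close>

lemma qconst_resolution:
  fixes M :: "('p, 'k::field) prep"
  assumes "qconst M" shows "has_finite_spread_res P lq M"
proof -
  have "\<lbrakk>qconst F; \<forall>T\<in>spreads. occurs F T \<longrightarrow> height T < n\<rbrakk> \<Longrightarrow> has_finite_spread_res P lq F" for n and F :: "('p, 'k) prep"
  proof (induction n arbitrary: F)
    case 0
    hence "\<And>T. T \<in> spreads \<Longrightarrow> \<not> occurs F T" by auto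
    thus ?case using has_finite_spread_res_zero[OF qconstD(1)[OF 0(1)] occurs_none[OF 0(1)] add_spread_zero] by blast
  next
    case (Suc n)
    note rF = qconstD(1)[OF Suc.prems(1)]
    obtain Ss g K i r where Ss: "set Ss \<subseteq> spreads" and g: "rhom (dsum_list (map indicator_rep Ss)) F g" and
     l: "\<forall>S. convex P lq S \<longrightarrow> lifts (indicator_rep S) (dsum_list (map indicator_rep Ss)) g F" and
     k: "ker_data (dsum_list (map indicator_rep Ss)) F g K i r" and K: "qconst K" and
     d: "\<forall>T\<in>spreads. occurs K T \<longrightarrow> (\<exists>S\<in>spreads. occurs F S \<and> prec T S)"
      using approximation_ker[OF Suc.prems(1)] by (elim exE conjE)
    note C = qconst_spread_sum[OF Ss, where 'k = 'k]
    have a: "add_spread P lq (dsum_list (map indicator_rep Ss) :: ('p, 'k) prep)"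
      by (rule add_spreadI[OF qconst_fin_pres[OF C]]) (use Ss spreads_fp in blast)
    have "height T < n" if T: "T \<in> spreads" "occurs K T" for T
    proof -
      obtain S where S: "S \<in> spreads" "occurs F S" "prec T S" using d T by blast
      have "height S < Suc n" using Suc.prems(2) S(1,2) by blast
      thus ?thesis using prec_height[OF T(1) S(1,3)] by simp
    qed
    hence res: "has_finite_spread_res P lq K" by (intro Suc.IH[OF K]) simp
    have "lifts Z (dsum_list (map indicator_rep Ss)) g F" if Z: "add_spread P lq Z" for Z
      by (rule lifts_add_spread[OF Z qconstD(1)[OF C] rF g]) (use l in \<open>auto simp: fp_spread_def spread_def\<close>)
    thus ?case by (intro has_finite_spread_res_step[OF rF a g _ k res])
  qed
  \<comment> \<open>A height counts elements of \<open>spreads\<close>, so it is at most the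
    cardinality; the successor makes the bound strict.\<close>
  moreover have "\<forall>T\<in>spreads. occurs M T \<longrightarrow> height T < Suc (card spreads)"
    unfolding height_def using card_mono[OF finite_spreads] by (auto simp: less_Suc_eq_le)
  ultimately show ?thesis using assms by blast
qed

end

section \<open>Direct summands of sums of spreads\<close>

lemma vec_add_diff:
  assumes "x \<in> carrier_vec n" "y \<in> carrier_vec n"
  shows "x + y - x = (y :: 'a::field vec)" "x + (y - x) = y"
proof -
  have d: "dim_vec x = n" "dim_vec y = n" using assms by (simp_all only: carrier_vecD)
  show "x + y - x = y" by (rule eq_vecI) (simp_all add: d)
  show "x + (y - x) = y" by (rule eq_vecI) (simp_all add: d)
qed

lemma mat_1_1_vec:
  assumes "A \<in> carrier_mat 1 1" "x \<in> carrier_vec 1"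
  shows "(A *\<^sub>v x) $ 0 = A $$ (0, 0) * (x :: 'a::field vec) $ 0"
proof -
  have d: "dim_row A = 1" "dim_col A = 1" "dim_vec x = 1"
    using assms carrier_matD carrier_vecD by blast+
  show ?thesis by (simp add: d scalar_prod_def)
qed

context rposet begin

lemma smult_mat_vec:
  assumes "A \<in> carrier_mat n m" "v \<in> carrier_vec m"
  shows "(c \<cdot>\<^sub>m A) *\<^sub>v v = c \<cdot>\<^sub>v (A *\<^sub>v (v :: 'k::field vec))"
proof (rule eq_vecI)
  fix i assume "i < dim_vec (c \<cdot>\<^sub>v (A *\<^sub>v v))"
  hence i: "i < dim_row A" by simp
  have "((c \<cdot>\<^sub>m A) *\<^sub>v v) $ i = (c \<cdot>\<^sub>v row A i) \<bullet> v" using i by (simp add: row_smult)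
  also have "\<dots> = c * (row A i \<bullet> v)"
    by (rule smult_scalar_prod_distrib[where n = m]) (use assms i in auto)
  finally show "((c \<cdot>\<^sub>m A) *\<^sub>v v) $ i = (c \<cdot>\<^sub>v (A *\<^sub>v v)) $ i" using i by simp
qed simp

lemma hom_smult:
  assumes X: "rep X" and Y: "rep Y" and f: "rhom X Y f"
  shows "rhom X Y (\<lambda>p. c \<cdot>\<^sub>m f p)"
proof (rule homI[OF X Y])
  fix p assume "p \<in> P" thus "c \<cdot>\<^sub>m f p \<in> carrier_mat (dm Y p) (dm X p)" using hom_mat[OF f] by simp
next
  fix p q and v :: "'a vec" assume h: "p \<in> P" "q \<in> P" "lq p q" "v \<in> carrier_vec (dm X p)"
  show "(c \<cdot>\<^sub>m f q) *\<^sub>v (mp X p q *\<^sub>v v) = mp Y p q *\<^sub>v ((c \<cdot>\<^sub>m f p) *\<^sub>v v)"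
    unfolding smult_mat_vec[OF hom_mat[OF f h(2)] rep_vec[OF X h]] smult_mat_vec[OF hom_mat[OF f h(1)] h(4)]
      mult_mat_vec[OF rep_mat[OF Y h(1-3)] hom_vec[OF f h(1,4)]] hom_nat[OF X Y f h] ..
qed

lemma hom_add:
  assumes X: "rep X" and Y: "rep Y" and f: "rhom X Y f" and g: "rhom X Y g"
  shows "rhom X Y (\<lambda>p. f p + g p)"
proof (rule homI[OF X Y])
  fix p assume "p \<in> P" thus "f p + g p \<in> carrier_mat (dm Y p) (dm X p)" using hom_mat[OF g] by simp
next
  fix p q and v :: "'a vec" assume h: "p \<in> P" "q \<in> P" "lq p q" "v \<in> carrier_vec (dm X p)"
  show "(f q + g q) *\<^sub>v (mp X p q *\<^sub>v v) = mp Y p q *\<^sub>v ((f p + g p) *\<^sub>v v)"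
    unfolding add_mult_distrib_mat_vec[OF hom_mat[OF f h(2)] hom_mat[OF g h(2)] rep_vec[OF X h]]
      add_mult_distrib_mat_vec[OF hom_mat[OF f h(1)] hom_mat[OF g h(1)] h(4)]
      mult_add_distrib_mat_vec[OF rep_mat[OF Y h(1-3)] hom_vec[OF f h(1,4)] hom_vec[OF g h(1,4)]]
      hom_nat[OF X Y f h] hom_nat[OF X Y g h] ..
qed

text \<open>\<open>u * v\<close> is idempotent and its complement \<open>e\<close> lands in the
  kernel of \<open>v\<close>. The isomorphism consists of \<open>v\<close> and the coordinates of
  \<open>e\<close> in \<open>K\<close>; its inverse is built from \<open>u\<close> and
  \<open>i\<close>.\<close>

lemma split_off:
  fixes X :: "('p, 'k::field) prep"
  assumes A: "rep A" and X: "rep X" and u: "rhom A X u" and v: "rhom X A v"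
    and vu: "\<And>p x. \<lbrakk>p \<in> P; x \<in> carrier_vec (dm A p)\<rbrakk> \<Longrightarrow> v p *\<^sub>v (u p *\<^sub>v x) = x"
    and k: "ker_data X A v K i r"
  shows "iso P lq X (dsum A K)" "retract K X"
proof -
  note kd = ker_dataD[OF k]
  let ?w = "\<lambda>p. (- 1) \<cdot>\<^sub>m (u p * v p)"
  have w: "rhom X X ?w" by (rule hom_smult[OF X X hom_comp[OF X A X v u]])
  define e where "e = (\<lambda>p. 1\<^sub>m (dm X p) + ?w p)"
  have e: "rhom X X e" unfolding e_def by (rule hom_add[OF X X hom_id[OF X] w])
  have ev: "e p *\<^sub>v x = x - u p *\<^sub>v (v p *\<^sub>v x)" if p: "p \<in> P" and x: "x \<in> carrier_vec (dm X p)" for p x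
  proof -
    have c: "u p *\<^sub>v (v p *\<^sub>v x) \<in> carrier_vec (dm X p)" by (rule hom_vec[OF u p hom_vec[OF v p x]])
    have "e p *\<^sub>v x = x + (- 1) \<cdot>\<^sub>v (u p *\<^sub>v (v p *\<^sub>v x))"
      unfolding e_def add_mult_distrib_mat_vec[OF one_carrier_mat hom_mat[OF w p] x]
        smult_mat_vec[OF hom_mat[OF hom_comp[OF X A X v u] p] x] hom_comp_vec[OF v u p x] one_mult_mat_vec[OF x] ..
    also have "\<dots> = x - u p *\<^sub>v (v p *\<^sub>v x)" using x c by (intro eq_vecI) (auto simp del: index_mult_mat_vec)
    finally show ?thesis .
  qed
  have vev: "v p *\<^sub>v (e p *\<^sub>v x) = 0\<^sub>v (dm A p)" if p: "p \<in> P" and x: "x \<in> carrier_vec (dm X p)" for p x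
  proof -
    note vx = hom_vec[OF v p x]
    have "v p *\<^sub>v (x - u p *\<^sub>v (v p *\<^sub>v x)) = v p *\<^sub>v x - v p *\<^sub>v (u p *\<^sub>v (v p *\<^sub>v x))"
      by (rule mult_minus_distrib_mat_vec[OF hom_mat[OF v p] x hom_vec[OF u p vx]])
    thus ?thesis unfolding ev[OF p x] vu[OF p vx] using vx by simp
  qed
  let ?re = "\<lambda>p. r p * e p"
  have z: "\<forall>p\<in>P. \<forall>x\<in>carrier_vec (dm X p). v p *\<^sub>v (e p *\<^sub>v x) = 0\<^sub>v (dm A p)" using vev by blast
  note re = ker_lift_hom(1)[OF k X X e z] and ire = ker_lift_hom(2)[OF k X X e z]
  have reik: "?re p *\<^sub>v (u p *\<^sub>v a + i p *\<^sub>v x) = x"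
    and vuik: "v p *\<^sub>v (u p *\<^sub>v a + i p *\<^sub>v x) = a"
    if p: "p \<in> P" and a: "a \<in> carrier_vec (dm A p)" and x: "x \<in> carrier_vec (dm K p)" for p a x
  proof -
    note ua = hom_vec[OF u p a] and ix = hom_vec[OF kd(2) p x]
    have s: "u p *\<^sub>v a + i p *\<^sub>v x \<in> carrier_vec (dm X p)" using ua ix by simp
    show va: "v p *\<^sub>v (u p *\<^sub>v a + i p *\<^sub>v x) = a"
      unfolding mult_add_distrib_mat_vec[OF hom_mat[OF v p] ua ix] vu[OF p a] kd(6)[OF p x] using a by simp
    note rc = hom_vec[OF re p s]
    have "i p *\<^sub>v (?re p *\<^sub>v (u p *\<^sub>v a + i p *\<^sub>v x)) = i p *\<^sub>v x"
      unfolding ire[OF p s] ev[OF p s] va by (rule vec_add_diff(1)[OF ua ix])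
    hence "r p *\<^sub>v (i p *\<^sub>v (?re p *\<^sub>v (u p *\<^sub>v a + i p *\<^sub>v x))) = r p *\<^sub>v (i p *\<^sub>v x)" by simp
    thus "?re p *\<^sub>v (u p *\<^sub>v a + i p *\<^sub>v x) = x" unfolding kd(4)[OF p rc] kd(4)[OF p x] .
  qed
  note dh = dsum_homs[OF A kd(1)] and D = rep_dsum[OF A kd(1)]
  define f where "f = (\<lambda>p. dinl A K p * v p + dinr A K p * ?re p)"
  have f1: "rhom X (dsum A K) (\<lambda>p. dinl A K p * v p)" by (rule hom_comp[OF X A D v dh(1)])
  have f2: "rhom X (dsum A K) (\<lambda>p. dinr A K p * ?re p)" by (rule hom_comp[OF X kd(1) D re dh(2)])
  have f: "rhom X (dsum A K) f" unfolding f_def by (rule hom_add[OF X D f1 f2])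
  have fv: "f p *\<^sub>v x = (v p *\<^sub>v x) @\<^sub>v (?re p *\<^sub>v x)" if p: "p \<in> P" and x: "x \<in> carrier_vec (dm X p)" for p x
  proof -
    note vx = hom_vec[OF v p x] and rx = hom_vec[OF re p x]
    have "f p *\<^sub>v x = dinl A K p *\<^sub>v (v p *\<^sub>v x) + dinr A K p *\<^sub>v (?re p *\<^sub>v x)"
      unfolding f_def add_mult_distrib_mat_vec[OF hom_mat[OF f1 p] hom_mat[OF f2 p] x]
        hom_comp_vec[OF v dh(1) p x] hom_comp_vec[OF re dh(2) p x] ..
    also have "\<dots> = (v p *\<^sub>v x) @\<^sub>v (?re p *\<^sub>v x)"
      unfolding dsum_vecs(1,2)[OF vx rx] append_vec_add[OF vx zero_carrier_vec zero_carrier_vec rx]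
      using vx rx by simp
    finally show ?thesis .
  qed
  obtain g where g: "rhom (dsum A K) X g" and gv: "\<forall>p\<in>P. \<forall>a\<in>carrier_vec (dm A p). \<forall>x\<in>carrier_vec (dm K p).
     g p *\<^sub>v (a @\<^sub>v x) = u p *\<^sub>v a + i p *\<^sub>v x"
    using dsum_out[OF A kd(1) X u kd(2)] by (elim exE conjE)
  show "iso P lq X (dsum A K)"
  proof (rule isoI[OF f g])
    fix p and x :: "'k vec" assume p: "p \<in> P" and x: "x \<in> carrier_vec (dm X p)"
    note vx = hom_vec[OF v p x] and rx = hom_vec[OF re p x]
    have uvx: "u p *\<^sub>v (v p *\<^sub>v x) \<in> carrier_vec (dm X p)" by (rule hom_vec[OF u p vx])
    show "g p *\<^sub>v (f p *\<^sub>v x) = x"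
      unfolding fv[OF p x] gv[rule_format, OF p vx rx] ire[OF p x] ev[OF p x]
      by (rule vec_add_diff(2)[OF uvx x])
  next
    fix p and y :: "'k vec" assume p: "p \<in> P" and "y \<in> carrier_vec (dm (dsum A K) p)"
    then have "y \<in> carrier_vec (dm A p + dm K p)" by simp
    then obtain a x where ax: "a \<in> carrier_vec (dm A p)" "x \<in> carrier_vec (dm K p)" "y = a @\<^sub>v x"
      by (rule append_vec_cases)
    have s: "u p *\<^sub>v a + i p *\<^sub>v x \<in> carrier_vec (dm X p)"
      using hom_vec[OF u p ax(1)] hom_vec[OF kd(2) p ax(2)] by simp
    show "f p *\<^sub>v (g p *\<^sub>v y) = y"
      unfolding ax(3) gv[rule_format, OF p ax(1,2)] fv[OF p s] reik[OF p ax(1,2)] vuik[OF p ax(1,2)] ..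
  qed
  have "?re p *\<^sub>v (i p *\<^sub>v x) = x" if p: "p \<in> P" and x: "x \<in> carrier_vec (dm K p)" for p x
  proof -
    have "u p *\<^sub>v 0\<^sub>v (dm A p) + i p *\<^sub>v x = i p *\<^sub>v x"
      using hom_zero_vec[OF u p] hom_vec[OF kd(2) p x] by simp
    thus ?thesis using reik[OF p zero_carrier_vec x] by metis
  qed
  thus "retract K X" unfolding retract_def using kd(2) re by (intro exI[of _ i] exI[of _ ?re] conjI ballI)
qed

lemma dm_indicator: "dm (indicator_rep S) p = (if p \<in> S then 1 else 0)"
  by (simp add: indicator_rep_def)

text \<open>The composite vu is an endomorphism of the indicator of a connected set, hence a scalar, nonzero
by its value at a; rescaling v turns u into a split monomorphism.\<close>

lemma indicator_endo_scale:
  fixes X :: "('p, 'k::field) prep"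
  defines "I \<equiv> \<lambda>S. indicator_rep S :: ('p, 'k) prep"
  assumes S: "convex P lq S" "connected_sub P lq S" and X: "rep X" and u: "rhom (I S) X u" and v: "rhom X (I S) v"
    and a: "a \<in> S" and y: "y \<in> carrier_vec 1" and nz: "v a *\<^sub>v (u a *\<^sub>v y) \<noteq> 0\<^sub>v 1"
  shows "\<exists>v'. rhom X (I S) v' \<and> (\<forall>p\<in>P. \<forall>x\<in>carrier_vec (dm (I S) p). v' p *\<^sub>v (u p *\<^sub>v x) = x) \<and>
    v' a *\<^sub>v (u a *\<^sub>v y) \<noteq> 0\<^sub>v 1"
proof -
  have SP: "S \<subseteq> P" using S(1) by (simp add: convex_def)
  have rI: "rep (I S)" unfolding I_def by (rule rep_indicator[OF S(1)])
  have dI: "dm (I S) p = (if p \<in> S then 1 else 0)" for p by (simp add: I_def dm_indicator)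
  let ?t = "\<lambda>p. (v p * u p) $$ (0, 0)"
  have vuc: "v p * u p \<in> carrier_mat 1 1" if "p \<in> S" for p
    using hom_mat[OF hom_comp[OF rI X rI u v], of p] that SP by (auto simp: dI)
  have vu1: "v p *\<^sub>v (u p *\<^sub>v x) = ?t p \<cdot>\<^sub>v x" if p: "p \<in> S" and x: "x \<in> carrier_vec 1" for p x
  proof -
    have pP: "p \<in> P" using p SP by auto
    have x': "x \<in> carrier_vec (dm (I S) p)" using x p by (simp add: dI)
    have "v p *\<^sub>v (u p *\<^sub>v x) = (v p * u p) *\<^sub>v x" using hom_comp_vec[OF u v pP x'] by simp
    also have "\<dots> = ?t p \<cdot>\<^sub>v x"
    proof (rule eq_vecI)
      fix i assume "i < dim_vec (?t p \<cdot>\<^sub>v x)"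
      hence i: "i = 0" using x by simp
      show "((v p * u p) *\<^sub>v x) $ i = (?t p \<cdot>\<^sub>v x) $ i"
        using mat_1_1_vec[OF vuc[OF p] x] x unfolding i by simp
    qed (use carrier_matD(1)[OF vuc[OF p]] x in simp)
    finally show ?thesis .
  qed
  have step: "?t p = ?t q" if p: "p \<in> S" and q: "q \<in> S" and le: "lq p q" for p q
  proof -
    let ?e = "unit_vec 1 0 :: 'k vec"
    have pq: "p \<in> P" "q \<in> P" using p q SP by auto
    have e': "?e \<in> carrier_vec (dm (I S) p)" using p by (simp add: dI)
    have m: "mp (I S) p q = 1\<^sub>m 1" using p q by (simp add: I_def indicator_rep_def)
    note c = hom_comp[OF rI X rI u v]
    have "(v q * u q) *\<^sub>v (mp (I S) p q *\<^sub>v ?e) = mp (I S) p q *\<^sub>v ((v p * u p) *\<^sub>v ?e)"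
      by (rule hom_nat[OF rI rI c pq le e'])
    moreover have "(v p * u p) *\<^sub>v ?e \<in> carrier_vec 1" using vuc[OF p] by (intro mult_mat_vec_carrier) auto
    ultimately have "(v q * u q) *\<^sub>v ?e = (v p * u p) *\<^sub>v ?e" unfolding m by simp
    moreover have "(v q * u q) *\<^sub>v ?e = ?t q \<cdot>\<^sub>v ?e" "(v p * u p) *\<^sub>v ?e = ?t p \<cdot>\<^sub>v ?e"
      using vu1[OF p, of ?e] vu1[OF q, of ?e] hom_comp_vec[OF u v pq(1) e'] hom_comp_vec[OF u v pq(2), of ?e] q by (simp_all add: dI)
    ultimately have "(?t q \<cdot>\<^sub>v ?e) $ 0 = (?t p \<cdot>\<^sub>v ?e) $ 0" by simp
    thus ?thesis by simp
  qed
  have const: "?t p = ?t a" if p: "p \<in> S" for p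
  proof -
    have "{q \<in> S. ?t q = ?t a} = S"
      by (rule clopen_all[OF S(2), of _ a]) (use a step in auto)
    thus ?thesis using p by blast
  qed
  have t0: "?t a \<noteq> 0"
  proof
    assume "?t a = 0"
    hence "v a *\<^sub>v (u a *\<^sub>v y) = 0\<^sub>v 1" using vu1[OF a y] y by auto
    thus False using nz by simp
  qed
  let ?v = "\<lambda>p. (1 / ?t a) \<cdot>\<^sub>m v p"
  have v': "rhom X (I S) ?v" by (rule hom_smult[OF X rI v])
  have id: "?v p *\<^sub>v (u p *\<^sub>v x) = x" if p: "p \<in> P" and x: "x \<in> carrier_vec (dm (I S) p)" for p x
  proof (cases "p \<in> S")
    case True
    hence x1: "x \<in> carrier_vec 1" using x by (simp add: dI)
    have "?v p *\<^sub>v (u p *\<^sub>v x) = (1 / ?t a) \<cdot>\<^sub>v (?t a \<cdot>\<^sub>v x)"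
      unfolding smult_mat_vec[OF hom_mat[OF v p] hom_vec[OF u p x]] vu1[OF True x1] const[OF True] ..
    also have "\<dots> = x" using t0 by (simp add: smult_smult_assoc)
    finally show ?thesis .
  next
    case False
    hence d0: "dm (I S) p = 0" by (simp add: dI)
    have "?v p *\<^sub>v (u p *\<^sub>v x) \<in> carrier_vec (dm (I S) p)" by (rule hom_vec[OF v' p hom_vec[OF u p x]])
    thus ?thesis using x carrier_vec0 unfolding d0 by metis
  qed
  have y0: "y \<noteq> 0\<^sub>v 1" using nz vu1[OF a y] y by auto
  have "?v a *\<^sub>v (u a *\<^sub>v y) = y" using id[of a y] a SP y by (auto simp: dI)
  hence "?v a *\<^sub>v (u a *\<^sub>v y) \<noteq> 0\<^sub>v 1" using y0 by simp
  thus ?thesis using v' id by (intro exI[of _ ?v] conjI ballI)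
qed

end

context qposet begin

text \<open>If no composite of this kind were nonzero, the idempotent s r would be strictly triangular at a with
respect to link, hence nilpotent.  Instead of nilpotency the proof uses a link-minimal nonzero component.\<close>

lemma retract_spread_summand:
  fixes X :: "('p, 'k::field) prep"
  assumes X: "rep X" and Ss: "set Ss \<subseteq> spreads" and r: "retract X (dsum_list (map indicator_rep Ss))"
    and a: "a \<in> P" and d: "dm X a \<noteq> 0"
  shows "\<exists>S\<in>spreads. \<exists>u v y. a \<in> S \<and> rhom (indicator_rep S) X u \<and> rhom X (indicator_rep S) v \<and>
     y \<in> carrier_vec 1 \<and> v a *\<^sub>v (u a *\<^sub>v y) \<noteq> 0\<^sub>v 1"
proof -
  define Xs where "Xs = (map indicator_rep Ss :: ('p, 'k) prep list)"
  define C where "C = dsum_list Xs"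
  have Xi: "Xs ! i = indicator_rep (Ss ! i)" "Ss ! i \<in> spreads" if "i < length Xs" for i
    using that Ss by (auto simp: Xs_def)
  have rXs: "\<forall>Y\<in>set Xs. rep Y"
  proof
    fix Y assume "Y \<in> set Xs"
    then obtain S where "S \<in> spreads" "Y = indicator_rep S" using Ss by (auto simp: Xs_def)
    thus "rep Y" using rep_indicator[OF spreadsD(1)] by simp
  qed
  have rC: "rep C" unfolding C_def by (rule rep_dsum_list[OF rXs])
  obtain s r where s: "rhom X C s" and r: "rhom C X r" and rs: "\<forall>p\<in>P. \<forall>v\<in>carrier_vec (dm X p). r p *\<^sub>v (s p *\<^sub>v v) = v"
    using r unfolding retract_def Xs_def[symmetric] C_def[symmetric] by (elim exE conjE)
  let ?x = "unit_vec (dm X a) 0 :: 'k vec"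
  have x: "?x \<in> carrier_vec (dm X a)" by simp
  have x0: "?x \<noteq> 0\<^sub>v (dm X a)"
  proof
    assume "?x = 0\<^sub>v (dm X a)"
    hence "?x $ 0 = (0\<^sub>v (dm X a) :: 'k vec) $ 0" by simp
    thus False using d by simp
  qed
  \<comment> \<open>A nonzero vector fixed by the idempotent \<open>s r\<close> at
    \<open>a\<close>.\<close>
  define y where "y = s a *\<^sub>v ?x"
  have y: "y \<in> carrier_vec (dm C a)" unfolding y_def by (rule hom_vec[OF s a x])
  have ry: "r a *\<^sub>v y = ?x" unfolding y_def using rs a x by blast
  have y0: "y \<noteq> 0\<^sub>v (dm C a)" using ry x0 hom_zero_vec[OF r a] by auto
  define c where "c j = lprj Xs j a *\<^sub>v y" for j
  have yD: "y \<in> carrier_vec (dm (dsum_list Xs) a)" using y by (simp add: C_def)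
  have cc: "c j \<in> carrier_vec (dm (Xs ! j) a)" if "j < length Xs" for j
    unfolding c_def by (rule hom_vec[OF lprj_hom[OF rXs that] a yD])
  define J where "J = {j. j < length Xs \<and> c j \<noteq> 0\<^sub>v (dm (Xs ! j) a)}"
  have Jne: "\<exists>j. j \<in> J"
  proof (rule ccontr)
    assume "\<not> (\<exists>j. j \<in> J)"
    hence "y = 0\<^sub>v (dm (dsum_list Xs) a)" by (intro dsum_list_zero[OF rXs a yD]) (auto simp: J_def c_def)
    thus False using y0 by (simp add: C_def)
  qed
  \<comment> \<open>Counts the spreads linked to \<open>S\<close> at \<open>a\<close>; a link
    between different spreads strictly raises this number. Below, \<open>i\<close> is a nonzero
    component of \<open>y\<close> for which it is least.\<close>
  define hh where "hh S = card {T \<in> spreads. link a T S}" for S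
  define i where "i = arg_min (\<lambda>j. hh (Ss ! j)) (\<lambda>j. j \<in> J)"
  obtain j0 where "j0 \<in> J" using Jne by blast
  hence iJ: "i \<in> J" unfolding i_def by (rule arg_min_natI)
  have imin: "hh (Ss ! i) \<le> hh (Ss ! j)" if "j \<in> J" for j unfolding i_def using that by (rule arg_min_nat_le)
  have il: "i < length Xs" and ci: "c i \<noteq> 0\<^sub>v (dm (Xs ! i) a)" using iJ by (auto simp: J_def)
  note Si = Xi(2)[OF il]
  have li: "rhom C (Xs ! i) (lprj Xs i)" unfolding C_def by (rule lprj_hom[OF rXs il])
  have rXi: "rep (Xs ! i)" using rXs il by simp
  let ?v = "\<lambda>p. lprj Xs i p * s p"
  have v: "rhom X (Xs ! i) ?v" by (rule hom_comp[OF X rC rXi s li])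
  let ?e = "\<lambda>p. ?v p * r p"
  have e: "rhom C (Xs ! i) ?e" by (rule hom_comp[OF rC X rXi r v])
  have ey: "?e a *\<^sub>v y = c i"
    unfolding hom_comp_vec[OF r v a y] ry hom_comp_vec[OF s li a x] y_def[symmetric] c_def ..
  have ec: "?e a \<in> carrier_mat (dm (Xs ! i) a) (dm (dsum_list Xs) a)" using hom_mat[OF e a] by (simp add: C_def)
  \<comment> \<open>Row \<open>i\<close> of the idempotent recovers \<open>c i\<close> from the
    components of \<open>y\<close>, so some component \<open>j\<close> contributes. Its link to
    \<open>Ss ! i\<close> and the choice of \<open>i\<close> force the two sets to agree, possibly
    at different indices.\<close>
  have "\<exists>j<length Xs. ?e a *\<^sub>v (linj Xs j a *\<^sub>v c j) \<noteq> 0\<^sub>v (dm (Xs ! i) a)"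
  proof (rule ccontr)
    assume n: "\<not> (\<exists>j<length Xs. ?e a *\<^sub>v (linj Xs j a *\<^sub>v c j) \<noteq> 0\<^sub>v (dm (Xs ! i) a))"
    have "?e a *\<^sub>v y = 0\<^sub>v (dm (Xs ! i) a)"
      by (rule dsum_list_kill[OF rXs a yD ec]) (use n in \<open>simp add: c_def\<close>)
    thus False using ey ci by simp
  qed
  then obtain j where jl: "j < length Xs" and ej: "?e a *\<^sub>v (linj Xs j a *\<^sub>v c j) \<noteq> 0\<^sub>v (dm (Xs ! i) a)" by blast
  note Sj = Xi(2)[OF jl]
  have lj: "rhom (Xs ! j) C (linj Xs j)" unfolding C_def by (rule linj_hom[OF rXs jl])
  have rXj: "rep (Xs ! j)" using rXs jl by simp
  have cj0: "c j \<noteq> 0\<^sub>v (dm (Xs ! j) a)"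
  proof
    assume "c j = 0\<^sub>v (dm (Xs ! j) a)"
    hence "linj Xs j a *\<^sub>v c j = 0\<^sub>v (dm C a)" using hom_zero_vec[OF lj a] by simp
    thus False using ej hom_zero_vec[OF e a] by simp
  qed
  hence jJ: "j \<in> J" using jl by (simp add: J_def)
  have aj: "a \<in> Ss ! j"
  proof (rule ccontr)
    assume "a \<notin> Ss ! j"
    hence d0: "dm (Xs ! j) a = 0" using Xi(1)[OF jl] by (simp add: dm_indicator)
    show False using cj0 carrier_vec0[OF cc[OF jl, unfolded d0]] unfolding d0 by simp
  qed
  have c1: "c j \<in> carrier_vec 1" using cc[OF jl] aj Xi(1)[OF jl] by (simp add: dm_indicator)
  let ?u = "\<lambda>p. r p * linj Xs j p"
  have u: "rhom (Xs ! j) X ?u" by (rule hom_comp[OF rXj rC X lj r])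
  have vu: "?v a *\<^sub>v (?u a *\<^sub>v c j) \<noteq> 0\<^sub>v (dm (Xs ! i) a)"
    using ej unfolding hom_comp_vec[OF r v a hom_vec[OF lj a cc[OF jl]]] hom_comp_vec[OF lj r a cc[OF jl]] .
  have lk: "link a (Ss ! j) (Ss ! i)"
  proof -
    have cj: "convex P lq (Ss ! j)" and ci: "convex P lq (Ss ! i)" using spreadsD(1) Sj Si by auto
    have m: "rhom (pow_ind (Ss ! j) 1) (Xs ! i) (\<lambda>p. ?v p * ?u p)"
      using hom_comp[OF rXj X rXi u v] unfolding Xi(1)[OF jl] pow_ind_1 .
    have w: "vhom (Ss ! j) (Xs ! i) (\<lambda>p. (?v p * ?u p) *\<^sub>v c j)" by (rule vhom_of_hom[OF cj rXi m c1])
    have w': "vhom (Ss ! j) (pow_ind (Ss ! i) 1) (\<lambda>p. (?v p * ?u p) *\<^sub>v c j)" using w unfolding Xi(1)[OF il] pow_ind_1 .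
    show ?thesis
    proof (rule link_of_vhom[OF ci spreadsD(4)[OF Sj] w' aj])
      show "(?v a * ?u a) *\<^sub>v c j \<noteq> 0\<^sub>v (dm (pow_ind (Ss ! i) 1 :: ('p, 'k) prep) a)"
        using vu unfolding hom_comp_vec[OF u v a cc[OF jl]] Xi(1)[OF il] pow_ind_1 .
    qed
  qed
  have eq: "Ss ! j = Ss ! i"
  proof (rule ccontr)
    assume ne: "Ss ! j \<noteq> Ss ! i"
    have "hh (Ss ! j) < hh (Ss ! i)" unfolding hh_def
    proof (rule psubset_card_mono)
      show "finite {T \<in> spreads. link a T (Ss ! i)}" using finite_spreads by simp
      have ai: "a \<in> Ss ! i" using lk unfolding link_def by blast
      have "Ss ! i \<notin> {T \<in> spreads. link a T (Ss ! j)}"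
        using link_antisym[OF spreadsD(2)[OF Sj] spreadsD(2)[OF Si] lk] ne by blast
      moreover have "Ss ! i \<in> {T \<in> spreads. link a T (Ss ! i)}" using Si link_refl[OF ai] by simp
      moreover have "{T \<in> spreads. link a T (Ss ! j)} \<subseteq> {T \<in> spreads. link a T (Ss ! i)}" using link_trans[OF _ lk] by blast
      ultimately show "{T \<in> spreads. link a T (Ss ! j)} \<subset> {T \<in> spreads. link a T (Ss ! i)}" by blast
    qed
    thus False using imin[OF jJ] by simp
  qed
  have u': "rhom (indicator_rep (Ss ! j)) X ?u" using u unfolding Xi(1)[OF jl] .
  have v': "rhom X (indicator_rep (Ss ! j)) ?v" using v unfolding Xi(1)[OF il] eq .
  have "?v a *\<^sub>v (?u a *\<^sub>v c j) \<noteq> 0\<^sub>v 1" using vu aj unfolding Xi(1)[OF il] eq[symmetric] by (simp add: dm_indicator)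
  hence "a \<in> Ss ! j \<and> rhom (indicator_rep (Ss ! j)) X ?u \<and> rhom X (indicator_rep (Ss ! j)) ?v \<and>
     c j \<in> carrier_vec 1 \<and> ?v a *\<^sub>v (?u a *\<^sub>v c j) \<noteq> 0\<^sub>v 1" using aj u' v' c1 by blast
  thus ?thesis using Sj by (intro bexI[of _ "Ss ! j"] exI[of _ ?u] exI[of _ ?v] exI[of _ "c j"])
qed

text \<open>One indicator is split off at a time. The complement is a kernel, so it is again
  \<open>qconst\<close>, and it is a retract of the same sum. Its total dimension over
  \<open>Q\<close> drops at \<open>a\<close>: a kernel of full dimension there would force
  \<open>v'\<close> to vanish at \<open>a\<close>.\<close>

lemma retract_spread_sum:
  fixes X :: "('p, 'k::field) prep"
  assumes "qconst X" "set Ss \<subseteq> spreads" "retract X (dsum_list (map indicator_rep Ss))"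
  shows "\<exists>Ts. set Ts \<subseteq> spreads \<and> iso P lq X (dsum_list (map indicator_rep Ts))"
  using assms(1,3)
proof (induction "\<Sum>q\<in>Q. dm X q" arbitrary: X rule: less_induct)
  case less
  note rX = qconstD(1)[OF less.prems(1)]
  show ?case
  proof (cases "\<forall>q\<in>Q. dm X q = 0")
    case True
    have "iso P lq X zero_rep" by (rule iso_zero[OF rX qconst_eq_zero[OF less.prems(1)]]) (use True in auto)
    thus ?thesis by (intro exI[of _ "[]"]) simp
  next
    case False
    then obtain a where a: "a \<in> Q" "dm X a \<noteq> 0" by blast
    have aP: "a \<in> P" using a(1) QP by blast
    obtain S u v y where S: "S \<in> spreads" and aS: "a \<in> S" and u: "rhom (indicator_rep S) X u"
      and v: "rhom X (indicator_rep S) v" and y: "y \<in> carrier_vec 1" and nz: "v a *\<^sub>v (u a *\<^sub>v y) \<noteq> 0\<^sub>v 1"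
      using retract_spread_summand[OF rX assms(2) less.prems(2) aP a(2)] by (elim bexE exE conjE)
    let ?I = "indicator_rep S :: ('p, 'k) prep"
    have qI: "qconst ?I" unfolding pow_ind_1 by (rule qconst_pow_ind[OF spreadsD(1,3)[OF S]])
    note rI = qconstD(1)[OF qI]
    obtain v' where v': "rhom X ?I v'" and id: "\<forall>p\<in>P. \<forall>x\<in>carrier_vec (dm ?I p). v' p *\<^sub>v (u p *\<^sub>v x) = x"
      and nz': "v' a *\<^sub>v (u a *\<^sub>v y) \<noteq> 0\<^sub>v 1"
      using indicator_endo_scale[OF spreadsD(1,2)[OF S] rX u v aS y nz] by (elim exE conjE)
    obtain K i r where k: "ker_data X ?I v' K i r" using ker_exists[OF rX rI v'] by (elim exE)
    note kd = ker_dataD[OF k]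
    have so: "iso P lq X (dsum ?I K)" "retract K X"
      using split_off[OF rI rX u v' _ k] id by blast+
    have K: "qconst K" by (rule qconst_ker[OF k less.prems(1) qI v'])
    have rK: "retract K (dsum_list (map indicator_rep Ss))"
      by (rule retract_trans[OF kd(1) rX qconstD(1)[OF qconst_spread_sum[OF assms(2)]] so(2) less.prems(2)])
    have "(\<Sum>q\<in>Q. dm K q) < (\<Sum>q\<in>Q. dm X q)"
    proof (rule sum_strict_mono_ex1[OF finQ])
      show "\<forall>q\<in>Q. dm K q \<le> dm X q" using kd(7) QP by blast
      have ua: "u a *\<^sub>v y \<in> carrier_vec (dm X a)" by (rule hom_vec[OF u aP]) (use y aS in \<open>simp add: dm_indicator\<close>)
      have "dm K a \<noteq> dm X a"
      proof
        assume "dm K a = dm X a"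
        hence "v' a *\<^sub>v (u a *\<^sub>v y) = 0\<^sub>v (dm ?I a)" by (rule kd(8)[OF aP _ ua])
        thus False using nz' aS by (simp add: dm_indicator)
      qed
      thus "\<exists>q\<in>Q. dm K q < dm X q" using kd(7)[OF aP] a(1) by (intro bexI[of _ a]) simp_all
    qed
    then obtain Ts where Ts: "set Ts \<subseteq> spreads" "iso P lq K (dsum_list (map indicator_rep Ts))"
      using less.hyps[OF _ K rK] by blast
    note rT = qconstD(1)[OF qconst_spread_sum[OF Ts(1), where 'k = 'k]]
    have "iso P lq X (dsum ?I (dsum_list (map indicator_rep Ts)))"
      by (rule iso_trans[OF rX rep_dsum[OF rI kd(1)] rep_dsum[OF rI rT] so(1) iso_dsum_right[OF rI kd(1) rT Ts(2)]])
    thus ?thesis using Ts(1) S by (intro exI[of _ "S # Ts"]) simp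
  qed
qed

text \<open>The kernel sequence of the approximation belongs to the exact structure because it lifts
  morphisms from all convex sets, not only from the saturated ones. Projectivity then lifts the
  identity of \<open>X\<close>, which makes \<open>X\<close> a retract of a sum of spreads.\<close>

lemma E_projective_sum:
  fixes X :: "('p, 'k::field) prep"
  assumes X: "qconst X" and E: "E_projective P lq X"
  shows "\<exists>Ss. (\<forall>S\<in>set Ss. fp_spread P lq TYPE('k) S) \<and> iso P lq X (dsum_list (map indicator_rep Ss))"
proof -
  note rX = qconstD(1)[OF X]
  obtain Ss g K i r where Ss: "set Ss \<subseteq> spreads" and g0: "rhom (dsum_list (map indicator_rep Ss)) X g"
    and l0: "\<forall>S. convex P lq S \<longrightarrow> lifts (indicator_rep S) (dsum_list (map indicator_rep Ss)) g X"
    and s0: "pw_surj P (dsum_list (map indicator_rep Ss)) X g"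
    and k0: "ker_data (dsum_list (map indicator_rep Ss)) X g K i r" and K: "qconst K"
    using approximation_ker[OF X] by (elim exE conjE)
  define C where "C = (dsum_list (map indicator_rep Ss) :: ('p, 'k) prep)"
  note g = g0[folded C_def] and l = l0[folded C_def] and sj = s0[folded C_def] and k = k0[folded C_def]
  have C: "qconst C" unfolding C_def by (rule qconst_spread_sum[OF Ss])
  note kd = ker_dataD[OF k] and rC = qconstD(1)[OF C]
  have inj: "pw_inj P K C i" unfolding pw_inj_def
  proof (intro ballI impI)
    fix p v assume p: "p \<in> P" and v: "v \<in> carrier_vec (dm K p)" and z: "i p *\<^sub>v v = 0\<^sub>v (dm C p)"
    have "r p *\<^sub>v (i p *\<^sub>v v) = 0\<^sub>v (dm K p)" unfolding z by (rule mult_mat_zero_vec[OF kd(9)[OF p]])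
    thus "v = 0\<^sub>v (dm K p)" unfolding kd(4)[OF p v] .
  qed
  have ex: "exact_at P K C X i g" unfolding exact_at_def
  proof (intro ballI iffI)
    fix p w assume p: "p \<in> P" and w: "w \<in> carrier_vec (dm C p)" and z: "g p *\<^sub>v w = 0\<^sub>v (dm X p)"
    show "\<exists>v\<in>carrier_vec (dm K p). w = i p *\<^sub>v v"
      using kd(5)[OF p w z] kd(3)[OF p w] by (intro bexI[of _ "r p *\<^sub>v w"]) simp_all
  next
    fix p w assume p: "p \<in> P" and "\<exists>v\<in>carrier_vec (dm K p). w = i p *\<^sub>v v"
    thus "g p *\<^sub>v w = 0\<^sub>v (dm X p)" using kd(6)[OF p] by blast
  qed
  have se: "short_exact P lq K C X i g"
    unfolding short_exact_def using qconst_fin_pres[OF K] qconst_fin_pres[OF C] qconst_fin_pres[OF X] kd(2) g inj ex sj by blast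
  have "in_spread_E P lq K C X i g"
    unfolding in_spread_E_def
  proof (intro conjI allI impI)
    show "short_exact P lq K C X i g" by (rule se)
    fix S assume S: "fp_spread P lq TYPE('k) S"
    have c: "convex P lq S" using S by (auto simp: fp_spread_def spread_def)
    show "hom_exact P lq (indicator_rep S) K C X i g"
      by (rule hom_exact_of_lifts[OF se rep_indicator[OF c]]) (use l c in blast)
  qed
  hence "hom_exact P lq X K C X i g" using E unfolding E_projective_def by blast
  hence "lifts X C g X" by (rule lifts_of_hom_exact[OF _ g])
  then obtain s where s: "rhom X C s" "\<forall>p\<in>P. \<forall>v\<in>carrier_vec (dm X p). 1\<^sub>m (dm X p) *\<^sub>v v = g p *\<^sub>v (s p *\<^sub>v v)"
    unfolding lifts_def using hom_id[OF rX] by blast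
  have "retract X C" unfolding retract_def using s g by (intro exI[of _ s] exI[of _ g]) auto
  hence "\<exists>Ts. set Ts \<subseteq> spreads \<and> iso P lq X (dsum_list (map indicator_rep Ts))"
    unfolding C_def by (rule retract_spread_sum[OF X Ss])
  thus ?thesis using spreads_fp by blast
qed

end

section \<open>Grid posets\<close>

lemma (in qposet) fin_pres_qconst:
  assumes "rep M" "set as \<subseteq> Q" "set bs \<subseteq> Q"
    and "rhom (dsum_list (map (\<lambda>b. indicator_rep (upq b)) bs)) (dsum_list (map (\<lambda>a. indicator_rep (upq a)) as)) f"
    and "rhom (dsum_list (map (\<lambda>a. indicator_rep (upq a)) as)) M g"
    and "exact_at P (dsum_list (map (\<lambda>b. indicator_rep (upq b)) bs)) (dsum_list (map (\<lambda>a. indicator_rep (upq a)) as)) M f g"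
    and "pw_surj P (dsum_list (map (\<lambda>a. indicator_rep (upq a)) as)) M g"
  shows "qconst M"
  by (rule qconst_coker[OF qconst_up_list[OF assms(3)] qconst_up_list[OF assms(2)] assms(1,4-7)])

section \<open>Floors in products of chains\<close>

lemma total_order_onD:
  assumes "total_order_on A r"
  shows "x \<in> A \<Longrightarrow> r x x" "\<lbrakk>x \<in> A; y \<in> A; r x y; r y x\<rbrakk> \<Longrightarrow> x = y"
    "\<lbrakk>x \<in> A; y \<in> A; z \<in> A; r x y; r y z\<rbrakk> \<Longrightarrow> r x z" "\<lbrakk>x \<in> A; y \<in> A\<rbrakk> \<Longrightarrow> r x y \<or> r y x"
proof -
  note d = assms[unfolded total_order_on_def]
  show "x \<in> A \<Longrightarrow> r x x" by (rule d[THEN conjunct1, rule_format])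
  show "\<lbrakk>x \<in> A; y \<in> A; r x y; r y x\<rbrakk> \<Longrightarrow> x = y"
    by (rule d[THEN conjunct2, THEN conjunct1, rule_format]) simp_all
  show "\<lbrakk>x \<in> A; y \<in> A; z \<in> A; r x y; r y z\<rbrakk> \<Longrightarrow> r x z"
    by (rule d[THEN conjunct2, THEN conjunct2, THEN conjunct1, rule_format, of x y z]) simp_all
  show "\<lbrakk>x \<in> A; y \<in> A\<rbrakk> \<Longrightarrow> r x y \<or> r y x"
    by (rule d[THEN conjunct2, THEN conjunct2, THEN conjunct2, rule_format])
qed

lemma total_order_max:
  assumes "finite A" "A \<noteq> {}" "A \<subseteq> S" "total_order_on S r"
  shows "\<exists>m\<in>A. \<forall>x\<in>A. r x m"
  using assms(1-3)
proof (induction A rule: finite_ne_induct)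
  case (singleton x)
  thus ?case using assms(4) by (simp add: total_order_on_def)
next
  case (insert y A)
  then obtain m where m: "m \<in> A" "\<forall>x\<in>A. r x m" by auto
  have S: "y \<in> S" "m \<in> S" "A \<subseteq> S" using insert.prems m by auto
  note tot = total_order_onD(4)[OF assms(4) S(1,2)] and rf = total_order_onD(1)[OF assms(4) S(1)]
  show ?case
  proof (cases "r y m")
    case True thus ?thesis using m by (intro bexI[of _ m]) auto
  next
    case False
    hence my: "r m y" using tot by simp
    have "r x y" if x: "x \<in> A" for x
    proof -
      have xS: "x \<in> S" using x S(3) by auto
      show ?thesis by (rule total_order_onD(3)[OF assms(4) xS S(2,1) _ my]) (use m(2) x in simp)
    qed
    thus ?thesis using rf by (intro bexI[of _ y]) auto
  qed
qed

locale grid =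
  fixes n :: nat and T :: "nat \<Rightarrow> 'a set" and leT :: "nat \<Rightarrow> 'a \<Rightarrow> 'a \<Rightarrow> bool"
  assumes tot: "\<forall>i<n. total_order_on (T i) (leT i)"
begin

abbreviation "G \<equiv> grid_carrier n T"
abbreviation "gle \<equiv> grid_le n leT"

lemmas t_refl = total_order_onD(1)[OF tot[rule_format]]
  and t_antisym = total_order_onD(2)[OF tot[rule_format]]
  and t_trans = total_order_onD(3)[OF tot[rule_format]]
  and t_total = total_order_onD(4)[OF tot[rule_format]]

lemma G_coord: "p \<in> G \<Longrightarrow> i < n \<Longrightarrow> p i \<in> T i"
  by (auto simp: grid_carrier_def)

lemma grid_rposet: "rposet G gle"
proof
  show "gle p p" if "p \<in> G" for p using that t_refl G_coord by (simp add: grid_le_def)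
  show "gle p r" if "p \<in> G" "q \<in> G" "r \<in> G" "gle p q" "gle q r" for p q r
    unfolding grid_le_def
  proof (intro allI impI)
    fix i assume i: "i < n"
    show "leT i (p i) (r i)"
      by (rule t_trans[OF i G_coord[OF that(1) i] G_coord[OF that(2) i] G_coord[OF that(3) i]])
        (use that i in \<open>simp_all add: grid_le_def\<close>)
  qed
  show "p = q" if "p \<in> G" "q \<in> G" "gle p q" "gle q p" for p q
  proof (rule PiE_ext)
    show "p \<in> PiE {..<n} T" "q \<in> PiE {..<n} T" using that by (simp_all add: grid_carrier_def)
    fix i assume "i \<in> {..<n}"
    hence i: "i < n" by simp
    show "p i = q i"
      by (rule t_antisym[OF i G_coord[OF that(1) i] G_coord[OF that(2) i]])
        (use that i in \<open>simp_all add: grid_le_def\<close>)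
  qed
qed

text \<open>Q is the finite subgrid spanned by A, and the floor map rounds every coordinate down to it.\<close>

lemma grid_qposet:
  assumes A: "finite A" "A \<subseteq> G"
  shows "\<exists>Q fl. qposet G gle Q fl \<and> A \<subseteq> Q"
proof -
  define C where "C i = (\<lambda>x. x i) ` A" for i
  define Q where "Q = PiE {..<n} C"
  define B where "B p i m \<longleftrightarrow> m \<in> C i \<and> leT i m (p i) \<and> (\<forall>x\<in>C i. leT i x (p i) \<longrightarrow> leT i x m)" for p i m
  define fl where "fl p = (\<lambda>i\<in>{..<n}. SOME m. B p i m)" for p
  have C: "finite (C i)" for i using A by (simp add: C_def)
  have CT: "C i \<subseteq> T i" if "i < n" for i using A(2) G_coord that by (auto simp: C_def)
  have QG: "Q \<subseteq> G" using CT unfolding Q_def grid_carrier_def by (intro PiE_mono) auto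
  have Qc: "q i \<in> C i" if "q \<in> Q" "i < n" for q i using that by (auto simp: Q_def)
  have B: "B p i (fl p i)" if p: "p \<in> G" and q: "q \<in> Q" "gle q p" and i: "i < n" for p q i
  proof -
    let ?D = "{x \<in> C i. leT i x (p i)}"
    have "q i \<in> ?D" using Qc[OF q(1) i] q(2) i by (simp add: grid_le_def)
    hence "?D \<noteq> {}" by blast
    moreover have "finite ?D" "?D \<subseteq> T i" using C CT[OF i] by auto
    ultimately obtain m where "m \<in> ?D" "\<forall>x\<in>?D. leT i x m"
      using total_order_max[of ?D "T i" "leT i"] tot i by blast
    hence "B p i m" by (simp add: B_def)
    hence "B p i (SOME m. B p i m)" by (rule someI)
    thus ?thesis using i by (simp add: fl_def)
  qed
  have flQ: "fl p \<in> Q" if "p \<in> G" "q \<in> Q" "gle q p" for p q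
  proof -
    have "fl p i \<in> C i" if i: "i < n" for i using B[OF \<open>p \<in> G\<close> \<open>q \<in> Q\<close> \<open>gle q p\<close> i] by (simp add: B_def)
    thus ?thesis unfolding Q_def fl_def by (auto simp: PiE_def)
  qed
  have "qposet G gle Q fl"
  proof (intro qposet.intro grid_rposet qposet_axioms.intro)
    show "finite Q" unfolding Q_def using C by (intro finite_PiE) auto
    show "Q \<subseteq> G" by (rule QG)
    fix p q assume h: "p \<in> G" "q \<in> Q" "gle q p"
    have "gle (fl p) p" "gle q (fl p)"
      using B[OF h] Qc[OF h(2)] h(3) by (simp_all add: grid_le_def B_def)
    thus "fl p \<in> Q \<and> gle (fl p) p \<and> gle q (fl p)" using flQ[OF h] by simp
  next
    fix z z' assume z: "z \<in> G" "z' \<in> G" and ex: "\<exists>q\<in>Q. gle q z" "\<exists>q\<in>Q. gle q z'" and gle': "gle (fl z) (fl z')"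
    obtain q q' where q: "q \<in> Q" "gle q z" and q': "q' \<in> Q" "gle q' z'" using ex by blast
    \<comment> \<open>The coordinatewise maximum. Each of its coordinates comes from
      \<open>z\<close> or from \<open>z'\<close>, hence so does each coordinate of its
      floor.\<close>
    define w where "w = (\<lambda>i\<in>{..<n}. if leT i (z i) (z' i) then z' i else z i)"
    have wi: "w i = (if leT i (z i) (z' i) then z' i else z i)" if "i < n" for i using that by (simp add: w_def)
    have wG: "w \<in> G" using z G_coord unfolding w_def grid_carrier_def by (auto simp: PiE_def)
    have zw: "gle z w" unfolding grid_le_def using wi t_refl G_coord z by simp
    have z'w: "gle z' w" unfolding grid_le_def
    proof (intro allI impI)
      fix i assume i: "i < n"
      show "leT i (z' i) (w i)"
        using t_total[OF i G_coord[OF z(1) i] G_coord[OF z(2) i]] t_refl[OF i G_coord[OF z(2) i]] wi[OF i] by auto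
    qed
    have qw: "gle q' w" by (rule rposet.trans[OF grid_rposet, OF _ z(2) wG q'(2) z'w]) (use q' QG in blast)
    note bz = B[OF z(1) q] and bz' = B[OF z(2) q'] and bw = B[OF wG q'(1) qw]
    have Gf: "fl z \<in> G" "fl z' \<in> G" "fl w \<in> G" using flQ[OF z(1) q] flQ[OF z(2) q'] flQ[OF wG q'(1) qw] QG by auto
    have "fl w = fl z'"
    proof (rule PiE_ext)
      show "fl w \<in> PiE {..<n} T" "fl z' \<in> PiE {..<n} T" using Gf by (simp_all add: grid_carrier_def)
      fix i assume "i \<in> {..<n}"
      hence i: "i < n" by simp
      note g = G_coord[OF Gf(1) i] G_coord[OF Gf(2) i] G_coord[OF Gf(3) i] G_coord[OF z(1) i] G_coord[OF z(2) i] G_coord[OF wG i]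
      have "leT i (fl z' i) (w i)"
        by (rule t_trans[OF i g(2) g(5) g(6)]) (use bz'[OF i] z'w i in \<open>simp_all add: B_def grid_le_def\<close>)
      hence 1: "leT i (fl z' i) (fl w i)" using bz'[OF i] bw[OF i] by (simp add: B_def)
      \<comment> \<open>Where \<open>w\<close> takes its coordinate from \<open>z\<close>, the floor
        is that of \<open>z\<close>, and the assumed comparison of floors bounds it by that of
        \<open>z'\<close>.\<close>
      have 2: "leT i (fl w i) (fl z' i)"
      proof (cases "leT i (z i) (z' i)")
        case True
        thus ?thesis using bw[OF i] bz'[OF i] wi[OF i] by (simp add: B_def)
      next
        case False
        hence "leT i (fl w i) (fl z i)" using bw[OF i] bz[OF i] wi[OF i] by (simp add: B_def)
        thus ?thesis using t_trans[OF i g(3) g(1) g(2)] gle' i by (simp add: grid_le_def)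
      qed
      show "fl w i = fl z' i" by (rule t_antisym[OF i g(3) g(2) 2 1])
    qed
    thus "\<exists>w\<in>G. gle z w \<and> gle z' w \<and> fl w = fl z'" using wG zw z'w by blast
  qed
  moreover have "A \<subseteq> Q"
  proof
    fix x assume x: "x \<in> A"
    hence "x \<in> PiE {..<n} T" using A(2) by (auto simp: grid_carrier_def)
    thus "x \<in> Q" using x unfolding Q_def C_def by (auto simp: PiE_def)
  qed
  ultimately show ?thesis by blast
qed

text \<open>\<open>Q\<close> is spanned by the degrees of the generators and relations of a
  presentation. Both terms are then \<open>qconst\<close>, and so is their cokernel.\<close>

lemma fin_pres_grid:
  fixes M :: "(nat \<Rightarrow> 'a, 'k::field) prep"
  assumes "fin_pres G gle M"
  shows "\<exists>Q fl. qposet G gle Q fl \<and> qposet.qconst G gle Q fl M"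
proof -
  obtain as bs f g where M: "is_rep G gle M" and ab: "set as \<subseteq> G" "set bs \<subseteq> G" and h:
    "is_hom G gle (dsum_list (map (\<lambda>b. indicator_rep (up G gle {b})) bs)) (dsum_list (map (\<lambda>a. indicator_rep (up G gle {a})) as)) f"
    "is_hom G gle (dsum_list (map (\<lambda>a. indicator_rep (up G gle {a})) as)) M g"
    "exact_at G (dsum_list (map (\<lambda>b. indicator_rep (up G gle {b})) bs)) (dsum_list (map (\<lambda>a. indicator_rep (up G gle {a})) as)) M f g"
    "pw_surj G (dsum_list (map (\<lambda>a. indicator_rep (up G gle {a})) as)) M g"
    using assms unfolding fin_pres_def Let_def by (elim exE conjE)
  obtain Q fl where Q: "qposet G gle Q fl" "set as \<union> set bs \<subseteq> Q"
    using grid_qposet[of "set as \<union> set bs"] ab by auto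
  have "qposet.qconst G gle Q fl M"
    by (rule qposet.fin_pres_qconst[OF Q(1) M _ _ h]) (use Q(2) in auto)
  thus ?thesis using Q(1) by blast
qed

end

theorem theoremA:
  fixes n :: nat and T :: "nat \<Rightarrow> 'a set" and leT :: "nat \<Rightarrow> 'a \<Rightarrow> 'a \<Rightarrow> bool"
  assumes "\<forall>i<n. total_order_on (T i) (leT i)"
  shows "(\<forall>X :: (nat \<Rightarrow> 'a, 'k::field) prep.
            fin_pres (grid_carrier n T) (grid_le n leT) X \<longrightarrow>
            (E_projective (grid_carrier n T) (grid_le n leT) X \<longleftrightarrow>
             (\<exists>Ss. (\<forall>S\<in>set Ss. fp_spread (grid_carrier n T) (grid_le n leT) TYPE('k) S) \<and>
                   iso (grid_carrier n T) (grid_le n leT) X (dsum_list (map indicator_rep Ss)))))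
       \<and> (\<forall>M :: (nat \<Rightarrow> 'a, 'k) prep.
            fin_pres (grid_carrier n T) (grid_le n leT) M \<longrightarrow>
            has_finite_spread_res (grid_carrier n T) (grid_le n leT) M)"
proof -
  interpret grid n T leT by (unfold_locales) (rule assms)
  show ?thesis
  proof (intro conjI allI impI)
    fix X :: "(nat \<Rightarrow> 'a, 'k) prep" assume X: "fin_pres G gle X"
    \<comment> \<open>Every representation brings its own \<open>Q\<close>; the conclusions drawn
      over it no longer mention it.\<close>
    obtain Q fl where Q: "qposet G gle Q fl" "qposet.qconst G gle Q fl X" using fin_pres_grid[OF X] by blast
    show "E_projective G gle X \<longleftrightarrow> (\<exists>Ss. (\<forall>S\<in>set Ss. fp_spread G gle TYPE('k) S) \<and> iso G gle X (dsum_list (map indicator_rep Ss)))"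
    proof
      assume "E_projective G gle X"
      thus "\<exists>Ss. (\<forall>S\<in>set Ss. fp_spread G gle TYPE('k) S) \<and> iso G gle X (dsum_list (map indicator_rep Ss))"
        by (rule qposet.E_projective_sum[OF Q])
    next
      assume "\<exists>Ss. (\<forall>S\<in>set Ss. fp_spread G gle TYPE('k) S) \<and> iso G gle X (dsum_list (map indicator_rep Ss))"
      then obtain Ss where "\<forall>S\<in>set Ss. fp_spread G gle TYPE('k) S" "iso G gle X (dsum_list (map indicator_rep Ss))" by blast
      thus "E_projective G gle X"
        by (rule rposet.E_projective_spread_sum[OF grid_rposet rposet.fin_pres_rep[OF grid_rposet X]])
    qed
  next
    fix M :: "(nat \<Rightarrow> 'a, 'k) prep" assume M: "fin_pres G gle M"
    obtain Q fl where Q: "qposet G gle Q fl" "qposet.qconst G gle Q fl M" using fin_pres_grid[OF M] by blast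
    show "has_finite_spread_res G gle M" by (rule qposet.qconst_resolution[OF Q])
  qed
qed

end
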